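(* Let $c\colon I\to(M,g)$ be a (nonconstant) geodesic in an $n$-dimensional Riemannian manifold, let $\Lambda$ be an $(n-1)$-dimensional vector space of normal Jacobi fields along $c$ for which the corresponding Riccati operator is self adjoint, and let $\Upsilon\subset\Lambda$ be a vector subspace. Let $T^\perp_{c(t)}M$, the projection $v\mapsto v^\perp$, the maps $A_t$ and the operator $\tfrac{\nabla^\perp}{\partial t}$ be defined from $\Lambda$ and $\Upsilon$ as in the context. Let $J\in\Lambda-\Upsilon$ and put $Y(t):=J^\perp(t)=(J(t))^\perp$. Then $Y$ satisfies the Jacobi equation $$\tfrac{(\nabla^{\perp})^2}{\partial t^2}Y(t)+\bigl(R(Y(t),\dot c(t))\dot c(t)\bigr)^{\perp}+3A_tA_t^*Y(t)=0 .$$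
   Context: The Riccati operator of $\Lambda$ is the endomorphism $L(t)$ of $(\dot c(t))^\perp$ defined (at those $t$ where $J\mapsto J(t)$ is an isomorphism $\Lambda\to(\dot c(t))^\perp$; then $L$ is called non-singular at $t$) by $L(t)J(t)=J'(t)$ for $J\in\Lambda$. Its self-adjointness means $\langle J_1'(t),J_2(t)\rangle=\langle J_1(t),J_2'(t)\rangle$ for all $J_1,J_2\in\Lambda$ and all $t$. Put $$T^v_{c(t)}M:=\{J(t)\mid J\in\Upsilon\}\oplus\{J'(t)\mid J\in\Upsilon,\ J(t)=0\};$$ the second summand vanishes for almost every $t$ and $T^v_{c(t)}M$ depends smoothly on $t$. $T^\perp_{c(t)}M$ is the orthogonal complement of $T^v_{c(t)}M$ in $T_{c(t)}M$, and for $v\in T_{c(t)}M$, $v^\perp$ is the orthogonal projection of $v$ to $T^\perp_{c(t)}M$. If $L$ is non-singular at $t$, define $A_t\colon T^v_{c(t)}M\to T^\perp_{c(t)}M$ by $J(t)\mapsto J'(t)^\perp$ for $J\in\Upsilon$; $A$ extends continuously to all of $I$, and $A_t^*$ denotes the adjoint. For a vector field $X(t)\in T^\perp_{c(t)}M$ along $c$, $\tfrac{\nabla^\perp X}{\partial t}:=(X'(t))^\perp$. Primes denote covariant derivatives along $c$. The sign convention for $R$ is such that the Jacobi equation is $J''+R(J,\dot c)\dot c=0$. *)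

theory Defs
  imports "HOL-Analysis.Analysis" "HOL-Library.Function_Algebras"
begin

section \<open>Pointwise vector space structure on functions\<close>

text \<open>
  Tangent vectors and vector fields along curves are functions below. With this instance
  the library notions \<^term>\<open>subspace\<close> and \<^term>\<open>dim\<close> apply to sets of them.
\<close>

instantiation "fun" :: (type, scaleR) scaleR
begin

definition scaleR_fun :: "real \<Rightarrow> ('a \<Rightarrow> 'b) \<Rightarrow> 'a \<Rightarrow> 'b" where
  "scaleR_fun r f = (\<lambda>x. r *\<^sub>R f x)"

instance ..

end

instance "fun" :: (type, real_vector) real_vector
  by standard
    (simp_all add: scaleR_fun_def plus_fun_def fun_eq_iff scaleR_add_right scaleR_add_left)


section \<open>Smooth maps\<close>

text \<open>
  Used only for open sets \<open>S\<close> and for relatively open subsets \<open>S\<close> of a nondegenerate real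
  interval; in both cases the derivative within \<open>S\<close> is unique, and at an end point of an
  interval it is the one-sided derivative.
\<close>

primrec Ck_on :: "nat \<Rightarrow> 'a::euclidean_space set \<Rightarrow> ('a \<Rightarrow> 'b::euclidean_space) \<Rightarrow> bool" where
  "Ck_on 0 S f \<longleftrightarrow> continuous_on S f"
| "Ck_on (Suc k) S f \<longleftrightarrow>
     f differentiable_on S \<and> (\<forall>v. Ck_on k S (\<lambda>x. frechet_derivative f (at x within S) v))"

definition smooth_on :: "'a::euclidean_space set \<Rightarrow> ('a \<Rightarrow> 'b::euclidean_space) \<Rightarrow> bool" where
  "smooth_on S f \<longleftrightarrow> (\<forall>k. Ck_on k S f)"


section \<open>Smooth manifolds and tangent spaces\<close>

text \<open>
  A chart is a domain together with a coordinate map (whose values off the domain are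
  irrelevant). A manifold is given by a smooth atlas; its points are the union of the chart
  domains and its dimension is that of the model space \<open>'e\<close>.
\<close>

type_synonym ('m, 'e) chart = "'m set \<times> ('m \<Rightarrow> 'e)"

abbreviation chart_dom :: "('m, 'e) chart \<Rightarrow> 'm set" where
  "chart_dom \<equiv> fst"

abbreviation coord :: "('m, 'e) chart \<Rightarrow> 'm \<Rightarrow> 'e" where
  "coord \<equiv> snd"

definition chart_inv :: "('m, 'e) chart \<Rightarrow> 'e \<Rightarrow> 'm" where
  "chart_inv \<kappa> = inv_into (chart_dom \<kappa>) (coord \<kappa>)"

definition smooth_atlas ::
  "('m::{t2_space,second_countable_topology}, 'e::euclidean_space) chart set \<Rightarrow> bool" where
  "smooth_atlas \<A> \<longleftrightarrow>
     (\<forall>\<kappa>\<in>\<A>. open (chart_dom \<kappa>) \<and> open (coord \<kappa> ` chart_dom \<kappa>) \<and>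
        homeomorphism (chart_dom \<kappa>) (coord \<kappa> ` chart_dom \<kappa>) (coord \<kappa>) (chart_inv \<kappa>)) \<and>
     (\<forall>\<kappa>\<in>\<A>. \<forall>\<kappa>'\<in>\<A>.
        smooth_on (coord \<kappa> ` (chart_dom \<kappa> \<inter> chart_dom \<kappa>')) (coord \<kappa>' \<circ> chart_inv \<kappa>))"

definition points :: "('m, 'e) chart set \<Rightarrow> 'm set" where
  "points \<A> = (\<Union>\<kappa>\<in>\<A>. chart_dom \<kappa>)"

definition charts_at :: "('m, 'e) chart set \<Rightarrow> 'm \<Rightarrow> ('m, 'e) chart set" where
  "charts_at \<A> p = {\<kappa>\<in>\<A>. p \<in> chart_dom \<kappa>}"

text \<open>
  A tangent vector at \<open>p\<close> is the family of its coordinate vectors in the charts around \<open>p\<close>,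
  related by the differentials of the chart transitions. It is \<open>0\<close> on all other charts so
  that it is determined by these coordinates.
\<close>

type_synonym ('m, 'e) tvec = "('m, 'e) chart \<Rightarrow> 'e"

definition transition_deriv ::
  "('m, 'e::euclidean_space) chart \<Rightarrow> ('m, 'e) chart \<Rightarrow> 'm \<Rightarrow> 'e \<Rightarrow> 'e" where
  "transition_deriv \<kappa> \<kappa>' p = frechet_derivative (coord \<kappa>' \<circ> chart_inv \<kappa>) (at (coord \<kappa> p))"

definition tangent_space ::
  "('m, 'e::euclidean_space) chart set \<Rightarrow> 'm \<Rightarrow> ('m, 'e) tvec set" where
  "tangent_space \<A> p =
     {v. (\<forall>\<kappa>. \<kappa> \<notin> charts_at \<A> p \<longrightarrow> v \<kappa> = 0) \<and>
         (\<forall>\<kappa>\<in>charts_at \<A> p. \<forall>\<kappa>'\<in>charts_at \<A> p. v \<kappa>' = transition_deriv \<kappa> \<kappa>' p (v \<kappa>))}"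

definition coord_tvec ::
  "('m, 'e::euclidean_space) chart set \<Rightarrow> ('m, 'e) chart \<Rightarrow> 'm \<Rightarrow> 'e \<Rightarrow> ('m, 'e) tvec" where
  "coord_tvec \<A> \<kappa> p a = (\<lambda>\<kappa>'. if \<kappa>' \<in> charts_at \<A> p then transition_deriv \<kappa> \<kappa>' p a else 0)"


section \<open>Riemannian metrics, Christoffel symbols and curvature\<close>

type_synonym ('m, 'e) metric = "'m \<Rightarrow> ('m, 'e) tvec \<Rightarrow> ('m, 'e) tvec \<Rightarrow> real"

definition metric_in_chart ::
  "('m, 'e::euclidean_space) chart set \<Rightarrow> ('m, 'e) metric \<Rightarrow> ('m, 'e) chart
   \<Rightarrow> 'e \<Rightarrow> 'e \<Rightarrow> 'e \<Rightarrow> real" where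
  "metric_in_chart \<A> g \<kappa> x a b =
     (let p = chart_inv \<kappa> x in g p (coord_tvec \<A> \<kappa> p a) (coord_tvec \<A> \<kappa> p b))"

definition riemannian_manifold ::
  "('m::{t2_space,second_countable_topology}, 'e::euclidean_space) chart set
   \<Rightarrow> ('m, 'e) metric \<Rightarrow> bool" where
  "riemannian_manifold \<A> g \<longleftrightarrow>
     smooth_atlas \<A> \<and>
     (\<forall>p\<in>points \<A>.
        (\<forall>u\<in>tangent_space \<A> p. \<forall>v\<in>tangent_space \<A> p. \<forall>w\<in>tangent_space \<A> p.
           g p (u + v) w = g p u w + g p v w) \<and>
        (\<forall>r. \<forall>u\<in>tangent_space \<A> p. \<forall>v\<in>tangent_space \<A> p. g p (r *\<^sub>R u) v = r * g p u v) \<and>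
        (\<forall>u\<in>tangent_space \<A> p. \<forall>v\<in>tangent_space \<A> p. g p u v = g p v u) \<and>
        (\<forall>u\<in>tangent_space \<A> p. u \<noteq> 0 \<longrightarrow> g p u u > 0)) \<and>
     (\<forall>\<kappa>\<in>\<A>. \<forall>a b. smooth_on (coord \<kappa> ` chart_dom \<kappa>) (\<lambda>x. metric_in_chart \<A> g \<kappa> x a b))"

text \<open>
  The bilinear Christoffel map of the Levi-Civita connection in a chart: with respect to the
  constant coordinate fields \<open>a\<close>, \<open>b\<close> it is the coordinate vector of \<open>\<nabla>\<^sub>a b\<close>, determined by
  the Koszul formula.
\<close>

definition christoffel ::
  "('m, 'e::euclidean_space) chart set \<Rightarrow> ('m, 'e) metric \<Rightarrow> ('m, 'e) chart
   \<Rightarrow> 'e \<Rightarrow> 'e \<Rightarrow> 'e \<Rightarrow> 'e" where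
  "christoffel \<A> g \<kappa> x a b =
     (THE u. \<forall>d. 2 * metric_in_chart \<A> g \<kappa> x u d =
          frechet_derivative (\<lambda>y. metric_in_chart \<A> g \<kappa> y b d) (at x) a
        + frechet_derivative (\<lambda>y. metric_in_chart \<A> g \<kappa> y a d) (at x) b
        - frechet_derivative (\<lambda>y. metric_in_chart \<A> g \<kappa> y a b) (at x) d)"

text \<open>
  \<open>R(u,v)w = \<nabla>\<^sub>u \<nabla>\<^sub>v w - \<nabla>\<^sub>v \<nabla>\<^sub>u w - \<nabla>\<^sub>[\<^sub>u\<^sub>,\<^sub>v\<^sub>] w\<close>, evaluated on constant coordinate fields. This
  is the sign for which the Jacobi equation is \<open>J'' + R(J, c')c' = 0\<close>.
\<close>

definition curvature_in_chart ::
  "('m, 'e::euclidean_space) chart set \<Rightarrow> ('m, 'e) metric \<Rightarrow> ('m, 'e) chart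
   \<Rightarrow> 'e \<Rightarrow> 'e \<Rightarrow> 'e \<Rightarrow> 'e \<Rightarrow> 'e" where
  "curvature_in_chart \<A> g \<kappa> x u v w =
       frechet_derivative (\<lambda>y. christoffel \<A> g \<kappa> y v w) (at x) u
     - frechet_derivative (\<lambda>y. christoffel \<A> g \<kappa> y u w) (at x) v
     + christoffel \<A> g \<kappa> x u (christoffel \<A> g \<kappa> x v w)
     - christoffel \<A> g \<kappa> x v (christoffel \<A> g \<kappa> x u w)"

definition curvature ::
  "('m, 'e::euclidean_space) chart set \<Rightarrow> ('m, 'e) metric \<Rightarrow> 'm
   \<Rightarrow> ('m, 'e) tvec \<Rightarrow> ('m, 'e) tvec \<Rightarrow> ('m, 'e) tvec \<Rightarrow> ('m, 'e) tvec" where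
  "curvature \<A> g p u v w =
     (\<lambda>\<kappa>. if \<kappa> \<in> charts_at \<A> p
           then curvature_in_chart \<A> g \<kappa> (coord \<kappa> p) (u \<kappa>) (v \<kappa>) (w \<kappa>) else 0)"


section \<open>Curves, geodesics and Jacobi fields\<close>

text \<open>
  \<open>I\<close> is the parameter interval, with any combination of open and closed ends. In the
  following derivatives the curve stays in the chart domain for parameters near \<open>t\<close>.
\<close>

definition smooth_curve ::
  "('m::topological_space, 'e::euclidean_space) chart set \<Rightarrow> real set \<Rightarrow> (real \<Rightarrow> 'm) \<Rightarrow> bool" where
  "smooth_curve \<A> I c \<longleftrightarrow>
     continuous_on I c \<and> c ` I \<subseteq> points \<A> \<and>
     (\<forall>\<kappa>\<in>\<A>. smooth_on {t\<in>I. c t \<in> chart_dom \<kappa>} (\<lambda>t. coord \<kappa> (c t)))"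

definition velocity ::
  "('m, 'e::euclidean_space) chart set \<Rightarrow> real set \<Rightarrow> (real \<Rightarrow> 'm) \<Rightarrow> real \<Rightarrow> ('m, 'e) tvec" where
  "velocity \<A> I c t =
     (\<lambda>\<kappa>. if \<kappa> \<in> charts_at \<A> (c t)
           then vector_derivative (\<lambda>s. coord \<kappa> (c s)) (at t within I) else 0)"

definition cov_deriv ::
  "('m, 'e::euclidean_space) chart set \<Rightarrow> ('m, 'e) metric \<Rightarrow> real set \<Rightarrow> (real \<Rightarrow> 'm)
   \<Rightarrow> (real \<Rightarrow> ('m, 'e) tvec) \<Rightarrow> real \<Rightarrow> ('m, 'e) tvec" where
  "cov_deriv \<A> g I c X t =
     (\<lambda>\<kappa>. if \<kappa> \<in> charts_at \<A> (c t)
           then vector_derivative (\<lambda>s. X s \<kappa>) (at t within I)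
                + christoffel \<A> g \<kappa> (coord \<kappa> (c t)) (velocity \<A> I c t \<kappa>) (X t \<kappa>)
           else 0)"

definition cov_differentiable ::
  "('m, 'e::euclidean_space) chart set \<Rightarrow> real set \<Rightarrow> (real \<Rightarrow> 'm)
   \<Rightarrow> (real \<Rightarrow> ('m, 'e) tvec) \<Rightarrow> real \<Rightarrow> bool" where
  "cov_differentiable \<A> I c X t \<longleftrightarrow>
     (\<forall>\<kappa>\<in>charts_at \<A> (c t). (\<lambda>s. X s \<kappa>) differentiable (at t within I))"

definition geodesic ::
  "('m::topological_space, 'e::euclidean_space) chart set \<Rightarrow> ('m, 'e) metric
   \<Rightarrow> real set \<Rightarrow> (real \<Rightarrow> 'm) \<Rightarrow> bool" where
  "geodesic \<A> g I c \<longleftrightarrow>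
     smooth_curve \<A> I c \<and> (\<forall>t\<in>I. cov_deriv \<A> g I c (velocity \<A> I c) t = 0)"

text \<open>
  Fields along \<open>c\<close> vanish outside \<open>I\<close> by convention, so that two fields are equal iff they
  agree on \<open>I\<close>; otherwise dimensions of spaces of fields would be wrong.
\<close>

definition smooth_field_along ::
  "('m, 'e::euclidean_space) chart set \<Rightarrow> real set \<Rightarrow> (real \<Rightarrow> 'm)
   \<Rightarrow> (real \<Rightarrow> ('m, 'e) tvec) \<Rightarrow> bool" where
  "smooth_field_along \<A> I c X \<longleftrightarrow>
     (\<forall>t\<in>I. X t \<in> tangent_space \<A> (c t)) \<and> (\<forall>t. t \<notin> I \<longrightarrow> X t = 0) \<and>
     (\<forall>\<kappa>\<in>\<A>. smooth_on {t\<in>I. c t \<in> chart_dom \<kappa>} (\<lambda>t. X t \<kappa>))"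

definition jacobi_field ::
  "('m, 'e::euclidean_space) chart set \<Rightarrow> ('m, 'e) metric \<Rightarrow> real set \<Rightarrow> (real \<Rightarrow> 'm)
   \<Rightarrow> (real \<Rightarrow> ('m, 'e) tvec) \<Rightarrow> bool" where
  "jacobi_field \<A> g I c J \<longleftrightarrow>
     smooth_field_along \<A> I c J \<and>
     (\<forall>t\<in>I. cov_deriv \<A> g I c (cov_deriv \<A> g I c J) t
            + curvature \<A> g (c t) (J t) (velocity \<A> I c t) (velocity \<A> I c t) = 0)"

definition normal_space ::
  "('m, 'e::euclidean_space) chart set \<Rightarrow> ('m, 'e) metric \<Rightarrow> real set \<Rightarrow> (real \<Rightarrow> 'm)
   \<Rightarrow> real \<Rightarrow> ('m, 'e) tvec set" where
  "normal_space \<A> g I c t = {v \<in> tangent_space \<A> (c t). g (c t) v (velocity \<A> I c t) = 0}"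

definition normal_jacobi_field ::
  "('m, 'e::euclidean_space) chart set \<Rightarrow> ('m, 'e) metric \<Rightarrow> real set \<Rightarrow> (real \<Rightarrow> 'm)
   \<Rightarrow> (real \<Rightarrow> ('m, 'e) tvec) \<Rightarrow> bool" where
  "normal_jacobi_field \<A> g I c J \<longleftrightarrow>
     jacobi_field \<A> g I c J \<and> (\<forall>t\<in>I. J t \<in> normal_space \<A> g I c t)"


section \<open>The Riccati operator and the transverse data\<close>

text \<open>
  The Riccati operator at \<open>t\<close> is \<open>J(t) \<mapsto> J'(t)\<close> on \<open>\<Lambda>\<close>; it exists where it is non-singular,
  while its self-adjointness is a condition on \<open>\<Lambda>\<close> at all \<open>t \<in> I\<close>.
\<close>

definition riccati_nonsingular ::
  "('m, 'e::euclidean_space) chart set \<Rightarrow> ('m, 'e) metric \<Rightarrow> real set \<Rightarrow> (real \<Rightarrow> 'm)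
   \<Rightarrow> (real \<Rightarrow> ('m, 'e) tvec) set \<Rightarrow> real \<Rightarrow> bool" where
  "riccati_nonsingular \<A> g I c \<Lambda> t \<longleftrightarrow> bij_betw (\<lambda>J. J t) \<Lambda> (normal_space \<A> g I c t)"

definition riccati_self_adjoint ::
  "('m, 'e::euclidean_space) chart set \<Rightarrow> ('m, 'e) metric \<Rightarrow> real set \<Rightarrow> (real \<Rightarrow> 'm)
   \<Rightarrow> (real \<Rightarrow> ('m, 'e) tvec) set \<Rightarrow> bool" where
  "riccati_self_adjoint \<A> g I c \<Lambda> \<longleftrightarrow>
     (\<forall>J1\<in>\<Lambda>. \<forall>J2\<in>\<Lambda>. \<forall>t\<in>I.
        g (c t) (cov_deriv \<A> g I c J1 t) (J2 t) = g (c t) (J1 t) (cov_deriv \<A> g I c J2 t))"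

definition vertical_space ::
  "('m, 'e::euclidean_space) chart set \<Rightarrow> ('m, 'e) metric \<Rightarrow> real set \<Rightarrow> (real \<Rightarrow> 'm)
   \<Rightarrow> (real \<Rightarrow> ('m, 'e) tvec) set \<Rightarrow> real \<Rightarrow> ('m, 'e) tvec set" where
  "vertical_space \<A> g I c \<Upsilon> t =
     {J1 t + cov_deriv \<A> g I c J2 t | J1 J2. J1 \<in> \<Upsilon> \<and> J2 \<in> \<Upsilon> \<and> J2 t = 0}"

definition perp_space ::
  "('m, 'e::euclidean_space) chart set \<Rightarrow> ('m, 'e) metric \<Rightarrow> real set \<Rightarrow> (real \<Rightarrow> 'm)
   \<Rightarrow> (real \<Rightarrow> ('m, 'e) tvec) set \<Rightarrow> real \<Rightarrow> ('m, 'e) tvec set" where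
  "perp_space \<A> g I c \<Upsilon> t =
     {v \<in> tangent_space \<A> (c t). \<forall>u\<in>vertical_space \<A> g I c \<Upsilon> t. g (c t) v u = 0}"

definition perp ::
  "('m, 'e::euclidean_space) chart set \<Rightarrow> ('m, 'e) metric \<Rightarrow> real set \<Rightarrow> (real \<Rightarrow> 'm)
   \<Rightarrow> (real \<Rightarrow> ('m, 'e) tvec) set \<Rightarrow> real \<Rightarrow> ('m, 'e) tvec \<Rightarrow> ('m, 'e) tvec" where
  "perp \<A> g I c \<Upsilon> t v =
     (THE w. w \<in> perp_space \<A> g I c \<Upsilon> t \<and> v - w \<in> vertical_space \<A> g I c \<Upsilon> t)"

definition perp_deriv ::
  "('m, 'e::euclidean_space) chart set \<Rightarrow> ('m, 'e) metric \<Rightarrow> real set \<Rightarrow> (real \<Rightarrow> 'm)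
   \<Rightarrow> (real \<Rightarrow> ('m, 'e) tvec) set \<Rightarrow> (real \<Rightarrow> ('m, 'e) tvec) \<Rightarrow> real \<Rightarrow> ('m, 'e) tvec" where
  "perp_deriv \<A> g I c \<Upsilon> X t = perp \<A> g I c \<Upsilon> t (cov_deriv \<A> g I c X t)"

definition A_regular ::
  "('m, 'e::euclidean_space) chart set \<Rightarrow> ('m, 'e) metric \<Rightarrow> real set \<Rightarrow> (real \<Rightarrow> 'm)
   \<Rightarrow> (real \<Rightarrow> ('m, 'e) tvec) set \<Rightarrow> real \<Rightarrow> ('m, 'e) tvec \<Rightarrow> ('m, 'e) tvec" where
  "A_regular \<A> g I c \<Upsilon> t v =
     perp \<A> g I c \<Upsilon> t (cov_deriv \<A> g I c (THE J. J \<in> \<Upsilon> \<and> J t = v) t)"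

text \<open>
  Convergence in the tangent bundle of vectors \<open>X s\<close> at \<open>c s\<close> to a vector at \<open>c t\<close>, in
  coordinates. Only charts around \<open>c t\<close> matter, so this is not pointwise convergence over all
  charts.
\<close>

definition tendsto_along ::
  "('m, 'e::euclidean_space) chart set \<Rightarrow> (real \<Rightarrow> 'm) \<Rightarrow> (real \<Rightarrow> ('m, 'e) tvec)
   \<Rightarrow> ('m, 'e) tvec \<Rightarrow> real \<Rightarrow> real set \<Rightarrow> bool" where
  "tendsto_along \<A> c X w t S \<longleftrightarrow>
     (\<forall>\<kappa>\<in>charts_at \<A> (c t). ((\<lambda>s. X s \<kappa>) \<longlongrightarrow> w \<kappa>) (at t within S))"

text \<open>
  At a singular \<open>t\<close>, \<open>A\<^sub>t v\<close> is the value of the continuous extension of the bundle map \<open>A\<close>: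
  the limit of \<open>A\<^sub>s (V s)\<close> over non-singular \<open>s \<rightarrow> t\<close>, for every section \<open>V\<close> of the vertical
  bundle that is continuous at \<open>t\<close> with \<open>V t = v\<close>.
\<close>

definition A_tensor ::
  "('m, 'e::euclidean_space) chart set \<Rightarrow> ('m, 'e) metric \<Rightarrow> real set \<Rightarrow> (real \<Rightarrow> 'm)
   \<Rightarrow> (real \<Rightarrow> ('m, 'e) tvec) set \<Rightarrow> (real \<Rightarrow> ('m, 'e) tvec) set
   \<Rightarrow> real \<Rightarrow> ('m, 'e) tvec \<Rightarrow> ('m, 'e) tvec" where
  "A_tensor \<A> g I c \<Lambda> \<Upsilon> t v =
     (if riccati_nonsingular \<A> g I c \<Lambda> t then A_regular \<A> g I c \<Upsilon> t v
      else THE w. w \<in> perp_space \<A> g I c \<Upsilon> t \<and>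
        (\<forall>V. (\<forall>s\<in>I. V s \<in> vertical_space \<A> g I c \<Upsilon> s) \<and> V t = v \<and> tendsto_along \<A> c V v t I \<longrightarrow>
           tendsto_along \<A> c (\<lambda>s. A_regular \<A> g I c \<Upsilon> s (V s)) w t
             {s\<in>I. riccati_nonsingular \<A> g I c \<Lambda> s}))"

definition A_adjoint ::
  "('m, 'e::euclidean_space) chart set \<Rightarrow> ('m, 'e) metric \<Rightarrow> real set \<Rightarrow> (real \<Rightarrow> 'm)
   \<Rightarrow> (real \<Rightarrow> ('m, 'e) tvec) set \<Rightarrow> (real \<Rightarrow> ('m, 'e) tvec) set
   \<Rightarrow> real \<Rightarrow> ('m, 'e) tvec \<Rightarrow> ('m, 'e) tvec" where
  "A_adjoint \<A> g I c \<Lambda> \<Upsilon> t w =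
     (THE v. v \<in> vertical_space \<A> g I c \<Upsilon> t \<and>
        (\<forall>u\<in>vertical_space \<A> g I c \<Upsilon> t.
           g (c t) (A_tensor \<A> g I c \<Lambda> \<Upsilon> t u) w = g (c t) u v))"

end

theory Submission
  imports Defs
begin

text \<open>
  Fix \<open>t\<close> and replace \<open>J\<close> by \<open>J - K\<close> with \<open>K \<in> \<Upsilon>\<close> such that \<open>J(t)\<close> is perpendicular to the
  vertical space; \<open>Y\<close> does not change. Let \<open>e\<^sub>b\<close> be an orthonormal frame of the vertical bundle near
  \<open>t\<close> and put \<open>p\<^sub>b = (e\<^sub>b')\<^sup>\<bottom>\<close>. Then \<open>A v = \<Sum> \<langle>v, e\<^sub>b\<rangle> p\<^sub>b\<close> and \<open>A\<^sup>* w = \<Sum> \<langle>w, p\<^sub>b\<rangle> e\<^sub>b\<close>, and with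
  \<open>f\<^sub>b = \<langle>J, e\<^sub>b\<rangle>\<close>, \<open>h\<^sub>b = \<langle>J', e\<^sub>b\<rangle>\<close> one has \<open>Y = J - \<Sum> f\<^sub>b e\<^sub>b\<close> and \<open>(Y')\<^sup>\<bottom> = J' - \<Sum> h\<^sub>b e\<^sub>b - \<Sum> f\<^sub>b p\<^sub>b\<close>.
  At \<open>t\<close> we have \<open>f\<^sub>b = 0\<close>, self-adjointness gives \<open>h\<^sub>b = \<langle>J, e\<^sub>b'\<rangle> = \<langle>Y, p\<^sub>b\<rangle>\<close>, hence \<open>f\<^sub>b' = 2 h\<^sub>b\<close>, and
  differentiating once more yields \<open>(J'')\<^sup>\<bottom> - \<Sum> h\<^sub>b p\<^sub>b - 2 \<Sum> h\<^sub>b p\<^sub>b = - (R(Y, c')c')\<^sup>\<bottom> - 3 A A\<^sup>* Y\<close>.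

  This works verbatim at singular \<open>t\<close> once the frame is built from the fields \<open>K\<close> with \<open>K(t) \<noteq> 0\<close>
  and the quotients \<open>K(s) / (s - t)\<close> for \<open>K(t) = 0\<close>: they are independent at \<open>t\<close> because
  \<open>\<langle>K', L\<rangle> = \<langle>K, L'\<rangle> = 0\<close> and a Jacobi field with \<open>K(t) = 0\<close>, \<open>K'(t) = 0\<close> vanishes. The same frame for
  \<open>\<Lambda>\<close> shows that singular parameters are isolated, so the limit defining \<open>A\<close> at \<open>t\<close> is unique.
\<close>

section \<open>Second derivatives and nondegenerate linear systems\<close>

text \<open>The frame \<open>e\<close> is only shown to be C1 at \<open>t\<close>, since part of it
  comes from the quotients \<open>K(s) / (s - t)\<close>, and the fields \<open>perp_e1 b\<close>
  made from its first derivative are merely continuous there. Yet the perpendicular part of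
  \<open>Y'\<close> contains them and has to be differentiated once more. Correcting
  \<open>J\<close> at the one parameter \<open>t\<close> overcomes this: the coefficients of these
  fields vanish at \<open>t\<close>, and the product of a differentiable function vanishing at
  \<open>t\<close> with a continuous field is differentiable at \<open>t\<close>. So the choice of
  \<open>K\<close>, which depends on \<open>t\<close>, serves regularity as well as algebra. All
  computations are made in one chart around \<open>c t\<close>. Other charts enter because tangent
  vectors are families over all charts, so that tangency, differentiability and limits are carried
  over by transition maps. The Christoffel map is given by a description, without an explicit
  formula; its regularity is that of the solution of a linear system with varying coefficients.
  Continuity of its first derivatives makes the curvature along \<open>c\<close> continuous, which
  bounds the coefficients of the Jacobi system and gives uniqueness.\<close>

lemma second_difference:
  fixes f :: "'a::real_normed_vector \<Rightarrow> 'b::real_normed_vector"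
  assumes "open S" "x \<in> S"
    and f: "\<And>y. y \<in> S \<Longrightarrow> (f has_derivative f' y) (at y)"
    and L: "((\<lambda>y. f' y v) has_derivative L) (at x)"
    and "e > 0"
  shows "\<exists>d>0. \<forall>h. 0 < h \<and> h < d \<longrightarrow>
    norm (f (x + h *\<^sub>R v + h *\<^sub>R w) - f (x + h *\<^sub>R v) - f (x + h *\<^sub>R w) + f x - (h\<^sup>2) *\<^sub>R L w) \<le> e * h\<^sup>2"
proof -
  \<comment> \<open>Every increment \<open>r v + k w\<close> with \<open>r\<close>, \<open>k\<close>
    in \<open>[0, h]\<close> has norm at most \<open>h * M\<close>; the summand 1 keeps
    \<open>M\<close> positive if \<open>v\<close> and \<open>w\<close> are 0. The factor 2 in
    \<open>e'\<close> accounts for the two linearisation errors that are subtracted in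
    \<open>bnd\<close>.\<close>
  define M where "M = norm v + norm w + 1"
  have M: "M > 0" "norm v + norm w \<le> M" "norm v \<le> M" unfolding M_def by (auto simp: add_nonneg_pos)
  define e' where "e' = e / (2 * M)"
  have "e' > 0" using \<open>e > 0\<close> M by (simp add: e'_def)
  interpret L: bounded_linear L using L by (rule has_derivative_bounded_linear)
  obtain d1 where d1: "d1 > 0" "\<And>y. norm (y - x) < d1 \<Longrightarrow> norm (f' y v - f' x v - L (y - x)) \<le> e' * norm (y - x)"
    using L \<open>e' > 0\<close> unfolding has_derivative_at_alt by blast
  obtain d2 where d2: "d2 > 0" "ball x d2 \<subseteq> S"
    using assms(1,2) openE by blast
  define d where "d = min d1 d2 / M"
  have "d > 0" using d1(1) d2(1) M by (simp add: d_def)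
  moreover have "norm (f (x + h *\<^sub>R v + h *\<^sub>R w) - f (x + h *\<^sub>R v) - f (x + h *\<^sub>R w) + f x
      - (h\<^sup>2) *\<^sub>R L w) \<le> e * h\<^sup>2"
    if h: "0 < h" "h < d" for h
  proof -
    have hM: "h * M < d1" "h * M < d2"
      using h M by (auto simp: d_def field_simps)
    have near: "norm (r *\<^sub>R v + k *\<^sub>R w) \<le> h * M" if "0 \<le> r" "r \<le> h" "0 \<le> k" "k \<le> h" for r k
    proof -
      have "norm (r *\<^sub>R v + k *\<^sub>R w) \<le> r * norm v + k * norm w"
        using that norm_triangle_ineq[of "r *\<^sub>R v" "k *\<^sub>R w"] by simp
      also have "\<dots> \<le> h * norm v + h * norm w"
        using that by (intro add_mono mult_right_mono) auto
      also have "\<dots> = h * (norm v + norm w)"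
        by (simp add: algebra_simps)
      also have "\<dots> \<le> h * M" using M h by (intro mult_left_mono) auto
      finally show ?thesis .
    qed
    have inS: "x + r *\<^sub>R v + k *\<^sub>R w \<in> S" if "0 \<le> r" "r \<le> h" "0 \<le> k" "k \<le> h" for r k
      using near[OF that] hM d2(2) by (auto simp: subset_iff dist_norm norm_minus_commute algebra_simps)
    \<comment> \<open>Fixing the full increment in \<open>w\<close> and moving along
      \<open>v\<close> turns the second difference into \<open>\<phi> h - \<phi> 0\<close>. The
      derivative of \<open>\<phi>\<close> compares the \<open>v\<close>-derivative of
      \<open>f\<close> at two points near \<open>x\<close>, where \<open>L\<close> is its
      linearisation.\<close>
    define \<phi> where "\<phi> r = f (x + r *\<^sub>R v + h *\<^sub>R w) - f (x + r *\<^sub>R v) - (r * h) *\<^sub>R L w" for r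
    have der: "(\<phi> has_derivative (\<lambda>k. k *\<^sub>R (f' (x + r *\<^sub>R v + h *\<^sub>R w) v - f' (x + r *\<^sub>R v) v - h *\<^sub>R L w)))
        (at r within {0..h})" if r: "r \<in> {0..h}" for r
    proof -
      have m1: "x + r *\<^sub>R v + h *\<^sub>R w \<in> S" and m2: "x + r *\<^sub>R v \<in> S"
        using inS[of r h] inS[of r 0] r h by auto
      interpret b1: bounded_linear "f' (x + r *\<^sub>R v + h *\<^sub>R w)"
        using f[OF m1] by (rule has_derivative_bounded_linear)
      interpret b2: bounded_linear "f' (x + r *\<^sub>R v)"
        using f[OF m2] by (rule has_derivative_bounded_linear)
      have "((\<lambda>r. f (x + r *\<^sub>R v + h *\<^sub>R w)) has_derivative (\<lambda>k. f' (x + r *\<^sub>R v + h *\<^sub>R w) (k *\<^sub>R v)))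
          (at r within {0..h})"
        by (rule has_derivative_compose[where g=f
          and g'="f' (x + r *\<^sub>R v + h *\<^sub>R w)"]) (use f[OF m1] in \<open>auto intro!: derivative_eq_intros\<close>)
      moreover have "((\<lambda>r. f (x + r *\<^sub>R v)) has_derivative (\<lambda>k. f' (x + r *\<^sub>R v) (k *\<^sub>R v)))
          (at r within {0..h})"
        by (rule has_derivative_compose[where g=f
          and g'="f' (x + r *\<^sub>R v)"]) (use f[OF m2] in \<open>auto intro!: derivative_eq_intros\<close>)
      ultimately show ?thesis
        unfolding \<phi>_def[abs_def] b1.scaleR b2.scaleR
        by (auto intro!: derivative_eq_intros simp: algebra_simps)
    qed
    have bnd: "onorm (\<lambda>k. k *\<^sub>R (f' (x + r *\<^sub>R v + h *\<^sub>R w) v - f' (x + r *\<^sub>R v) v - h *\<^sub>R L w)) \<le> e * h"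
      if r: "r \<in> {0..h}" for r
    proof (rule onorm_le)
      fix k :: real
      have n1: "norm (r *\<^sub>R v + h *\<^sub>R w) \<le> h * M" "norm (r *\<^sub>R v) \<le> h * M"
        using near[of r h] near[of r 0] r h by auto
      have a1: "norm (f' (x + r *\<^sub>R v + h *\<^sub>R w) v - f' x v - L (r *\<^sub>R v + h *\<^sub>R w)) \<le> e' * (h * M)"
        using d1(2)[of "x + r *\<^sub>R v + h *\<^sub>R w"] n1(1) hM \<open>e' > 0\<close>
        by (smt (verit, best) add_diff_cancel_left' mult_left_mono add.assoc)
      have a2: "norm (f' (x + r *\<^sub>R v) v - f' x v - L (r *\<^sub>R v)) \<le> e' * (h * M)"
        using d1(2)[of "x + r *\<^sub>R v"] n1(2) hM \<open>e' > 0\<close>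
        by (smt (verit, best) add_diff_cancel_left' mult_left_mono)
      have eq: "f' (x + r *\<^sub>R v + h *\<^sub>R w) v - f' (x + r *\<^sub>R v) v - h *\<^sub>R L w =
         (f' (x + r *\<^sub>R v + h *\<^sub>R w) v - f' x v - L (r *\<^sub>R v + h *\<^sub>R w)) - (f' (x + r *\<^sub>R v) v - f' x v
           - L (r *\<^sub>R v))"
        by (simp add: L.add L.scaleR)
      have "norm (f' (x + r *\<^sub>R v + h *\<^sub>R w) v - f' (x + r *\<^sub>R v) v - h *\<^sub>R L w) \<le> 2 * (e' * (h * M))"
        unfolding eq by (rule order_trans[OF norm_triangle_ineq4]) (use a1 a2 in simp)
      also have "\<dots> = e * h" using M by (simp add: e'_def)
      finally show "norm (k *\<^sub>R (f' (x + r *\<^sub>R v + h *\<^sub>R w) v - f' (x + r *\<^sub>R v) v - h *\<^sub>R L w))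
          \<le> e * h * norm k"
        by (simp add: mult.commute mult_left_mono)
    qed
    have "norm (\<phi> h - \<phi> 0) \<le> (e * h) * norm (h - 0)"
      by (rule differentiable_bound[of "{0..h}", OF _ der bnd]) (use h in auto)
    then show ?thesis using h by (simp add: \<phi>_def power2_eq_square algebra_simps)
  qed
  ultimately show ?thesis by blast
qed

text \<open>The second difference of \<open>f\<close> does not change when \<open>v\<close> and
  \<open>w\<close> are exchanged, so \<open>L w\<close> and \<open>K v\<close> both approximate it,
  divided by the square of \<open>h\<close>, with error \<open>e\<close>. With \<open>e\<close> a
  quarter of their distance this is contradictory.\<close>

lemma second_derivative_symmetric:
  fixes f :: "'a::real_normed_vector \<Rightarrow> 'b::real_normed_vector"
  assumes "open S" "x \<in> S"
    and f: "\<And>y. y \<in> S \<Longrightarrow> (f has_derivative f' y) (at y)"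
    and L: "((\<lambda>y. f' y v) has_derivative L) (at x)"
    and K: "((\<lambda>y. f' y w) has_derivative K) (at x)"
  shows "L w = K v"
proof (rule ccontr)
  assume "L w \<noteq> K v"
  define e where "e = norm (L w - K v) / 4"
  have "e > 0" using \<open>L w \<noteq> K v\<close> by (simp add: e_def)
  obtain d where d: "d > 0" "\<And>h. 0 < h \<Longrightarrow> h < d \<Longrightarrow>
    norm (f (x + h *\<^sub>R v + h *\<^sub>R w) - f (x + h *\<^sub>R v) - f (x + h *\<^sub>R w) + f x - (h\<^sup>2) *\<^sub>R L w) \<le> e * h\<^sup>2"
    using second_difference[OF assms(1,2) f L \<open>e > 0\<close>] by blast
  obtain d' where d': "d' > 0" "\<And>h. 0 < h \<Longrightarrow> h < d' \<Longrightarrow>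
    norm (f (x + h *\<^sub>R w + h *\<^sub>R v) - f (x + h *\<^sub>R w) - f (x + h *\<^sub>R v) + f x - (h\<^sup>2) *\<^sub>R K v) \<le> e * h\<^sup>2"
    using second_difference[OF assms(1,2) f K \<open>e > 0\<close>] by blast
  define h where "h = min d d' / 2"
  have h: "0 < h" "h < d" "h < d'" using d(1) d'(1) by (auto simp: h_def)
  define D where "D = f (x + h *\<^sub>R v + h *\<^sub>R w) - f (x + h *\<^sub>R v) - f (x + h *\<^sub>R w) + f x"
  have 1: "norm (D - (h\<^sup>2) *\<^sub>R L w) \<le> e * h\<^sup>2" using d(2)[OF h(1,2)] by (simp add: D_def)
  have 2: "norm (D - (h\<^sup>2) *\<^sub>R K v) \<le> e * h\<^sup>2" using d'(2)[OF h(1,3)] by (simp add: D_def algebra_simps)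
  have "(h\<^sup>2) *\<^sub>R (L w - K v) = (D - (h\<^sup>2) *\<^sub>R K v) - (D - (h\<^sup>2) *\<^sub>R L w)"
    by (simp add: algebra_simps)
  then have "norm ((h\<^sup>2) *\<^sub>R (L w - K v)) \<le> 2 * (e * h\<^sup>2)"
    using 1 2 norm_triangle_ineq4[of "D - (h\<^sup>2) *\<^sub>R K v" "D - (h\<^sup>2) *\<^sub>R L w"] by simp
  then have "h\<^sup>2 * (4 * e) \<le> h\<^sup>2 * (2 * e)"
    by (simp add: e_def mult_ac)
  then show False using h(1) \<open>e > 0\<close> by simp
qed

text \<open>Product rule for a factor \<open>p\<close> that is only continuous: a summand containing
  a derivative of \<open>p\<close> would be multiplied by \<open>q x = 0\<close>. It is applied with
  \<open>p\<close> a coordinate of the solution of a linear system, before that solution is known to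
  be differentiable.\<close>

lemma has_derivative_mult_vanishing:
  fixes p :: "'a::real_normed_vector \<Rightarrow> real" and q :: "'a \<Rightarrow> 'b::real_normed_vector"
  assumes p: "continuous (at x within S) p" and q: "(q has_derivative q') (at x within S)" and q0: "q x = 0"
  shows "((\<lambda>y. p y *\<^sub>R q y) has_derivative (\<lambda>h. p x *\<^sub>R q' h)) (at x within S)"
proof -
  obtain B where B: "\<And>h. norm (q' h) \<le> norm h * B" "B \<ge> 0"
    using bounded_linear.nonneg_bounded[OF has_derivative_bounded_linear[OF q]] by auto
  have bl: "bounded_linear (\<lambda>h. p x *\<^sub>R q' h)"
    by (intro bounded_linear_scaleR_right[THEN bounded_linear_compose] has_derivative_bounded_linear[OF q])
  have lim: "((\<lambda>y. norm (q y - q x - q' (y - x)) / norm (y - x)) \<longlongrightarrow> 0) (at x within S)"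
    using q by (simp add: has_derivative_iff_norm)
  have pl: "((\<lambda>y. p y) \<longlongrightarrow> p x) (at x within S)"
    using p by (simp add: continuous_within)
  have l2: "((\<lambda>y. \<bar>p y\<bar> * (norm (q y - q x - q' (y - x)) / norm (y - x)) + \<bar>p y - p x\<bar> * B) \<longlongrightarrow> \<bar>p x\<bar> * 0
      + \<bar>p x - p x\<bar> * B) (at x within S)"
    by (intro tendsto_intros pl lim)
  have "((\<lambda>y. norm (p y *\<^sub>R q y - p x *\<^sub>R q x - p x *\<^sub>R q' (y - x)) / norm (y - x)) \<longlongrightarrow> 0) (at x within S)"
  proof (rule real_tendsto_sandwich[OF _ _ tendsto_const])
    show "\<forall>\<^sub>F y in at x within S. norm (p y *\<^sub>R q y - p x *\<^sub>R q x - p x *\<^sub>R q' (y - x)) / norm (y - x)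
       \<le> \<bar>p y\<bar> * (norm (q y - q x - q' (y - x)) / norm (y - x)) + \<bar>p y - p x\<bar> * B"
    proof (rule eventually_at_topological[THEN iffD2], intro exI[of _ UNIV] conjI ballI impI)
      fix y assume "y \<noteq> x"
      have "p y *\<^sub>R q y - p x *\<^sub>R q x - p x *\<^sub>R q' (y - x) = p y *\<^sub>R (q y - q x - q' (y - x)) + (p y
          - p x) *\<^sub>R q' (y - x)"
        by (simp add: q0 algebra_simps)
      then have "norm (p y *\<^sub>R q y - p x *\<^sub>R q x - p x *\<^sub>R q' (y - x)) \<le> \<bar>p y\<bar> * norm (q y - q x - q' (y
          - x)) + \<bar>p y - p x\<bar> * (norm (y - x) * B)"
        using norm_triangle_ineq[of "p y *\<^sub>R (q y - q x - q' (y - x))" "(p y - p x) *\<^sub>R q' (y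
            - x)"] B(1)[of "y - x"]
        by (smt (verit) mult_left_mono norm_scaleR abs_ge_zero)
      then show "norm (p y *\<^sub>R q y - p x *\<^sub>R q x - p x *\<^sub>R q' (y - x)) / norm (y - x)
       \<le> \<bar>p y\<bar> * (norm (q y - q x - q' (y - x)) / norm (y - x)) + \<bar>p y - p x\<bar> * B"
        using \<open>y \<noteq> x\<close> by (simp add: field_simps)
    qed auto
  qed (use l2 in auto)
  then show ?thesis using bl by (simp add: has_derivative_iff_norm)
qed


section \<open>Linear systems given by a positive form\<close>

text \<open>Positivity makes \<open>u\<close> recoverable from the functional \<open>G u\<close>.
  Encoding this functional by its values on \<open>Basis\<close> gives an injective endomorphism of
  \<open>'e\<close>, hence an invertible one.\<close>

lemma nondegenerate_left_inverse:
  fixes G :: "'e::euclidean_space \<Rightarrow> 'e \<Rightarrow> real"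
  assumes G: "bilinear G" and pos: "\<And>u. u \<noteq> 0 \<Longrightarrow> G u u > 0"
  obtains S where "linear S" "\<And>u. S (\<Sum>d\<in>Basis. G u d *\<^sub>R d) = u"
    "\<And>y. (\<Sum>d\<in>Basis. G (S y) d *\<^sub>R d) = y"
proof -
  let ?T = "\<lambda>u. \<Sum>d\<in>Basis. G u d *\<^sub>R d"
  have lin: "linear ?T"
    using G by (intro linearI) (simp_all add: bilinear_ladd bilinear_lmul scaleR_left_distrib
      sum.distrib scaleR_sum_right)
  have "inj ?T"
  proof (rule linear_injective_0[OF lin, THEN iffD2], intro allI impI)
    fix u assume "?T u = 0"
    then have "G u d = 0" if "d \<in> Basis" for d
      using that inner_sum_left_Basis[of d "G u"] by simp
    moreover have "G u u = (\<Sum>d\<in>Basis. (u \<bullet> d) * G u d)"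
    proof -
      have "G u (\<Sum>d\<in>Basis. (u \<bullet> d) *\<^sub>R d) = (\<Sum>d\<in>Basis. (u \<bullet> d) *\<^sub>R G u d)"
        using G unfolding bilinear_def by (simp add: linear_sum[of "G u"] linear_scale[of "G u"])
      then show ?thesis by (simp add: euclidean_representation)
    qed
    ultimately show "u = 0" using pos[of u] by force
  qed
  then obtain S where S: "linear S" "S \<circ> ?T = id" "?T \<circ> S = id"
    using linear_injective_isomorphism[OF lin] by (auto simp: fun_eq_iff)
  show ?thesis by (rule that[of S]) (use S in \<open>auto simp: fun_eq_iff\<close>)
qed

lemma bilinear_expand_left:
  fixes G :: "'e::euclidean_space \<Rightarrow> 'e \<Rightarrow> 'b::real_normed_vector"
  assumes "bilinear G"
  shows "G u d = (\<Sum>b\<in>Basis. (u \<bullet> b) *\<^sub>R G b d)"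
proof -
  have l: "linear (\<lambda>u. G u d)" using assms by (simp add: bilinear_def)
  have "G (\<Sum>b\<in>Basis. (u \<bullet> b) *\<^sub>R b) d = (\<Sum>b\<in>Basis. (u \<bullet> b) *\<^sub>R G b d)"
    by (simp add: linear_sum[OF l] linear_scale[OF l])
  then show ?thesis by (simp add: euclidean_representation)
qed

lemma bilinear_expand_right:
  fixes G :: "'e::euclidean_space \<Rightarrow> 'e \<Rightarrow> 'b::real_normed_vector"
  assumes "bilinear G"
  shows "G u v = (\<Sum>b\<in>Basis. (v \<bullet> b) *\<^sub>R G u b)"
proof -
  have l: "linear (G u)" using assms by (simp add: bilinear_def)
  have "G u (\<Sum>b\<in>Basis. (v \<bullet> b) *\<^sub>R b) = (\<Sum>b\<in>Basis. (v \<bullet> b) *\<^sub>R G u b)"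
    by (simp add: linear_sum[OF l] linear_scale[OF l])
  then show ?thesis by (simp add: euclidean_representation)
qed

lemma bilinear_expand:
  fixes G :: "'e::euclidean_space \<Rightarrow> 'e \<Rightarrow> 'b::real_normed_vector"
  assumes "bilinear G"
  shows "G u v = (\<Sum>a\<in>Basis. \<Sum>b\<in>Basis. ((u \<bullet> a) * (v \<bullet> b)) *\<^sub>R G a b)"
proof -
  have "G u v = (\<Sum>a\<in>Basis. (u \<bullet> a) *\<^sub>R (\<Sum>b\<in>Basis. (v \<bullet> b) *\<^sub>R G a b))"
    by (subst bilinear_expand_left[OF assms])
       (intro sum.cong refl arg_cong[where f = "scaleR _"] bilinear_expand_right[OF assms])
  then show ?thesis by (simp add: scaleR_sum_right)
qed

text \<open>Both systems are compared through the fixed form \<open>G0\<close>. The unknown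
  \<open>u1\<close> remains on the right, but multiplied by \<open>G1 - G0\<close>: this factor is
  small in the continuity argument and vanishes at the base point in the differentiability
  argument.\<close>

lemma nondegenerate_solution_diff:
  fixes G0 G1 :: "'e::euclidean_space \<Rightarrow> 'e \<Rightarrow> real"
  assumes S: "linear S" "\<And>u. S (\<Sum>d\<in>Basis. G0 u d *\<^sub>R d) = u"
    and "bilinear G0" "bilinear G1"
    and "\<And>d. G0 u0 d = w0 d" "\<And>d. G1 u1 d = w1 d"
  shows "u1 - u0 = S (\<Sum>d\<in>Basis. (w1 d - w0 d - (\<Sum>b\<in>Basis. (u1 \<bullet> b) * (G1 b d - G0 b d))) *\<^sub>R d)"
proof -
  have "u1 - u0 = S ((\<Sum>d\<in>Basis. G0 (u1 - u0) d *\<^sub>R d))" by (simp add: S)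
  also have "(\<Sum>d\<in>Basis. G0 (u1 - u0) d *\<^sub>R d) =
    (\<Sum>d\<in>Basis. (w1 d - w0 d - (\<Sum>b\<in>Basis. (u1 \<bullet> b) * (G1 b d - G0 b d))) *\<^sub>R d)"
  proof (rule sum.cong[OF refl])
    fix d :: 'e
    have "(\<Sum>b\<in>Basis. (u1 \<bullet> b) * (G1 b d - G0 b d)) = G1 u1 d - G0 u1 d"
      using bilinear_expand_left[OF assms(3), of u1 d] bilinear_expand_left[OF assms(4), of u1 d]
      by (simp add: right_diff_distrib sum_subtractf)
    moreover have "G0 (u1 - u0) d = G0 u1 d - G0 u0 d" 
      using assms(3) by (rule bilinear_lsub)
    ultimately show "G0 (u1 - u0) d *\<^sub>R d = (w1 d - w0 d - (\<Sum>b\<in>Basis. (u1 \<bullet> b) * (G1 b d - G0 b d))) *\<^sub>R d"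
      using assms(5,6) by simp
  qed
  finally show ?thesis .
qed

text \<open>Nothing is known in advance about the variation of \<open>u\<close>. The preceding
  identity bounds \<open>u x - u0\<close> by the perturbations \<open>\<eta>\<close> of the right
  side and \<open>\<theta>\<close> of the form, where \<open>\<theta>\<close> is multiplied by the
  unknown \<open>u x\<close>; this part is absorbed on the left.\<close>

lemma nondegenerate_solution_tendsto:
  fixes G :: "'p \<Rightarrow> 'e::euclidean_space \<Rightarrow> 'e \<Rightarrow> real"
  assumes G0: "bilinear G0" "\<And>u. u \<noteq> 0 \<Longrightarrow> G0 u u > 0" "\<And>d. G0 u0 d = w0 d"
    and ev: "\<forall>\<^sub>F x in F. bilinear (G x) \<and> (\<forall>d. G x (u x) d = w x d)"
    and G: "\<And>a b. ((\<lambda>x. G x a b) \<longlongrightarrow> G0 a b) F" and w: "\<And>d. ((\<lambda>x. w x d) \<longlongrightarrow> w0 d) F"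
  shows "(u \<longlongrightarrow> u0) F"
proof -
  obtain S where S: "linear S" "\<And>u. S (\<Sum>d\<in>Basis. G0 u d *\<^sub>R d) = u"
    using nondegenerate_left_inverse[OF G0(1,2)] by metis
  obtain K where K: "K > 0" "\<And>y. norm (S y) \<le> K * norm y"
    using linear_bounded_pos[OF S(1)] by blast
  define \<eta> where "\<eta> x = (\<Sum>d\<in>Basis. \<bar>w x d - w0 d\<bar>)" for x
  define \<theta> where "\<theta> x = (\<Sum>d\<in>Basis. \<Sum>b\<in>Basis. \<bar>G x b d - G0 b d\<bar>)" for x
  have "(\<eta> \<longlongrightarrow> (\<Sum>d\<in>(Basis::'e set). \<bar>w0 d - w0 d\<bar>)) F"
    unfolding \<eta>_def[abs_def] by (intro tendsto_intros w)
  then have \<eta>: "(\<eta> \<longlongrightarrow> 0) F" by simp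
  have "(\<theta> \<longlongrightarrow> (\<Sum>d\<in>(Basis::'e set). \<Sum>b\<in>(Basis::'e set). \<bar>G0 b d - G0 b d\<bar>)) F"
    unfolding \<theta>_def[abs_def] by (intro tendsto_intros G)
  then have \<theta>: "(\<theta> \<longlongrightarrow> 0) F" by simp
  \<comment> \<open>With \<open>1 / (2 * K)\<close> the part of the bound that contains
    \<open>norm (u x - u0)\<close> is at most half of \<open>norm (u x - u0)\<close>; this yields
    the factor \<open>2 * K\<close> in \<open>bd\<close>.\<close>
  have small: "\<forall>\<^sub>F x in F. \<theta> x < 1 / (2 * K)"
    using \<theta> K(1) by (simp add: order_tendstoD(2))
  have bd: "\<forall>\<^sub>F x in F. norm (u x - u0) \<le> 2 * K * (\<eta> x + \<theta> x * norm u0)"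
    using ev small
  proof eventually_elim
    case (elim x)
    define s where "s = (\<Sum>d\<in>Basis. (w x d - w0 d - (\<Sum>b\<in>Basis. (u x \<bullet> b) * (G x b d - G0 b d))) *\<^sub>R d)"
    have eq: "u x - u0 = S s"
      unfolding s_def using nondegenerate_solution_diff[OF S G0(1) _ G0(3)] elim by blast
    have "norm s \<le> (\<Sum>d\<in>(Basis::'e set). \<bar>w x d - w0 d\<bar> + (\<Sum>b\<in>Basis. norm (u x) * \<bar>G x b d - G0 b d\<bar>))"
      unfolding s_def
    proof (rule order_trans[OF norm_sum], rule sum_mono)
      fix d :: 'e assume d: "d \<in> Basis"
      have "\<bar>\<Sum>b\<in>Basis. (u x \<bullet> b) * (G x b d - G0 b d)\<bar> \<le> (\<Sum>b\<in>Basis. norm (u x) * \<bar>G x b d - G0 b d\<bar>)"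
        by (rule order_trans[OF sum_abs], rule sum_mono) (simp add: abs_mult Basis_le_norm mult_right_mono)
      then show "norm ((w x d - w0 d - (\<Sum>b\<in>Basis. (u x \<bullet> b) * (G x b d - G0 b d))) *\<^sub>R d)
         \<le> \<bar>w x d - w0 d\<bar> + (\<Sum>b\<in>Basis. norm (u x) * \<bar>G x b d - G0 b d\<bar>)"
        using d by (simp add: abs_if split: if_splits)
    qed
    also have "\<dots> = \<eta> x + norm (u x) * \<theta> x"
      by (simp add: \<eta>_def \<theta>_def sum.distrib sum_distrib_left)
    also have "\<dots> \<le> \<eta> x + (norm (u x - u0) + norm u0) * \<theta> x"
      using norm_triangle_sub[of "u x" u0]
      by (intro add_left_mono mult_right_mono) (auto simp: \<theta>_def intro!: sum_nonneg)
    finally have "norm (u x - u0) \<le> K * (\<eta> x + (norm (u x - u0) + norm u0) * \<theta> x)"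
      unfolding eq using K by (meson order_trans mult_left_mono less_imp_le)
    moreover have "K * (norm (u x - u0) * \<theta> x) \<le> norm (u x - u0) / 2"
    proof -
      have "K * \<theta> x \<le> 1/2" using elim K(1) by (simp add: field_simps)
      then have "norm (u x - u0) * (K * \<theta> x) \<le> norm (u x - u0) * (1/2)" by (intro mult_left_mono) auto
      then show ?thesis by (simp add: algebra_simps)
    qed
    ultimately show ?case by (simp add: algebra_simps)
  qed
  have "((\<lambda>x. 2 * K * (\<eta> x + \<theta> x * norm u0)) \<longlongrightarrow> 2 * K * (0 + 0 * norm u0)) F"
    by (intro tendsto_intros \<eta> \<theta>)
  then have "((\<lambda>x. norm (u x - u0)) \<longlongrightarrow> 0) F"
    using bd by (intro tendsto_sandwich[OF _ bd tendsto_const]) auto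
  then show ?thesis by (simp add: tendsto_norm_zero_iff LIM_zero_iff)
qed

text \<open>Once \<open>u\<close> is continuous at \<open>x\<close>, the right side of
  \<open>nondegenerate_solution_diff\<close> is differentiable there, because \<open>u y\<close>
  occurs in it only with the factor \<open>G y - G x\<close>, which vanishes at \<open>x\<close>.
  This is the implicit function argument for a linear system.\<close>

lemma nondegenerate_solution_differentiable:
  fixes G :: "'p::real_normed_vector \<Rightarrow> 'e::euclidean_space \<Rightarrow> 'e \<Rightarrow> real"
  assumes "open S" "x \<in> S"
    and bil: "\<And>y. y \<in> S \<Longrightarrow> bilinear (G y)" and pos: "\<And>u. u \<noteq> 0 \<Longrightarrow> G x u u > 0"
    and sol: "\<And>y d. y \<in> S \<Longrightarrow> G y (u y) d = w y d"
    and G: "\<And>a b. (\<lambda>y. G y a b) differentiable (at x)" and w: "\<And>d. (\<lambda>y. w y d) differentiable (at x)"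
  shows "u differentiable (at x)"
proof -
  obtain T where T: "linear T" "\<And>u. T (\<Sum>d\<in>Basis. G x u d *\<^sub>R d) = u"
    using nondegenerate_left_inverse[OF bil[OF assms(2)] pos] by metis
  have evS: "\<forall>\<^sub>F y in at x. y \<in> S" using assms(1,2) by (simp add: eventually_at_topological) blast
  have lim: "(u \<longlongrightarrow> u x) (at x)"
  proof (rule nondegenerate_solution_tendsto[where ?G0.0 = "G x" and G = G and w = w and ?w0.0 = "w x"])
    show "\<forall>\<^sub>F y in at x. bilinear (G y) \<and> (\<forall>d. G y (u y) d = w y d)"
      using evS by eventually_elim (use bil sol in auto)
    show "((\<lambda>y. G y a b) \<longlongrightarrow> G x a b) (at x)" for a b
      using differentiable_imp_continuous_within[OF G[of a b]] by (simp add: continuous_within)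
    show "((\<lambda>y. w y d) \<longlongrightarrow> w x d) (at x)" for d
      using differentiable_imp_continuous_within[OF w[of d]] by (simp add: continuous_within)
  qed (use assms in auto)
  define p where "p y = (\<Sum>d\<in>Basis. (w y d - w x d - (\<Sum>b\<in>Basis. (u y \<bullet> b) * (G y b d - G x b d))) *\<^sub>R d)" for y
  have "p differentiable (at x)"
    unfolding p_def[abs_def]
  proof (intro differentiable_sum differentiable_scaleR differentiable_diff w differentiable_const
    finite_Basis ballI)
    fix d b :: 'e
    obtain D where "((\<lambda>y. G y b d) has_derivative D) (at x)" using G unfolding differentiable_def by blast
    then have "((\<lambda>y. G y b d - G x b d) has_derivative D) (at x)"
      by (auto intro!: derivative_eq_intros)
    then have "((\<lambda>y. (u y \<bullet> b) *\<^sub>R (G y b d - G x b d)) has_derivative (\<lambda>h. (u x \<bullet> b) *\<^sub>R D h)) (at x)"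
      by (intro has_derivative_mult_vanishing) (use lim in \<open>auto simp: continuous_within intro!:
        tendsto_intros\<close>)
    then show "(\<lambda>y. (u y \<bullet> b) * (G y b d - G x b d)) differentiable (at x)"
      unfolding differentiable_def by auto
  qed
  then have "(\<lambda>y. u x + T (p y)) differentiable (at x)"
    using linear_imp_differentiable[OF T(1)] differentiable_compose differentiable_add
      differentiable_const by blast
  then obtain D where D: "((\<lambda>y. u x + T (p y)) has_derivative D) (at x)"
    by (auto simp: differentiable_def)
  have "u x + T (p y) = u y" if "y \<in> S" for y
  proof -
    have "u y - u x = T (p y)"
      unfolding p_def
      by (rule nondegenerate_solution_diff[OF T bil[OF assms(2)] bil[OF that]]) (use sol that assms(2) in auto)
    then show ?thesis by (simp add: algebra_simps)
  qed
  from has_derivative_transform_within_open[OF D assms(1,2) this]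
  show ?thesis by (auto simp: differentiable_def)
qed

section \<open>One-sided calculus on an interval\<close>

lemma has_vector_derivative_iff_tendsto:
  fixes f :: "real \<Rightarrow> 'b::real_normed_vector"
  shows "(f has_vector_derivative D) (at t within S) \<longleftrightarrow>
    ((\<lambda>s. (f s - f t) /\<^sub>R (s - t)) \<longlongrightarrow> D) (at t within S)"
proof -
  have "((\<lambda>s. norm (f s - f t - (s - t) *\<^sub>R D) / norm (s - t)) \<longlongrightarrow> 0) (at t within S) \<longleftrightarrow>
     ((\<lambda>s. norm ((f s - f t) /\<^sub>R (s - t) - D)) \<longlongrightarrow> 0) (at t within S)"
  proof (rule filterlim_cong[OF refl refl], rule eventually_at_topological[THEN iffD2], intro exI[of _
    UNIV] conjI ballI impI)
    fix s assume "s \<noteq> t"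
    then have "(f s - f t) /\<^sub>R (s - t) - D = (f s - f t - (s - t) *\<^sub>R D) /\<^sub>R (s - t)"
      by (simp add: scaleR_diff_right)
    then show "norm (f s - f t - (s - t) *\<^sub>R D) / norm (s - t) = norm ((f s - f t) /\<^sub>R (s - t) - D)"
      by (simp add: divide_inverse mult.commute)
  qed auto
  then show ?thesis
    unfolding has_vector_derivative_def has_derivative_iff_norm
    by (simp add: tendsto_norm_zero_iff LIM_zero_iff bounded_linear_scaleR_left)
qed

text \<open>The interval may contain its end points, so the mean value inequality is applied on
  segments issuing from \<open>t\<close>. Convexity keeps them in \<open>I\<close>, and they stay in
  the neighbourhood where \<open>P\<close> holds.\<close>

lemma eventually_within_segment:
  fixes t :: real
  assumes I: "is_interval I" "t \<in> I" and ev: "\<forall>\<^sub>F s in nhds t. s \<in> I \<longrightarrow> P s"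
  shows "\<forall>\<^sub>F s in nhds t. s \<in> I \<longrightarrow> closed_segment t s \<subseteq> I \<and> (\<forall>r\<in>closed_segment t s. P r)"
proof -
  obtain d where d: "d > 0" "\<And>s. dist s t < d \<Longrightarrow> s \<in> I \<Longrightarrow> P s"
    using ev by (auto simp: eventually_nhds_metric)
  have "closed_segment t s \<subseteq> I \<and> (\<forall>r\<in>closed_segment t s. P r)" if s: "dist s t < d" "s \<in> I" for s
  proof -
    have sub: "closed_segment t s \<subseteq> I"
      using I s(2) by (meson is_interval_convex_1 convex_contains_segment)
    have "dist r t < d" if "r \<in> closed_segment t s" for r
      using that s(1) by (auto simp: closed_segment_eq_real_ivl dist_real_def split: if_splits)
    then show ?thesis using sub d(2) by blast
  qed
  then show ?thesis using d(1) by (auto simp: eventually_nhds_metric)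
qed

section \<open>Taylor expansion and divided differences\<close>

text \<open>The remainder \<open>\<psi>\<close> has the derivative
  \<open>f1 r - f1 t - (r - t) f2\<close>, which is small compared with \<open>r - t\<close> by
  differentiability of \<open>f1\<close> at \<open>t\<close> alone; the mean value inequality gains
  one order.\<close>

lemma taylor2_within:
  fixes f :: "real \<Rightarrow> 'b::real_normed_vector"
  assumes I: "is_interval I" "t \<in> I"
    and f1: "\<forall>\<^sub>F s in nhds t. s \<in> I \<longrightarrow> (f has_vector_derivative f1 s) (at s within I)"
    and f2: "(f1 has_vector_derivative f2) (at t within I)"
    and "e > 0"
  shows "\<forall>\<^sub>F s in nhds t. s \<in> I \<longrightarrow>
     norm (f s - f t - (s - t) *\<^sub>R f1 t - ((s - t)\<^sup>2 / 2) *\<^sub>R f2) \<le> e * (s - t)\<^sup>2 \<and>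
     norm (f1 s - f1 t - (s - t) *\<^sub>R f2) \<le> e * \<bar>s - t\<bar>"
proof -
  obtain d where d: "d > 0" "\<And>s. s \<in> I \<Longrightarrow> norm (s - t) < d \<Longrightarrow> norm (f1 s - f1 t - (s - t) *\<^sub>R f2)
      \<le> e * norm (s - t)"
    using f2 \<open>e > 0\<close> unfolding has_vector_derivative_def has_derivative_within_alt by blast
  have ev: "\<forall>\<^sub>F s in nhds t. s \<in> I \<longrightarrow> norm (f1 s - f1 t - (s - t) *\<^sub>R f2) \<le> e * \<bar>s - t\<bar>"
    unfolding eventually_nhds_metric using d by (auto simp: dist_norm intro!: exI[of _ d])
  have "\<forall>\<^sub>F s in nhds t. s \<in> I \<longrightarrow> (f has_vector_derivative f1 s) (at s within I) \<and> norm (f1 s - f1 t - (s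
      - t) *\<^sub>R f2) \<le> e * \<bar>s - t\<bar>"
    using f1 ev by eventually_elim auto
  from eventually_within_segment[OF I this] show ?thesis
  proof eventually_elim
    case (elim s)
    show ?case
    proof
      assume s: "s \<in> I"
      define \<psi> where "\<psi> r = f r - f t - (r - t) *\<^sub>R f1 t - ((r - t)\<^sup>2 / 2) *\<^sub>R f2" for r
      have der: "(\<psi> has_derivative (\<lambda>k. k *\<^sub>R (f1 r - f1 t - (r - t) *\<^sub>R f2))) (at r within closed_segment t s)"
        if r: "r \<in> closed_segment t s" for r
      proof -
        have "(f has_vector_derivative f1 r) (at r within closed_segment t s)"
          using elim s r has_vector_derivative_within_subset by blast
        then have "(f has_derivative (\<lambda>k. k *\<^sub>R f1 r)) (at r within closed_segment t s)"
          by (simp add: has_vector_derivative_def)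
        moreover have "((\<lambda>r. (r - t)\<^sup>2 / 2) has_derivative (\<lambda>k. k * (r - t))) (at r within closed_segment t s)"
          by (auto intro!: derivative_eq_intros simp: field_simps)
        ultimately show ?thesis unfolding \<psi>_def[abs_def]
          by (auto intro!: derivative_eq_intros simp: scaleR_diff_right)
      qed
      have bnd: "onorm (\<lambda>k. k *\<^sub>R (f1 r - f1 t - (r - t) *\<^sub>R f2)) \<le> e * \<bar>s - t\<bar>"
        if r: "r \<in> closed_segment t s" for r
      proof (rule onorm_le)
        fix k :: real
        have "\<bar>r - t\<bar> \<le> \<bar>s - t\<bar>" using r by (auto simp: closed_segment_eq_real_ivl split: if_splits)
        then have "e * \<bar>r - t\<bar> \<le> e * \<bar>s - t\<bar>" using \<open>e > 0\<close> by simp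
        moreover have "norm (f1 r - f1 t - (r - t) *\<^sub>R f2) \<le> e * \<bar>r - t\<bar>" using elim s r by blast
        ultimately have "norm (f1 r - f1 t - (r - t) *\<^sub>R f2) \<le> e * \<bar>s - t\<bar>" by linarith
        then show "norm (k *\<^sub>R (f1 r - f1 t - (r - t) *\<^sub>R f2)) \<le> e * \<bar>s - t\<bar> * norm k"
          by (simp add: mult.commute mult_left_mono)
      qed
      have "norm (\<psi> s - \<psi> t) \<le> (e * \<bar>s - t\<bar>) * norm (s - t)"
        by (rule differentiable_bound[of "closed_segment t s", OF _ der bnd]) auto
      then show "norm (f s - f t - (s - t) *\<^sub>R f1 t - ((s - t)\<^sup>2 / 2) *\<^sub>R f2) \<le> e * (s - t)\<^sup>2 \<and>
          norm (f1 s - f1 t - (s - t) *\<^sub>R f2) \<le> e * \<bar>s - t\<bar>"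
        using elim s by (simp add: \<psi>_def power2_eq_square mult.assoc)
    qed
  qed
qed

lemma has_vector_derivative_within_cong_ev:
  assumes "\<forall>\<^sub>F s in nhds t. s \<in> I \<longrightarrow> f s = g s" "t \<in> I"
  shows "(f has_vector_derivative D) (at t within I) \<longleftrightarrow> (g has_vector_derivative D) (at t within I)"
proof -
  have "\<forall>\<^sub>F s in nhds t. s \<in> I \<longrightarrow> f s = g s" by fact
  then show ?thesis
    using assms(2) eventually_nhds_x_imp_x[OF assms(1)]
    by (intro has_vector_derivative_cong_ev) auto
qed

text \<open>The second-order expansion gives the derivative \<open>f2 / 2\<close> of
  \<open>q\<close> at \<open>t\<close>. Away from \<open>t\<close>, since \<open>q t = f1 t\<close>,
  the derivative \<open>q1 s\<close> is the difference quotient of \<open>f1\<close> minus that of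
  \<open>q\<close>; its limit is \<open>f2 - f2 / 2\<close>, so it is continuous at
  \<open>t\<close>.\<close>

lemma divided_difference_C1:
  fixes f :: "real \<Rightarrow> 'b::real_normed_vector"
  assumes I: "is_interval I" "t \<in> I"
    and f1: "\<forall>\<^sub>F s in nhds t. s \<in> I \<longrightarrow> (f has_vector_derivative f1 s) (at s within I)"
    and f2: "(f1 has_vector_derivative f2) (at t within I)"
    and f0: "f t = 0"
  defines "q \<equiv> \<lambda>s. if s = t then f1 t else f s /\<^sub>R (s - t)"
  defines "q1 \<equiv> \<lambda>s. if s = t then f2 /\<^sub>R 2 else (f1 s - q s) /\<^sub>R (s - t)"
  shows "\<forall>\<^sub>F s in nhds t. s \<in> I \<longrightarrow> (q has_vector_derivative q1 s) (at s within I)"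
    and "continuous (at t within I) q1"
proof -
  have lim1: "((\<lambda>s. (q s - q t) /\<^sub>R (s - t)) \<longlongrightarrow> f2 /\<^sub>R 2) (at t within I)"
  proof (rule tendstoI)
    fix e :: real assume "e > 0"
    have "\<forall>\<^sub>F s in at t within I. norm (f s - f t - (s - t) *\<^sub>R f1 t - ((s - t)\<^sup>2 / 2) *\<^sub>R f2)
        \<le> (e/2) * (s - t)\<^sup>2"
      unfolding eventually_at_filter using taylor2_within[OF I f1 f2, of "e/2"] \<open>e > 0\<close>
        by (auto elim: eventually_mono)
    moreover have "\<forall>\<^sub>F s in at t within I. s \<noteq> t" by (simp add: eventually_at_filter)
    ultimately show "\<forall>\<^sub>F s in at t within I. dist ((q s - q t) /\<^sub>R (s - t)) (f2 /\<^sub>R 2) < e"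
    proof eventually_elim
      case (elim s)
      have "(q s - q t) /\<^sub>R (s - t) - f2 /\<^sub>R 2 = (f s - f t - (s - t) *\<^sub>R f1 t - ((s
          - t)\<^sup>2 / 2) *\<^sub>R f2) /\<^sub>R (s - t)\<^sup>2"
      proof -
        have "(s - t)\<^sup>2 \<noteq> 0" using elim(2) by simp
        then have "inverse ((s - t)\<^sup>2) * ((s - t)\<^sup>2 / 2) = 1 / 2" by (metis left_inverse times_divide_eq_right)
        moreover have "inverse ((s - t)\<^sup>2) * (s - t) = inverse (s - t)"
            "inverse ((s - t)\<^sup>2) = inverse (s - t) * inverse (s - t)"
          using elim(2) by (simp_all add: power2_eq_square)
        ultimately show ?thesis using elim(2) by (simp add: q_def f0 scaleR_diff_right)
      qed
      moreover have "norm (x /\<^sub>R r\<^sup>2) = norm x / r\<^sup>2" for x :: 'b and r :: real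
        by (simp add: divide_inverse mult.commute)
      ultimately have "norm ((q s - q t) /\<^sub>R (s - t) - f2 /\<^sub>R 2) = norm (f s - f t - (s - t) *\<^sub>R f1 t
          - ((s - t)\<^sup>2 / 2) *\<^sub>R f2) / (s - t)\<^sup>2"
        by (simp only:)
      also have "\<dots> \<le> e/2" using elim by (simp add: divide_le_eq)
      finally show ?case using \<open>e > 0\<close> by (simp add: dist_norm)
    qed
  qed
  have lim2: "((\<lambda>s. (f1 s - f1 t) /\<^sub>R (s - t)) \<longlongrightarrow> f2) (at t within I)"
    using f2 by (simp add: has_vector_derivative_iff_tendsto)
  have "((\<lambda>s. (f1 s - f1 t) /\<^sub>R (s - t) - (q s - q t) /\<^sub>R (s - t)) \<longlongrightarrow> f2 - f2 /\<^sub>R 2) (at t within I)"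
    by (intro tendsto_intros lim1 lim2)
  moreover have "f2 - f2 /\<^sub>R 2 = f2 /\<^sub>R 2" 
    using scaleR_left_diff_distrib[of 1 "1/2" f2] by simp
  ultimately have lim3: "((\<lambda>s. (f1 s - f1 t) /\<^sub>R (s - t) - (q s - q t) /\<^sub>R (s - t)) \<longlongrightarrow> q1 t) (at t within I)"
    by (simp add: q1_def)
  have "(q1 \<longlongrightarrow> q1 t) (at t within I)"
    by (rule Lim_transform_eventually[OF lim3]) (auto simp: eventually_at_filter q1_def q_def
      scaleR_diff_right[symmetric])
  then show "continuous (at t within I) q1" by (simp add: continuous_within)
  show "\<forall>\<^sub>F s in nhds t. s \<in> I \<longrightarrow> (q has_vector_derivative q1 s) (at s within I)"
    using f1
  proof eventually_elim
    case (elim s)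
    show ?case
    proof
      assume s: "s \<in> I"
      show "(q has_vector_derivative q1 s) (at s within I)"
      proof (cases "s = t")
        case True
        then show ?thesis using lim1 by (simp add: has_vector_derivative_iff_tendsto q1_def)
      next
        case False
        have "((\<lambda>r. f r /\<^sub>R (r - t)) has_vector_derivative q1 s) (at s within I)"
          using elim s False
          by (auto intro!: derivative_eq_intros simp: q1_def q_def
            has_real_derivative_iff_has_vector_derivative[symmetric] algebra_simps divide_inverse
              power2_eq_square)
        moreover have "\<forall>\<^sub>F r in nhds s. r \<in> I \<longrightarrow> f r /\<^sub>R (r - t) = q r"
          using t1_space_nhds[OF False] by (rule eventually_mono) (auto simp: q_def)
        ultimately show ?thesis using has_vector_derivative_within_cong_ev[where f = "\<lambda>r. f r /\<^sub>R (r
            - t)" and g = q, OF _ s] by simp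
      qed
    qed
  qed
qed

section \<open>Uniqueness for linear differential equations\<close>

text \<open>A maximum argument in place of Gronwall: on a segment of length below
  \<open>1 / (2 * K)\<close> the mean value inequality bounds the maximum of
  \<open>norm (z r)\<close> by half of itself. \<open>K\<close> exceeds \<open>C\<close> and is
  positive for every sign of \<open>C\<close>.\<close>

lemma linear_growth_vanishes_near:
  fixes z :: "real \<Rightarrow> 'b::real_normed_vector"
  assumes I: "is_interval I" "t \<in> I"
    and z': "\<forall>\<^sub>F s in nhds t. s \<in> I \<longrightarrow> (z has_vector_derivative z' s) (at s within I) \<and> norm (z' s)
        \<le> C * norm (z s)"
    and z0: "z t = 0"
  shows "\<forall>\<^sub>F s in nhds t. s \<in> I \<longrightarrow> z s = 0"
proof -
  define K where "K = \<bar>C\<bar> + 1"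
  have K: "K > 0" "C \<le> K" by (auto simp: K_def)
  have "\<forall>\<^sub>F s in nhds t. dist s t < 1 / (2 * K)"
    unfolding eventually_nhds_metric using K by (auto intro!: exI[of _ "1 / (2*K)"])
  with eventually_within_segment[OF I z'] show ?thesis
  proof eventually_elim
    case (elim s)
    show ?case
    proof
      assume s: "s \<in> I"
      let ?S = "closed_segment t s"
      have der: "(z has_derivative (\<lambda>k. k *\<^sub>R z' r)) (at r within ?S)" if "r \<in> ?S" for r
        using elim(1) s that has_vector_derivative_within_subset[of z _ r I ?S]
          by (auto simp: has_vector_derivative_def)
      have cont: "continuous_on ?S (\<lambda>r. norm (z r))"
        using der by (intro continuous_on_norm has_derivative_continuous_on[OF der])
      obtain x where x: "x \<in> ?S" "\<And>r. r \<in> ?S \<Longrightarrow> norm (z r) \<le> norm (z x)"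
        using continuous_attains_sup[OF compact_segment _ cont] ends_in_segment(1)[of t s] by auto
      have bnd: "onorm (\<lambda>k. k *\<^sub>R z' r) \<le> K * norm (z x)" if r: "r \<in> ?S" for r
      proof (rule onorm_le)
        fix k :: real
        have "norm (z' r) \<le> C * norm (z r)" using elim(1) s r by blast
        also have "\<dots> \<le> K * norm (z x)" using K x(2)[OF r] by (intro mult_mono) auto
        finally show "norm (k *\<^sub>R z' r) \<le> K * norm (z x) * norm k" by (simp add: mult.commute mult_left_mono)
      qed
      have "norm (z x - z t) \<le> (K * norm (z x)) * norm (x - t)"
        by (rule differentiable_bound[of ?S, OF _ der bnd]) (use x in auto)
      also have "\<dots> \<le> (K * norm (z x)) * (1 / (2 * K))"
        using x(1) elim(2) K by (intro mult_left_mono) (auto simp: closed_segment_eq_real_ivl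
          dist_real_def split: if_splits)
      also have "\<dots> = norm (z x) / 2" using K by simp
      finally have "norm (z x) \<le> 0" using z0 by simp
      then show "z s = 0" using x(2)[of s] by auto
    qed
  qed
qed

section \<open>Calculus of fields that are C1 at a parameter\<close>

text \<open>The derivative exists near \<open>t\<close> but is required to be continuous only at \<open>t\<close> itself.\<close>

definition C1_at :: "real set \<Rightarrow> real \<Rightarrow> (real \<Rightarrow> 'b::real_normed_vector) \<Rightarrow> bool" where
  "C1_at I t X \<longleftrightarrow> (\<exists>X'. (\<forall>\<^sub>F s in nhds t. s \<in> I \<longrightarrow> (X has_vector_derivative X' s) (at s within I))
     \<and> continuous (at t within I) X')"

lemma C1_atI:
  assumes "\<forall>\<^sub>F s in nhds t. s \<in> I \<longrightarrow> (X has_vector_derivative X' s) (at s within I)"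
    and "continuous (at t within I) X'"
  shows "C1_at I t X"
  unfolding C1_at_def by (intro exI conjI) (rule assms)+

lemma C1_at_deriv_ev:
  assumes "C1_at I t X"
  obtains X' where "\<forall>\<^sub>F s in nhds t. s \<in> I \<longrightarrow> (X has_vector_derivative X' s) (at s within I)"
    "continuous (at t within I) X'"
  using assms unfolding C1_at_def by (elim exE conjE) (rule that)

lemma C1_at_has_derivative:
  assumes "C1_at I t X" "t \<in> I"
  obtains D where "(X has_vector_derivative D) (at t within I)"
proof -
  obtain X' where "\<forall>\<^sub>F s in nhds t. s \<in> I \<longrightarrow> (X has_vector_derivative X' s) (at s within I)"
    using assms(1) by (rule C1_at_deriv_ev)
  then have "(X has_vector_derivative X' t) (at t within I)"
    using assms(2) eventually_nhds_x_imp_x by blast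
  then show ?thesis by (rule that)
qed

lemma C1_at_continuous:
  assumes "C1_at I t X" "t \<in> I"
  shows "continuous (at t within I) X"
proof -
  obtain D where "(X has_vector_derivative D) (at t within I)" using assms by (rule C1_at_has_derivative)
  then show ?thesis by (rule has_vector_derivative_continuous)
qed

lemma C1_at_eventually_differentiable:
  assumes "C1_at I t X"
  shows "\<forall>\<^sub>F s in nhds t. s \<in> I \<longrightarrow> X differentiable (at s within I)"
proof -
  obtain X' where "\<forall>\<^sub>F s in nhds t. s \<in> I \<longrightarrow> (X has_vector_derivative X' s) (at s within I)"
    using assms by (rule C1_at_deriv_ev)
  then show ?thesis by eventually_elim (auto intro: differentiableI_vector)
qed

lemma C1_at_const: "C1_at I t (\<lambda>s. c)"
  by (rule C1_atI[where X' = "\<lambda>s. 0"]) simp_all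

lemma C1_at_cong:
  assumes "\<forall>\<^sub>F s in nhds t. s \<in> I \<longrightarrow> X s = Y s" and "C1_at I t X"
  shows "C1_at I t Y"
proof -
  obtain X' where X': "\<forall>\<^sub>F s in nhds t. s \<in> I \<longrightarrow> (X has_vector_derivative X' s) (at s within I)"
    "continuous (at t within I) X'" using assms(2) by (rule C1_at_deriv_ev)
  have "\<forall>\<^sub>F s in nhds t. s \<in> I \<longrightarrow> (Y has_vector_derivative X' s) (at s within I)"
    using eventually_eventually[THEN iffD2, OF assms(1)] X'(1)
  proof eventually_elim
    case (elim s)
    show ?case
    proof
      assume s: "s \<in> I"
      show "(Y has_vector_derivative X' s) (at s within I)"
        by (rule has_vector_derivative_within_cong_ev[OF elim(1) s, THEN iffD1]) (use elim(2) s in simp)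
    qed
  qed
  then show ?thesis using X'(2) by (rule C1_atI)
qed

lemma C1_at_add:
  assumes "C1_at I t X" "C1_at I t Y"
  shows "C1_at I t (\<lambda>s. X s + Y s)"
proof -
  obtain X' where X': "\<forall>\<^sub>F s in nhds t. s \<in> I \<longrightarrow> (X has_vector_derivative X' s) (at s within I)"
    "continuous (at t within I) X'" using assms(1) by (rule C1_at_deriv_ev)
  obtain Y' where Y': "\<forall>\<^sub>F s in nhds t. s \<in> I \<longrightarrow> (Y has_vector_derivative Y' s) (at s within I)"
    "continuous (at t within I) Y'" using assms(2) by (rule C1_at_deriv_ev)
  show ?thesis
  proof (rule C1_atI[where X' = "\<lambda>s. X' s + Y' s"])
    show "\<forall>\<^sub>F s in nhds t. s \<in> I \<longrightarrow> ((\<lambda>s. X s + Y s) has_vector_derivative (X' s + Y' s)) (at s within I)"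
      using X'(1) Y'(1) by eventually_elim (auto intro!: derivative_intros)
  qed (intro continuous_intros X'(2) Y'(2))
qed

lemma C1_at_bilinear:
  assumes B: "bounded_bilinear B" and "t \<in> I" and X: "C1_at I t X" and Y: "C1_at I t Y"
  shows "C1_at I t (\<lambda>s. B (X s) (Y s))"
proof -
  obtain X' where X': "\<forall>\<^sub>F s in nhds t. s \<in> I \<longrightarrow> (X has_vector_derivative X' s) (at s within I)"
    "continuous (at t within I) X'" using X by (rule C1_at_deriv_ev)
  obtain Y' where Y': "\<forall>\<^sub>F s in nhds t. s \<in> I \<longrightarrow> (Y has_vector_derivative Y' s) (at s within I)"
    "continuous (at t within I) Y'" using Y by (rule C1_at_deriv_ev)
  have c: "continuous (at t within I) (\<lambda>s. B (U s) (V s))"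
    if "continuous (at t within I) U" "continuous (at t within I) V" for U V
    using that bounded_bilinear.tendsto[OF B] by (auto simp: continuous_within)
  show ?thesis
  proof (rule C1_atI[where X' = "\<lambda>s. B (X s) (Y' s) + B (X' s) (Y s)"])
    show "\<forall>\<^sub>F s in nhds t. s \<in> I \<longrightarrow> ((\<lambda>s. B (X s) (Y s)) has_vector_derivative (B (X s) (Y' s)
        + B (X' s) (Y s))) (at s within I)"
      using X'(1) Y'(1) by eventually_elim (auto intro: bounded_bilinear.has_vector_derivative[OF B])
  qed (intro continuous_add c X'(2) Y'(2) C1_at_continuous[OF X \<open>t \<in> I\<close>] C1_at_continuous[OF Y \<open>t \<in> I\<close>])
qed

lemmas C1_at_scaleR = C1_at_bilinear[OF bounded_bilinear_scaleR]
  and C1_at_mult = C1_at_bilinear[OF bounded_bilinear_mult]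
  and C1_at_inner = C1_at_bilinear[OF bounded_bilinear_inner]

lemma C1_at_uminus: "t \<in> I \<Longrightarrow> C1_at I t X \<Longrightarrow> C1_at I t (\<lambda>s. - X s)"
  using C1_at_scaleR[of t I "\<lambda>s. -1" X] by (simp add: C1_at_const)

lemma C1_at_diff: "t \<in> I \<Longrightarrow> C1_at I t X \<Longrightarrow> C1_at I t Y \<Longrightarrow> C1_at I t (\<lambda>s. X s - Y s)"
  using C1_at_add[of I t X "\<lambda>s. - Y s"] by (simp add: C1_at_uminus)

lemma C1_at_sum:
  "finite F \<Longrightarrow> (\<And>i. i \<in> F \<Longrightarrow> C1_at I t (X i)) \<Longrightarrow> C1_at I t (\<lambda>s. \<Sum>i\<in>F. X i s)"
  by (induction F rule: finite_induct) (auto intro: C1_at_const C1_at_add)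

lemma C1_at_inverse_sqrt:
  fixes n :: "real \<Rightarrow> real"
  assumes n: "C1_at I t n" and t: "t \<in> I" and pos: "n t > 0"
  shows "C1_at I t (\<lambda>s. inverse (sqrt (n s)))" and "\<forall>\<^sub>F s in nhds t. s \<in> I \<longrightarrow> n s > 0"
proof -
  obtain n' where n': "\<forall>\<^sub>F s in nhds t. s \<in> I \<longrightarrow> (n has_vector_derivative n' s) (at s within I)"
    "continuous (at t within I) n'" using n by (rule C1_at_deriv_ev)
  have c: "continuous (at t within I) n" by (rule C1_at_continuous[OF n t])
  then have "\<forall>\<^sub>F s in at t within I. n s > 0"
    using pos by (simp add: continuous_within order_tendstoD(1))
  then show ev: "\<forall>\<^sub>F s in nhds t. s \<in> I \<longrightarrow> n s > 0"
    unfolding eventually_at_filter by eventually_elim (use pos in auto)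
  show "C1_at I t (\<lambda>s. inverse (sqrt (n s)))"
  proof (rule C1_atI[where X' = "\<lambda>s. - (n' s) * (inverse (sqrt (n s)))^3 / 2"])
    show "\<forall>\<^sub>F s in nhds t. s \<in> I \<longrightarrow> ((\<lambda>s. inverse (sqrt (n s))) has_vector_derivative
        - (n' s) * (inverse (sqrt (n s)))^3 / 2) (at s within I)"
      using ev n'(1)
    proof eventually_elim
      case (elim s)
      show ?case
      proof
        assume s: "s \<in> I"
        have n: "(n has_real_derivative n' s) (at s within I)" and pos: "n s > 0"
          using elim s by (auto simp: has_real_derivative_iff_has_vector_derivative)
        have "((\<lambda>s. inverse (sqrt (n s))) has_real_derivative
            - (inverse (sqrt (n s)) * (inverse (sqrt (n s)) / 2 * n' s) * inverse (sqrt (n s)))) (at s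
              within I)"
          by (rule DERIV_inverse'[OF DERIV_chain2[OF DERIV_real_sqrt n]]) (use pos in auto)
        then show "((\<lambda>s. inverse (sqrt (n s))) has_vector_derivative
            - (n' s) * (inverse (sqrt (n s)))^3 / 2) (at s within I)"
          by (simp add: has_real_derivative_iff_has_vector_derivative[symmetric] power3_eq_cube mult_ac)
      qed
    qed
  qed (use c pos n' in \<open>auto intro!: continuous_intros\<close>)
qed

text \<open>Regularity of \<open>G s\<close> is known for fixed basis vectors; expanding both
  arguments turns the moving form into a finite sum of products.\<close>

lemma C1_at_bilinear_form:
  fixes G :: "real \<Rightarrow> 'e::euclidean_space \<Rightarrow> 'e \<Rightarrow> 'b::real_normed_vector"
  assumes bil: "\<forall>\<^sub>F s in nhds t. s \<in> I \<longrightarrow> bilinear (G s)" and "t \<in> I"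
    and G: "\<And>a b. a \<in> Basis \<Longrightarrow> b \<in> Basis \<Longrightarrow> C1_at I t (\<lambda>s. G s a b)" and X: "C1_at I t X" and Y: "C1_at I t Y"
  shows "C1_at I t (\<lambda>s. G s (X s) (Y s))"
proof (rule C1_at_cong)
  show "\<forall>\<^sub>F s in nhds t. s \<in> I \<longrightarrow> (\<Sum>a\<in>Basis. \<Sum>b\<in>Basis. ((X s \<bullet> a) * (Y s \<bullet> b)) *\<^sub>R G s a b) = G s (X s) (Y s)"
    using bil by eventually_elim (simp add: bilinear_expand[symmetric])
  show "C1_at I t (\<lambda>s. \<Sum>a\<in>Basis. \<Sum>b\<in>Basis. ((X s \<bullet> a) * (Y s \<bullet> b)) *\<^sub>R G s a b)"
    by (intro C1_at_sum finite_Basis C1_at_scaleR C1_at_mult C1_at_inner C1_at_const \<open>t \<in> I\<close> X Y G)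
qed

section \<open>Orthonormalisation of C1 fields\<close>

text \<open>The family is already orthonormal at \<open>t\<close>. Hence the subtracted projections
  vanish at \<open>t\<close>, the squared length \<open>n\<close> is 1 there and positive nearby,
  and normalisation preserves C1 and leaves the vectors at \<open>t\<close> unchanged.\<close>

lemma gram_schmidt_fields:
  fixes G :: "real \<Rightarrow> 'e::euclidean_space \<Rightarrow> 'e \<Rightarrow> real"
  assumes bil: "\<forall>\<^sub>F s in nhds t. s \<in> I \<longrightarrow> bilinear (G s)"
    and sym: "\<forall>\<^sub>F s in nhds t. s \<in> I \<longrightarrow> (\<forall>a b. G s a b = G s b a)"
    and t: "t \<in> I" and G: "\<And>a b. C1_at I t (\<lambda>s. G s a b)"
    and "finite F" and E: "\<And>i. i \<in> F \<Longrightarrow> C1_at I t (E i)"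
    and orth: "\<And>i j. i \<in> F \<Longrightarrow> j \<in> F \<Longrightarrow> G t (E i t) (E j t) = (if i = j then 1 else 0)"
  shows "\<exists>e. (\<forall>i\<in>F. C1_at I t (e i) \<and> e i t = E i t) \<and>
    (\<forall>\<^sub>F s in nhds t. s \<in> I \<longrightarrow> (\<forall>i\<in>F. \<forall>j\<in>F. G s (e i s) (e j s) = (if i = j then 1 else 0)) \<and>
       span ((\<lambda>i. e i s) ` F) = span ((\<lambda>i. E i s) ` F))"
  using \<open>finite F\<close> E orth
proof (induction F rule: finite_induct)
  case empty
  then show ?case by auto
next
  case (insert k F)
  have "\<exists>e. (\<forall>i\<in>F. C1_at I t (e i) \<and> e i t = E i t) \<and>
    (\<forall>\<^sub>F s in nhds t. s \<in> I \<longrightarrow> (\<forall>i\<in>F. \<forall>j\<in>F. G s (e i s) (e j s) = (if i = j then 1 else 0)) \<and>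
       span ((\<lambda>i. e i s) ` F) = span ((\<lambda>i. E i s) ` F))"
    by (rule insert.IH) (use insert.prems in simp_all)
  then obtain e where e0: "\<forall>i\<in>F. C1_at I t (e i) \<and> e i t = E i t"
    and ev: "\<forall>\<^sub>F s in nhds t. s \<in> I \<longrightarrow> (\<forall>i\<in>F. \<forall>j\<in>F. G s (e i s) (e j s) = (if i = j then 1 else 0)) \<and>
       span ((\<lambda>i. e i s) ` F) = span ((\<lambda>i. E i s) ` F)"
    by (elim exE conjE)
  have e: "C1_at I t (e i)" "e i t = E i t" if "i \<in> F" for i using e0 that by auto
  define N where "N s = E k s - (\<Sum>i\<in>F. G s (E k s) (e i s) *\<^sub>R e i s)" for s
  define n where "n s = G s (N s) (N s)" for s
  have form: "C1_at I t (\<lambda>s. G s (X s) (Y s))" if "C1_at I t X" "C1_at I t Y" for X Y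
    by (rule C1_at_bilinear_form[OF bil t G that])
  have CN: "C1_at I t N"
    unfolding N_def using insert.hyps insert.prems e by (intro C1_at_diff C1_at_sum C1_at_scaleR form t) auto
  have Cn: "C1_at I t n" unfolding n_def by (intro form CN)
  have "G t (E k t) (e i t) = 0" if "i \<in> F" for i
    using insert.prems(2)[of k i] insert.hyps(2) that e(2) by auto
  then have Nt: "N t = E k t" by (simp add: N_def)
  have nt: "n t = 1" using insert.prems(2)[of k k] by (simp add: n_def Nt)
  define f where "f = e(k := (\<lambda>s. inverse (sqrt (n s)) *\<^sub>R N s))"
  have Cf: "C1_at I t (f i) \<and> f i t = E i t" if "i \<in> insert k F" for i
    using that e nt Nt C1_at_inverse_sqrt(1)[OF Cn t] CN t by (auto simp: f_def intro!: C1_at_scaleR)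
  have fF: "f i = e i" if "i \<in> F" for i using that insert.hyps by (auto simp: f_def)
  have "\<forall>\<^sub>F s in nhds t. s \<in> I \<longrightarrow> (\<forall>i\<in>insert k F. \<forall>j\<in>insert k F. G s (f i s) (f j s) = (if i
      = j then 1 else 0)) \<and>
       span ((\<lambda>i. f i s) ` insert k F) = span ((\<lambda>i. E i s) ` insert k F)"
    using ev bil sym C1_at_inverse_sqrt(2)[OF Cn t, unfolded nt, OF zero_less_one]
  proof eventually_elim
    case (elim s)
    show ?case
    proof
      assume s: "s \<in> I"
      have bi: "bilinear (G s)" and sy: "\<And>a b. G s a b = G s b a" and np: "n s > 0" using elim s by auto
      have on: "G s (e i s) (e j s) = (if i = j then 1 else 0)" if "i \<in> F" "j \<in> F" for i j
        using elim s that by blast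
      have sp: "span ((\<lambda>i. e i s) ` F) = span ((\<lambda>i. E i s) ` F)" using elim s by blast
      have Ne: "G s (N s) (e j s) = 0" if j: "j \<in> F" for j
      proof -
        have l: "linear (\<lambda>u. G s u (e j s))" using bi by (simp add: bilinear_def)
        have "G s (N s) (e j s) = G s (E k s) (e j s) - (\<Sum>i\<in>F. G s (E k s) (e i s) * G s (e i s) (e j s))"
          unfolding N_def by (simp add: linear_diff[OF l] linear_sum[OF l] linear_scale[OF l])
        also have "(\<Sum>i\<in>F. G s (E k s) (e i s) * G s (e i s) (e j s)) = (\<Sum>i\<in>F. if i
            = j then G s (E k s) (e i s) else 0)"
          by (rule sum.cong) (auto simp: on j)
        finally show ?thesis using j insert.hyps(1) by simp
      qed
      have fk: "f k s = inverse (sqrt (n s)) *\<^sub>R N s" by (simp add: f_def)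
      have kk: "G s (f k s) (f k s) = 1"
        using np by (simp add: fk bilinear_lmul[OF bi] bilinear_rmul[OF bi] n_def[symmetric] field_simps)
      have kj: "G s (f k s) (f j s) = 0" if "j \<in> F" for j
        by (simp add: fk fF[OF that] bilinear_lmul[OF bi] Ne[OF that])
      have O: "\<forall>i\<in>insert k F. \<forall>j\<in>insert k F. G s (f i s) (f j s) = (if i = j then 1 else 0)"
        using kk kj sy on fF insert.hyps(2) by (metis insert_iff)
      have im: "(\<lambda>i. f i s) ` F = (\<lambda>i. e i s) ` F" using fF by (auto simp: image_iff)
      have S1: "(\<Sum>i\<in>F. G s (E k s) (e i s) *\<^sub>R e i s) \<in> span ((\<lambda>i. e i s) ` F)"
        by (intro span_sum span_scale span_base) auto
      have S: "span ((\<lambda>i. f i s) ` insert k F) = span ((\<lambda>i. E i s) ` insert k F)"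
      proof (intro equalityI span_minimal subspace_span)
        show "(\<lambda>i. f i s) ` insert k F \<subseteq> span ((\<lambda>i. E i s) ` insert k F)"
        proof -
          have sub: "span ((\<lambda>i. e i s) ` F) \<subseteq> span ((\<lambda>i. E i s) ` insert k F)"
            unfolding sp by (rule span_mono) auto
          have "f k s \<in> span ((\<lambda>i. E i s) ` insert k F)"
            unfolding fk N_def using sub S1 by (intro span_scale span_diff) (auto intro: span_base)
          moreover have "(\<lambda>i. f i s) ` F \<subseteq> span ((\<lambda>i. E i s) ` insert k F)"
            unfolding im using sub span_superset by blast
          ultimately show ?thesis by auto
        qed
        show "(\<lambda>i. E i s) ` insert k F \<subseteq> span ((\<lambda>i. f i s) ` insert k F)"
        proof -
          have sub: "span ((\<lambda>i. e i s) ` F) \<subseteq> span ((\<lambda>i. f i s) ` insert k F)"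
            unfolding im[symmetric] by (rule span_mono) auto
          have "E k s = sqrt (n s) *\<^sub>R f k s + (\<Sum>i\<in>F. G s (E k s) (e i s) *\<^sub>R e i s)"
            using np by (simp add: fk N_def)
          moreover have "sqrt (n s) *\<^sub>R f k s + (\<Sum>i\<in>F. G s (E k s) (e i s) *\<^sub>R e i s)
              \<in> span ((\<lambda>i. f i s) ` insert k F)"
            using sub S1 by (auto intro!: span_add span_scale span_base[of "f k s"])
          ultimately have "E k s \<in> span ((\<lambda>i. f i s) ` insert k F)" by simp
          moreover have "(\<lambda>i. E i s) ` F \<subseteq> span ((\<lambda>i. f i s) ` insert k F)"
            using sub span_superset sp by blast
          ultimately show ?thesis by auto
        qed
      qed
      show "(\<forall>i\<in>insert k F. \<forall>j\<in>insert k F. G s (f i s) (f j s) = (if i = j then 1 else 0)) \<and>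
       span ((\<lambda>i. f i s) ` insert k F) = span ((\<lambda>i. E i s) ` insert k F)" using O S by blast
    qed
  qed
  with Cf show ?case by (intro exI[of _ f] conjI ballI) auto
qed

section \<open>Families of bilinear maps\<close>

lemma Ck_on_cong:
  assumes "\<And>x. x \<in> S \<Longrightarrow> f x = g x" and "Ck_on k S f"
  shows "Ck_on k S g"
  using assms
proof (induction k arbitrary: f g)
  case 0
  then show ?case by (simp cong: continuous_on_cong)
next
  case (Suc k)
  have iff: "(f has_derivative D) (at x within S) \<longleftrightarrow> (g has_derivative D) (at x within S)" if "x \<in> S" for x D
    using has_derivative_transform[OF that, of g f] has_derivative_transform[OF that, of f g]
      Suc.prems(1) by metis
  have "g differentiable_on S"
    using Suc.prems(2) iff by (auto simp: differentiable_on_def differentiable_def)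
  moreover have "Ck_on k S (\<lambda>x. frechet_derivative g (at x within S) v)" for v
  proof (rule Suc.IH)
    show "Ck_on k S (\<lambda>x. frechet_derivative f (at x within S) v)" using Suc.prems(2) by simp
    show "frechet_derivative f (at x within S) v = frechet_derivative g (at x within S) v" if "x \<in> S" for x
      unfolding frechet_derivative_def iff[OF that] ..
  qed
  ultimately show ?case by simp
qed

lemma smooth_on_continuous:
  assumes "smooth_on S f"
  shows "continuous_on S f"
proof -
  have "Ck_on 0 S f" using assms unfolding smooth_on_def by (rule spec)
  then show ?thesis by simp
qed

lemma smooth_on_differentiable_on:
  assumes "smooth_on S f"
  shows "f differentiable_on S"
proof -
  have "Ck_on (Suc 0) S f" using assms unfolding smooth_on_def by (rule spec)
  then show ?thesis by simp
qed

lemma smooth_on_has_derivative: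
  assumes "smooth_on S f" "open S" "x \<in> S"
  shows "(f has_derivative frechet_derivative f (at x)) (at x)"
  using smooth_on_differentiable_on[OF assms(1)] assms(2,3)
  by (simp add: differentiable_on_eq_differentiable_at frechet_derivative_works[symmetric])

lemma smooth_on_derivative:
  assumes "smooth_on S f" "open S"
  shows "smooth_on S (\<lambda>x. frechet_derivative f (at x) v)"
  unfolding smooth_on_def
proof
  fix k
  have "Ck_on (Suc k) S f" using assms(1) unfolding smooth_on_def by blast
  then have "Ck_on k S (\<lambda>x. frechet_derivative f (at x within S) v)" by simp
  then show "Ck_on k S (\<lambda>x. frechet_derivative f (at x) v)"
    by (rule Ck_on_cong[rotated]) (use assms(2) in \<open>simp add: at_within_open[OF _ assms(2)]\<close>)
qed

lemma smooth_on_second_derivative: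
  assumes "smooth_on S f" "open S" "x \<in> S"
  shows "((\<lambda>y. frechet_derivative f (at y) v) has_derivative
     frechet_derivative (\<lambda>y. frechet_derivative f (at y) v) (at x)) (at x)"
  using smooth_on_has_derivative[OF smooth_on_derivative[OF assms(1,2)] assms(2,3)] .

section \<open>Differentiation of bilinear families\<close>

text \<open>Derivatives are unique, so additivity and homogeneity of every \<open>H x\<close> in
  each argument pass to \<open>dH\<close>.\<close>

lemma bilinear_family_derivative_bilinear:
  fixes H :: "'x::real_normed_vector \<Rightarrow> 'e::euclidean_space \<Rightarrow> 'e \<Rightarrow> 'b::real_normed_vector"
  assumes "open D" "x \<in> D" and bil: "\<And>x. x \<in> D \<Longrightarrow> bilinear (H x)"
    and dH: "\<And>a b. ((\<lambda>x. H x a b) has_derivative (\<lambda>h. dH h a b)) (at x)"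
  shows "bilinear (dH h)"
proof -
  have u: "h1 = h2" if "((\<lambda>x. f x) has_derivative h1) (at x)" "((\<lambda>x. f' x) has_derivative h2)
      (at x)" "\<And>x. x \<in> D \<Longrightarrow> f x = f' x"
    for f f' :: "'x \<Rightarrow> 'b" and h1 h2
    by (rule has_derivative_unique[OF has_derivative_transform_within_open[OF that(1) assms(1,2)]
      that(2)]) (use that(3) in simp)
  have 1: "(\<lambda>h. dH h (a + a') b) = (\<lambda>h. dH h a b + dH h a' b)" for a a' b
    by (rule u[OF dH has_derivative_add[OF dH dH]]) (simp add: bilinear_ladd bil)
  have 2: "(\<lambda>h. dH h (r *\<^sub>R a) b) = (\<lambda>h. r *\<^sub>R dH h a b)" for a b r
    by (rule u[OF dH has_derivative_scaleR_right[OF dH]]) (simp add: bilinear_lmul bil)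
  have 3: "(\<lambda>h. dH h b (a + a')) = (\<lambda>h. dH h b a + dH h b a')" for a a' b
    by (rule u[OF dH has_derivative_add[OF dH dH]]) (simp add: bilinear_radd bil)
  have 4: "(\<lambda>h. dH h b (r *\<^sub>R a)) = (\<lambda>h. r *\<^sub>R dH h b a)" for a b r
    by (rule u[OF dH has_derivative_scaleR_right[OF dH]]) (simp add: bilinear_rmul bil)
  show ?thesis
    unfolding bilinear_def
    using 1[THEN fun_cong] 2[THEN fun_cong] 3[THEN fun_cong] 4[THEN fun_cong]
      by (intro conjI allI linearI) simp_all
qed

text \<open>Only the components \<open>H x a b\<close> with fixed \<open>a\<close>, \<open>b\<close>
  come with a derivative in \<open>x\<close>, so both moving arguments are expanded in the basis.
  The product rule for the metric along the curve, the derivative of the Christoffel term and the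
  transformation laws under chart changes all rest on this rule.\<close>

lemma bilinear_family_has_derivative:
  fixes H :: "'x::real_normed_vector \<Rightarrow> 'e::euclidean_space \<Rightarrow> 'e \<Rightarrow> 'b::real_normed_vector"
    and X :: "'p::real_normed_vector \<Rightarrow> 'x"
  assumes "z \<in> S" and D: "open D" "X z \<in> D" and bil: "\<And>x. x \<in> D \<Longrightarrow> bilinear (H x)"
    and dH: "\<And>a b. ((\<lambda>x. H x a b) has_derivative (\<lambda>h. dH h a b)) (at (X z))"
    and X: "(X has_derivative X') (at z within S)"
    and \<alpha>: "(\<alpha> has_derivative \<alpha>') (at z within S)" and \<beta>: "(\<beta> has_derivative \<beta>') (at z within S)"
  shows "((\<lambda>y. H (X y) (\<alpha> y) (\<beta> y)) has_derivative
     (\<lambda>h. dH (X' h) (\<alpha> z) (\<beta> z) + H (X z) (\<alpha>' h) (\<beta> z) + H (X z) (\<alpha> z) (\<beta>' h))) (at z within S)"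
proof -
  have bdH: "bilinear (dH h)" for h by (rule bilinear_family_derivative_bilinear[OF D bil dH])
  have HX: "((\<lambda>y. H (X y) a b) has_derivative (\<lambda>h. dH (X' h) a b)) (at z within S)" for a b
    by (rule has_derivative_compose[OF X dH])
  have der: "((\<lambda>y. \<Sum>a\<in>Basis. \<Sum>b\<in>Basis. ((\<alpha> y \<bullet> a) * (\<beta> y \<bullet> b)) *\<^sub>R H (X y) a b) has_derivative
     (\<lambda>h. \<Sum>a\<in>Basis. \<Sum>b\<in>Basis. ((\<alpha> z \<bullet> a) * (\<beta> z \<bullet> b)) *\<^sub>R dH (X' h) a b +
        ((\<alpha> z \<bullet> a) * (\<beta>' h \<bullet> b) + (\<alpha>' h \<bullet> a) * (\<beta> z \<bullet> b)) *\<^sub>R H (X z) a b)) (at z within S)"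
    by (intro has_derivative_sum has_derivative_scaleR has_derivative_mult has_derivative_inner_left \<alpha> \<beta> HX)
  have eq: "(\<lambda>h. \<Sum>a\<in>Basis. \<Sum>b\<in>Basis. ((\<alpha> z \<bullet> a) * (\<beta> z \<bullet> b)) *\<^sub>R dH (X' h) a b +
        ((\<alpha> z \<bullet> a) * (\<beta>' h \<bullet> b) + (\<alpha>' h \<bullet> a) * (\<beta> z \<bullet> b)) *\<^sub>R H (X z) a b) =
     (\<lambda>h. dH (X' h) (\<alpha> z) (\<beta> z) + H (X z) (\<alpha>' h) (\<beta> z) + H (X z) (\<alpha> z) (\<beta>' h))"
    by (rule ext) (simp add: bilinear_expand[OF bdH, of _ "\<alpha> z" "\<beta> z"] bilinear_expand[OF bil[OF D(2)],
      of "\<alpha>' _" "\<beta> z"]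
        bilinear_expand[OF bil[OF D(2)], of "\<alpha> z" "\<beta>' _"] scaleR_left_distrib sum.distrib add_ac)
  have evD: "\<forall>\<^sub>F y in at z within S. X y \<in> D"
    using has_derivative_continuous[OF X] D unfolding continuous_within by (intro topological_tendstoD) simp_all
  have "\<forall>\<^sub>F y in at z within S. (\<Sum>a\<in>Basis. \<Sum>b\<in>Basis. ((\<alpha> y \<bullet> a) * (\<beta> y \<bullet> b)) *\<^sub>R H (X y) a b)
      = H (X y) (\<alpha> y) (\<beta> y)"
    using evD by eventually_elim (simp add: bilinear_expand[OF bil, symmetric])
  moreover have "(\<Sum>a\<in>Basis. \<Sum>b\<in>Basis. ((\<alpha> z \<bullet> a) * (\<beta> z \<bullet> b)) *\<^sub>R H (X z) a b) = H (X z) (\<alpha> z) (\<beta> z)"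
    by (simp add: bilinear_expand[OF bil[OF D(2)], symmetric])
  ultimately show ?thesis
    by (rule has_derivative_transform_eventually[OF der[unfolded eq] _ _ \<open>z \<in> S\<close>])
qed

section \<open>Charts, tangent vectors and the Levi-Civita connection\<close>

locale riemannian =
  fixes \<A> :: "('m::{t2_space,second_countable_topology}, 'e::euclidean_space) chart set"
    and g :: "('m, 'e) metric"
  assumes riem: "riemannian_manifold \<A> g"
begin

abbreviation transition :: "('m, 'e) chart \<Rightarrow> ('m, 'e) chart \<Rightarrow> 'e \<Rightarrow> 'e" where
  "transition \<kappa> \<kappa>' \<equiv> coord \<kappa>' \<circ> chart_inv \<kappa>"

abbreviation overlap :: "('m, 'e) chart \<Rightarrow> ('m, 'e) chart \<Rightarrow> 'e set" where
  "overlap \<kappa> \<kappa>' \<equiv> coord \<kappa> ` (chart_dom \<kappa> \<inter> chart_dom \<kappa>')"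

abbreviation cdom :: "('m, 'e) chart \<Rightarrow> 'e set" where
  "cdom \<kappa> \<equiv> coord \<kappa> ` chart_dom \<kappa>"

abbreviation m :: "('m, 'e) chart \<Rightarrow> 'e \<Rightarrow> 'e \<Rightarrow> 'e \<Rightarrow> real" where
  "m \<equiv> metric_in_chart \<A> g"

lemma atlas: "smooth_atlas \<A>"
  using riem by (simp add: riemannian_manifold_def)

lemma
  assumes "\<kappa> \<in> \<A>"
  shows open_chart_dom: "open (chart_dom \<kappa>)" and open_cdom: "open (cdom \<kappa>)"
    and chart_homeo: "homeomorphism (chart_dom \<kappa>) (cdom \<kappa>) (coord \<kappa>) (chart_inv \<kappa>)"
  using atlas assms by (auto simp: smooth_atlas_def)

lemma chart_inv_coord [simp]: "\<kappa> \<in> \<A> \<Longrightarrow> p \<in> chart_dom \<kappa> \<Longrightarrow> chart_inv \<kappa> (coord \<kappa> p) = p"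
  using chart_homeo by (auto simp: homeomorphism_def)

lemma open_overlap:
  assumes "\<kappa> \<in> \<A>" "\<kappa>' \<in> \<A>"
  shows "open (overlap \<kappa> \<kappa>')"
proof -
  have "openin (top_of_set (cdom \<kappa>)) (overlap \<kappa> \<kappa>')"
    by (rule homeomorphism_imp_open_map[OF chart_homeo[OF assms(1)]])
       (rule openin_open_Int[OF open_chart_dom[OF assms(2)]])
  then show ?thesis using open_cdom[OF assms(1)] by (simp add: openin_open_eq)
qed

lemma smooth_transition: "\<kappa> \<in> \<A> \<Longrightarrow> \<kappa>' \<in> \<A> \<Longrightarrow> smooth_on (overlap \<kappa> \<kappa>') (transition \<kappa> \<kappa>')"
  using atlas by (auto simp: smooth_atlas_def)

lemma charts_atD: "\<kappa> \<in> charts_at \<A> p \<Longrightarrow> \<kappa> \<in> \<A>" "\<kappa> \<in> charts_at \<A> p \<Longrightarrow> p \<in> chart_dom \<kappa>"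
  by (auto simp: charts_at_def)

lemma charts_at_overlap: "\<kappa> \<in> charts_at \<A> p \<Longrightarrow> \<kappa>' \<in> charts_at \<A> p \<Longrightarrow> coord \<kappa> p \<in> overlap \<kappa> \<kappa>'"
  by (auto simp: charts_at_def)

lemma charts_at_cdom: "\<kappa> \<in> charts_at \<A> p \<Longrightarrow> coord \<kappa> p \<in> cdom \<kappa>"
  by (auto simp: charts_at_def)

lemma charts_at_points: "\<kappa> \<in> charts_at \<A> p \<Longrightarrow> p \<in> points \<A>"
  by (auto simp: charts_at_def points_def)

section \<open>Transition maps and tangent vectors\<close>

lemma transition_has_derivative:
  assumes "\<kappa> \<in> charts_at \<A> p" "\<kappa>' \<in> charts_at \<A> p"
  shows "(transition \<kappa> \<kappa>' has_derivative transition_deriv \<kappa> \<kappa>' p) (at (coord \<kappa> p))"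
  unfolding transition_deriv_def
  using smooth_on_has_derivative[OF smooth_transition open_overlap charts_at_overlap] assms
    charts_atD(1) by blast

lemma linear_transition_deriv:
  assumes "\<kappa> \<in> charts_at \<A> p" "\<kappa>' \<in> charts_at \<A> p"
  shows "linear (transition_deriv \<kappa> \<kappa>' p)"
  using transition_has_derivative[OF assms] by (rule has_derivative_linear)

lemma transition_deriv_self:
  assumes "\<kappa> \<in> charts_at \<A> p"
  shows "transition_deriv \<kappa> \<kappa> p a = a"
proof -
  have "((\<lambda>x. x) has_derivative transition_deriv \<kappa> \<kappa> p) (at (coord \<kappa> p))"
    by (rule has_derivative_transform_within_open[OF transition_has_derivative[OF assms assms]
      open_overlap charts_at_overlap[OF assms assms]])
       (use charts_atD(1)[OF assms] in auto)
  then have "transition_deriv \<kappa> \<kappa> p = (\<lambda>x. x)"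
    using has_derivative_ident has_derivative_unique by blast
  then show ?thesis by simp
qed

lemma transition_deriv_comp:
  assumes "\<kappa> \<in> charts_at \<A> p" "\<kappa>' \<in> charts_at \<A> p" "\<kappa>'' \<in> charts_at \<A> p"
  shows "transition_deriv \<kappa>' \<kappa>'' p (transition_deriv \<kappa> \<kappa>' p a) = transition_deriv \<kappa> \<kappa>'' p a"
proof -
  let ?O = "overlap \<kappa> \<kappa>' \<inter> overlap \<kappa> \<kappa>''"
  have A: "\<kappa> \<in> \<A>" "\<kappa>' \<in> \<A>" "\<kappa>'' \<in> \<A>" using assms charts_atD(1) by auto
  have eq: "transition \<kappa> \<kappa>' (coord \<kappa> p) = coord \<kappa>' p" using A assms charts_atD(2) by simp
  have h1: "((transition \<kappa>' \<kappa>'' \<circ> transition \<kappa> \<kappa>') has_derivative (transition_deriv \<kappa>' \<kappa>'' p \<circ>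
      transition_deriv \<kappa> \<kappa>' p)) (at (coord \<kappa> p))"
    by (rule diff_chain_at[OF transition_has_derivative[OF assms(1,2)]]) (use
      transition_has_derivative[OF assms(2,3)] eq in simp)
  have h2: "(transition \<kappa>' \<kappa>'' \<circ> transition \<kappa> \<kappa>') x = transition \<kappa> \<kappa>'' x" if "x \<in> ?O" for x
  proof -
    obtain q r where q: "x = coord \<kappa> q" "q \<in> chart_dom \<kappa>" "q \<in> chart_dom \<kappa>'"
      and r: "x = coord \<kappa> r" "r \<in> chart_dom \<kappa>" "r \<in> chart_dom \<kappa>''"
      using \<open>x \<in> ?O\<close> by blast
    have "q = r" using q r chart_inv_coord[OF A(1)] by metis
    then show ?thesis using q r A by simp
  qed
  have h3: "open ?O" "coord \<kappa> p \<in> ?O" using A assms by (auto intro: open_overlap charts_at_overlap)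
  have "(transition \<kappa> \<kappa>'' has_derivative (transition_deriv \<kappa>' \<kappa>'' p \<circ> transition_deriv \<kappa> \<kappa>' p))
      (at (coord \<kappa> p))"
    by (rule has_derivative_transform_within_open[OF h1 h3 h2])
  then have "transition_deriv \<kappa>' \<kappa>'' p \<circ> transition_deriv \<kappa> \<kappa>' p = transition_deriv \<kappa> \<kappa>'' p"
    using transition_has_derivative[OF assms(1,3)] has_derivative_unique by blast
  then show ?thesis by (metis comp_apply)
qed

lemma transition_deriv_inverse:
  assumes "\<kappa> \<in> charts_at \<A> p" "\<kappa>' \<in> charts_at \<A> p"
  shows "transition_deriv \<kappa>' \<kappa> p (transition_deriv \<kappa> \<kappa>' p a) = a"
  using transition_deriv_comp[OF assms assms(1)] transition_deriv_self[OF assms(1)] by simp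

lemma tangent_spaceI:
  assumes "\<And>\<kappa>. \<kappa> \<notin> charts_at \<A> p \<Longrightarrow> v \<kappa> = 0"
    and "\<And>\<kappa> \<kappa>'. \<kappa> \<in> charts_at \<A> p \<Longrightarrow> \<kappa>' \<in> charts_at \<A> p \<Longrightarrow> v \<kappa>' = transition_deriv \<kappa> \<kappa>' p (v \<kappa>)"
  shows "v \<in> tangent_space \<A> p"
  unfolding tangent_space_def mem_Collect_eq by (intro conjI allI impI ballI assms)

lemma tangent_transition:
  "v \<in> tangent_space \<A> p \<Longrightarrow> \<kappa> \<in> charts_at \<A> p \<Longrightarrow> \<kappa>' \<in> charts_at \<A> p \<Longrightarrow> v \<kappa>' = transition_deriv \<kappa> \<kappa>' p (v \<kappa>)"
  unfolding tangent_space_def by blast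

lemma tangent_outside: "v \<in> tangent_space \<A> p \<Longrightarrow> \<kappa> \<notin> charts_at \<A> p \<Longrightarrow> v \<kappa> = 0"
  unfolding tangent_space_def by blast

lemma tangent_space_subspace: "subspace (tangent_space \<A> p)"
  unfolding subspace_def
proof (intro conjI ballI allI)
  note L = linear_transition_deriv
  show "0 \<in> tangent_space \<A> p"
    by (rule tangent_spaceI) (simp_all add: linear_0[OF L])
  show "u + v \<in> tangent_space \<A> p" if u: "u \<in> tangent_space \<A> p" and v: "v \<in> tangent_space \<A> p" for u v
  proof (rule tangent_spaceI)
    fix \<kappa> \<kappa>' assume k: "\<kappa> \<in> charts_at \<A> p" "\<kappa>' \<in> charts_at \<A> p"
    show "(u + v) \<kappa>' = transition_deriv \<kappa> \<kappa>' p ((u + v) \<kappa>)"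
      unfolding plus_fun_apply linear_add[OF L[OF k]]
      by (intro arg_cong2[where f = "(+)"] tangent_transition[OF _ k] u v)
  qed (use tangent_outside[OF u] tangent_outside[OF v] in simp)
  show "r *\<^sub>R u \<in> tangent_space \<A> p" if u: "u \<in> tangent_space \<A> p" for r u
  proof (rule tangent_spaceI)
    fix \<kappa> \<kappa>' assume k: "\<kappa> \<in> charts_at \<A> p" "\<kappa>' \<in> charts_at \<A> p"
    show "(r *\<^sub>R u) \<kappa>' = transition_deriv \<kappa> \<kappa>' p ((r *\<^sub>R u) \<kappa>)"
      unfolding scaleR_fun_def linear_scale[OF L[OF k]]
      by (intro arg_cong[where f = "scaleR r"] tangent_transition[OF _ k] u)
  qed (use tangent_outside[OF u] in \<open>simp add: scaleR_fun_def\<close>)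
qed

lemmas tangent_zero = subspace_0[OF tangent_space_subspace]
  and tangent_add = subspace_add[OF tangent_space_subspace]
  and tangent_diff = subspace_diff[OF tangent_space_subspace]
  and tangent_scale = subspace_scale[OF tangent_space_subspace]

lemma coord_tvec_tangent: "\<kappa> \<in> charts_at \<A> p \<Longrightarrow> coord_tvec \<A> \<kappa> p a \<in> tangent_space \<A> p"
  by (auto simp: tangent_space_def coord_tvec_def transition_deriv_comp)

lemma coord_tvec_apply [simp]: "\<kappa> \<in> charts_at \<A> p \<Longrightarrow> coord_tvec \<A> \<kappa> p a \<kappa> = a"
  by (simp add: coord_tvec_def transition_deriv_self)

text \<open>The component in one chart determines the others through the transition derivatives.
  Identities between tangent vectors can therefore be checked in a single chart.\<close>

lemma tangent_eqI:
  assumes "v \<in> tangent_space \<A> p" "w \<in> tangent_space \<A> p" "\<kappa> \<in> charts_at \<A> p" "v \<kappa> = w \<kappa>"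
  shows "v = w"
proof
  fix \<kappa>'
  show "v \<kappa>' = w \<kappa>'"
    using assms by (cases "\<kappa>' \<in> charts_at \<A> p") (simp_all add: tangent_transition[of _ p \<kappa> \<kappa>'] tangent_outside)
qed

lemma coord_tvec_of_component:
  "v \<in> tangent_space \<A> p \<Longrightarrow> \<kappa> \<in> charts_at \<A> p \<Longrightarrow> coord_tvec \<A> \<kappa> p (v \<kappa>) = v"
  by (rule tangent_eqI[of _ p _ \<kappa>]) (simp_all add: coord_tvec_tangent)

lemma coord_tvec_change:
  assumes "\<kappa> \<in> charts_at \<A> p" "\<kappa>' \<in> charts_at \<A> p"
  shows "coord_tvec \<A> \<kappa> p a = coord_tvec \<A> \<kappa>' p (transition_deriv \<kappa> \<kappa>' p a)"
proof (rule tangent_eqI[OF coord_tvec_tangent[OF assms(1)] coord_tvec_tangent[OF assms(2)] assms(2)])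
  show "coord_tvec \<A> \<kappa> p a \<kappa>' = coord_tvec \<A> \<kappa>' p (transition_deriv \<kappa> \<kappa>' p a) \<kappa>'"
    unfolding coord_tvec_apply[OF assms(2)] using assms(2) by (simp add: coord_tvec_def)
qed

section \<open>The metric in coordinates\<close>

lemma
  assumes "p \<in> points \<A>"
  shows metric_add: "u \<in> tangent_space \<A> p \<Longrightarrow> v \<in> tangent_space \<A> p \<Longrightarrow> w \<in> tangent_space \<A> p
      \<Longrightarrow> g p (u + v) w = g p u w + g p v w"
    and metric_scale: "u \<in> tangent_space \<A> p \<Longrightarrow> v \<in> tangent_space \<A> p \<Longrightarrow> g p (r *\<^sub>R u) v = r * g p u v"
    and metric_sym: "u \<in> tangent_space \<A> p \<Longrightarrow> v \<in> tangent_space \<A> p \<Longrightarrow> g p u v = g p v u"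
    and metric_pos: "u \<in> tangent_space \<A> p \<Longrightarrow> u \<noteq> 0 \<Longrightarrow> g p u u > 0"
proof -
  have R: "(\<forall>u\<in>tangent_space \<A> p. \<forall>v\<in>tangent_space \<A> p. \<forall>w\<in>tangent_space \<A> p. g p (u + v) w = g p u w
      + g p v w) \<and>
     (\<forall>r. \<forall>u\<in>tangent_space \<A> p. \<forall>v\<in>tangent_space \<A> p. g p (r *\<^sub>R u) v = r * g p u v) \<and>
     (\<forall>u\<in>tangent_space \<A> p. \<forall>v\<in>tangent_space \<A> p. g p u v = g p v u) \<and>
     (\<forall>u\<in>tangent_space \<A> p. u \<noteq> 0 \<longrightarrow> g p u u > 0)"
    using riem[unfolded riemannian_manifold_def] assms by (elim conjE) (erule bspec)
  note R1 = R[THEN conjunct1] and R2 = R[THEN conjunct2, THEN conjunct1]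
    and R3 = R[THEN conjunct2, THEN conjunct2, THEN conjunct1]
      and R4 = R[THEN conjunct2, THEN conjunct2, THEN conjunct2]
  show "u \<in> tangent_space \<A> p \<Longrightarrow> v \<in> tangent_space \<A> p \<Longrightarrow> w \<in> tangent_space \<A> p \<Longrightarrow> g p (u + v) w = g p u w
      + g p v w"
    using R1 by simp
  show "u \<in> tangent_space \<A> p \<Longrightarrow> v \<in> tangent_space \<A> p \<Longrightarrow> g p (r *\<^sub>R u) v = r * g p u v"
    using R2 by simp
  show "u \<in> tangent_space \<A> p \<Longrightarrow> v \<in> tangent_space \<A> p \<Longrightarrow> g p u v = g p v u"
    by (rule R3[rule_format])
  show "u \<in> tangent_space \<A> p \<Longrightarrow> u \<noteq> 0 \<Longrightarrow> g p u u > 0"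
    using R4 by simp
qed

lemma m_coord:
  assumes "\<kappa> \<in> charts_at \<A> p"
  shows "m \<kappa> (coord \<kappa> p) a b = g p (coord_tvec \<A> \<kappa> p a) (coord_tvec \<A> \<kappa> p b)"
  using chart_inv_coord[OF charts_atD[OF assms]] by (simp add: metric_in_chart_def Let_def)

lemma metric_eq_m:
  "\<kappa> \<in> charts_at \<A> p \<Longrightarrow> u \<in> tangent_space \<A> p \<Longrightarrow> v \<in> tangent_space \<A> p \<Longrightarrow> g p u v = m \<kappa> (coord \<kappa> p) (u \<kappa>) (v \<kappa>)"
  using m_coord[of \<kappa> p "u \<kappa>" "v \<kappa>"] coord_tvec_of_component[of u p \<kappa>] coord_tvec_of_component[of v p \<kappa>] by metis

lemma cdomE:
  assumes "x \<in> cdom \<kappa>" "\<kappa> \<in> \<A>"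
  obtains p where "x = coord \<kappa> p" "\<kappa> \<in> charts_at \<A> p"
proof -
  obtain p where "x = coord \<kappa> p" "p \<in> chart_dom \<kappa>" using assms(1) by (rule imageE)
  then show ?thesis using assms(2) that by (simp add: charts_at_def)
qed

lemma coord_tvec_add: "\<kappa> \<in> charts_at \<A> p \<Longrightarrow> coord_tvec \<A> \<kappa> p (a + b) = coord_tvec \<A> \<kappa> p a + coord_tvec \<A> \<kappa> p b"
  by (rule tangent_eqI[of _ p _ \<kappa>]) (simp_all add: coord_tvec_tangent tangent_add)

lemma coord_tvec_scale: "\<kappa> \<in> charts_at \<A> p \<Longrightarrow> coord_tvec \<A> \<kappa> p (r *\<^sub>R a) = r *\<^sub>R coord_tvec \<A> \<kappa> p a"
  by (rule tangent_eqI[of _ p _ \<kappa>]) (simp_all add: coord_tvec_tangent tangent_scale, simp add: scaleR_fun_def)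

lemma m_sym:
  assumes "\<kappa> \<in> \<A>" "x \<in> cdom \<kappa>"
  shows "m \<kappa> x a b = m \<kappa> x b a"
proof -
  obtain p where p: "x = coord \<kappa> p" "\<kappa> \<in> charts_at \<A> p" using assms(2,1) by (rule cdomE)
  show ?thesis
    unfolding p(1) m_coord[OF p(2)]
    by (rule metric_sym[OF charts_at_points[OF p(2)] coord_tvec_tangent[OF p(2)] coord_tvec_tangent[OF p(2)]])
qed

lemma m_bilinear:
  assumes "\<kappa> \<in> \<A>" "x \<in> cdom \<kappa>"
  shows "bilinear (m \<kappa> x)"
proof -
  obtain p where p: "x = coord \<kappa> p" "\<kappa> \<in> charts_at \<A> p" using assms(2,1) by (rule cdomE)
  have pp: "p \<in> points \<A>" using p(2) by (rule charts_at_points)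
  have "linear (\<lambda>a. m \<kappa> x a b)" for b
    using p(2) pp by (intro linearI) (simp_all add: p(1) m_coord coord_tvec_add coord_tvec_scale
      metric_add metric_scale coord_tvec_tangent)
  then show ?thesis
    unfolding bilinear_def using m_sym[OF assms] by simp
qed

lemma m_pos:
  assumes "\<kappa> \<in> \<A>" "x \<in> cdom \<kappa>" "a \<noteq> 0"
  shows "m \<kappa> x a a > 0"
proof -
  obtain p where p: "x = coord \<kappa> p" "\<kappa> \<in> charts_at \<A> p" using assms(2,1) by (rule cdomE)
  have "coord_tvec \<A> \<kappa> p a \<noteq> 0" using coord_tvec_apply[OF p(2), of a] assms(3) by auto
  then show ?thesis using p charts_at_points[OF p(2)] by (simp add: m_coord metric_pos coord_tvec_tangent)
qed

lemma m_smooth: "\<kappa> \<in> \<A> \<Longrightarrow> smooth_on (cdom \<kappa>) (\<lambda>x. m \<kappa> x a b)"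
  using riem by (simp add: riemannian_manifold_def)

lemma m_change:
  assumes "\<kappa> \<in> charts_at \<A> p" "\<kappa>' \<in> charts_at \<A> p"
  shows "m \<kappa> (coord \<kappa> p) a b = m \<kappa>' (coord \<kappa>' p) (transition_deriv \<kappa> \<kappa>' p a) (transition_deriv \<kappa> \<kappa>' p b)"
  using assms coord_tvec_change[OF assms] by (simp add: m_coord)

definition dm :: "('m, 'e) chart \<Rightarrow> 'e \<Rightarrow> 'e \<Rightarrow> 'e \<Rightarrow> 'e \<Rightarrow> real" where
  "dm \<kappa> x v a b = frechet_derivative (\<lambda>y. m \<kappa> y a b) (at x) v"

lemma m_has_derivative: "\<kappa> \<in> \<A> \<Longrightarrow> x \<in> cdom \<kappa> \<Longrightarrow> ((\<lambda>y. m \<kappa> y a b) has_derivative (\<lambda>v. dm \<kappa> x v a b)) (at x)"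
  unfolding dm_def by (rule smooth_on_has_derivative[OF m_smooth open_cdom])

lemma dm_bilinear: "\<kappa> \<in> \<A> \<Longrightarrow> x \<in> cdom \<kappa> \<Longrightarrow> bilinear (dm \<kappa> x v)"
  by (rule bilinear_family_derivative_bilinear[OF open_cdom _ m_bilinear m_has_derivative])

lemma dm_linear: "\<kappa> \<in> \<A> \<Longrightarrow> x \<in> cdom \<kappa> \<Longrightarrow> linear (\<lambda>v. dm \<kappa> x v a b)"
  using has_derivative_linear[OF m_has_derivative] .

lemma dm_sym: "\<kappa> \<in> \<A> \<Longrightarrow> x \<in> cdom \<kappa> \<Longrightarrow> dm \<kappa> x v a b = dm \<kappa> x v b a"
proof -
  assume A: "\<kappa> \<in> \<A>" "x \<in> cdom \<kappa>"
  have "((\<lambda>y. m \<kappa> y b a) has_derivative (\<lambda>v. dm \<kappa> x v a b)) (at x)"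
    by (rule has_derivative_transform_within_open[OF m_has_derivative[OF A] open_cdom[OF A(1)] A(2)])
      (rule m_sym[OF A(1)])
  then have "(\<lambda>v. dm \<kappa> x v a b) = (\<lambda>v. dm \<kappa> x v b a)" using m_has_derivative[OF A]
    by (rule has_derivative_unique)
  then show ?thesis by (rule fun_cong)
qed

lemma dm_smooth: "\<kappa> \<in> \<A> \<Longrightarrow> smooth_on (cdom \<kappa>) (\<lambda>x. dm \<kappa> x v a b)"
  unfolding dm_def by (rule smooth_on_derivative[OF m_smooth open_cdom])

section \<open>The Koszul formula and metric compatibility\<close>

abbreviation \<Gamma> :: "('m, 'e) chart \<Rightarrow> 'e \<Rightarrow> 'e \<Rightarrow> 'e \<Rightarrow> 'e" where
  "\<Gamma> \<equiv> christoffel \<A> g"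

lemma nondegenerate_eqI:
  assumes "\<kappa> \<in> \<A>" "x \<in> cdom \<kappa>" "\<And>d. m \<kappa> x u d = m \<kappa> x v d"
  shows "u = v"
proof (rule ccontr)
  assume "u \<noteq> v"
  then have "m \<kappa> x (u - v) (u - v) > 0" by (intro m_pos assms) simp
  then show False using assms(3)[of "u - v"] bilinear_lsub[OF m_bilinear[OF assms(1,2)]] by simp
qed

text \<open>The description in \<open>christoffel\<close> is meaningful once a solution exists and
  is unique. The right side \<open>k\<close> is linear in \<open>d\<close>, so the positive form
  \<open>m \<kappa> x\<close> represents it by a vector, and nondegeneracy gives uniqueness.\<close>

lemma koszul:
  assumes "\<kappa> \<in> \<A>" "x \<in> cdom \<kappa>"
  shows "2 * m \<kappa> x (\<Gamma> \<kappa> x a b) d = dm \<kappa> x a b d + dm \<kappa> x b a d - dm \<kappa> x d a b"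
proof -
  define k where "k d = dm \<kappa> x a b d + dm \<kappa> x b a d - dm \<kappa> x d a b" for d
  have lin: "linear k"
    unfolding k_def using dm_bilinear[OF assms] dm_linear[OF assms]
    by (intro linear_compose_add linear_compose_sub) (auto simp: bilinear_def)
  obtain S where S: "\<And>y. (\<Sum>d\<in>Basis. m \<kappa> x (S y) d *\<^sub>R d) = y"
    using nondegenerate_left_inverse[OF m_bilinear[OF assms] m_pos[OF assms]] by metis
  define u where "u = S (\<Sum>d\<in>Basis. (k d / 2) *\<^sub>R d)"
  have "(\<Sum>d\<in>Basis. m \<kappa> x u d *\<^sub>R d) = (\<Sum>d\<in>Basis. (k d / 2) *\<^sub>R d)" unfolding u_def by (rule S)
  then have b: "m \<kappa> x u d = k d / 2" if "d \<in> Basis" for d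
    using inner_sum_left_Basis[OF that, of "m \<kappa> x u"] inner_sum_left_Basis[OF that, of "\<lambda>d. k d / 2"] by simp
  have l: "linear (m \<kappa> x u)" using m_bilinear[OF assms] by (simp add: bilinear_def)
  have "linear (\<lambda>d. 2 *\<^sub>R m \<kappa> x u d)" by (rule linear_compose_scale_right[OF l])
  then have u: "2 * m \<kappa> x u d = k d" for d
    using linear_eq_stdbasis[OF _ lin, of "\<lambda>d. 2 *\<^sub>R m \<kappa> x u d"] b by (simp add: fun_eq_iff)
  have "\<Gamma> \<kappa> x a b = u"
    unfolding christoffel_def dm_def[symmetric]
  proof (rule the_equality)
    show "\<forall>d. 2 * m \<kappa> x u d = dm \<kappa> x a b d + dm \<kappa> x b a d - dm \<kappa> x d a b" using u by (simp add: k_def)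
    show "u' = u" if "\<forall>d. 2 * m \<kappa> x u' d = dm \<kappa> x a b d + dm \<kappa> x b a d - dm \<kappa> x d a b" for u'
    proof (rule nondegenerate_eqI[OF assms])
      show "m \<kappa> x u' d = m \<kappa> x u d" for d using that[rule_format, of d] u[of d] by (simp add: k_def)
    qed
  qed
  then show ?thesis using u by (simp add: k_def)
qed

lemma christoffel_eqI:
  assumes "\<kappa> \<in> \<A>" "x \<in> cdom \<kappa>" "\<And>d. 2 * m \<kappa> x u d = dm \<kappa> x a b d + dm \<kappa> x b a d - dm \<kappa> x d a b"
  shows "\<Gamma> \<kappa> x a b = u"
proof (rule nondegenerate_eqI[OF assms(1,2)])
  show "m \<kappa> x (\<Gamma> \<kappa> x a b) d = m \<kappa> x u d" for d
    using koszul[OF assms(1,2), of a b d] assms(3)[of d] by simp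
qed

lemma christoffel_bilinear:
  assumes "\<kappa> \<in> \<A>" "x \<in> cdom \<kappa>"
  shows "bilinear (\<Gamma> \<kappa> x)"
proof -
  note B = dm_bilinear[OF assms] note L = dm_linear[OF assms] note M = m_bilinear[OF assms] note K =
    koszul[OF assms]
  show ?thesis
    unfolding bilinear_def
    by (intro conjI allI linearI christoffel_eqI[OF assms])
      (simp_all add: bilinear_ladd[OF M] bilinear_lmul[OF M] bilinear_ladd[OF B] bilinear_lmul[OF B]
        bilinear_radd[OF B] bilinear_rmul[OF B]
        linear_add[OF L] linear_scale[OF L] distrib_left K, simp_all add: K mult.left_commute[of 2]
          algebra_simps)
qed

text \<open>In the Koszul formulas for the pairings of \<open>\<Gamma> \<kappa> x v a\<close> with
  \<open>b\<close> and of \<open>\<Gamma> \<kappa> x v b\<close> with \<open>a\<close>, the terms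
  differentiating in the directions \<open>a\<close> and \<open>b\<close> have opposite signs, so
  the sum is twice the derivative in direction \<open>v\<close>.\<close>

lemma metric_compatible:
  assumes "\<kappa> \<in> \<A>" "x \<in> cdom \<kappa>"
  shows "dm \<kappa> x v a b = m \<kappa> x (\<Gamma> \<kappa> x v a) b + m \<kappa> x a (\<Gamma> \<kappa> x v b)"
  using koszul[OF assms, of v a b] koszul[OF assms, of v b a] m_sym[OF assms, of a "\<Gamma> \<kappa> x v b"]
    dm_sym[OF assms, of _ a b] dm_sym[OF assms, of a b v] dm_sym[OF assms, of b a v]
  by simp

end

lemma smooth_on_tendsto:
  assumes "smooth_on S f" "open S" "x \<in> S"
  shows "(f \<longlongrightarrow> f x) (at x)"
proof -
  have "isCont f x"
    using continuous_on_eq_continuous_at[OF assms(2), of f] smooth_on_continuous[OF assms(1)] assms(3) by blast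
  then show ?thesis by (simp add: isCont_def)
qed

context riemannian
begin

section \<open>Regularity of the Christoffel map\<close>

text \<open>The Koszul formula is a linear system for \<open>\<Gamma> \<kappa> y a b\<close> whose
  form and right side depend differentiably on \<open>y\<close>, so its solution does as
  well.\<close>

lemma christoffel_differentiable:
  assumes "\<kappa> \<in> \<A>" "x \<in> cdom \<kappa>"
  shows "(\<lambda>y. \<Gamma> \<kappa> y a b) differentiable (at x)"
proof (rule nondegenerate_solution_differentiable[where G = "m \<kappa>"
  and w = "\<lambda>y d. (dm \<kappa> y a b d + dm \<kappa> y b a d - dm \<kappa> y d a b) / 2"])
  show "open (cdom \<kappa>)" by (rule open_cdom[OF assms(1)])
  show "x \<in> cdom \<kappa>" by fact
  show "bilinear (m \<kappa> y)" if "y \<in> cdom \<kappa>" for y by (rule m_bilinear[OF assms(1) that])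
  show "m \<kappa> x u u > 0" if "u \<noteq> 0" for u by (rule m_pos[OF assms that])
  show "m \<kappa> y (\<Gamma> \<kappa> y a b) d = (dm \<kappa> y a b d + dm \<kappa> y b a d - dm \<kappa> y d a b) / 2" if "y \<in> cdom \<kappa>" for y d
    using koszul[OF assms(1) that, of a b d] by simp
  show "(\<lambda>y. m \<kappa> y a b) differentiable (at x)" for a b
    using m_has_derivative[OF assms, of a b] by (rule differentiableI)
  have d: "(\<lambda>y. dm \<kappa> y v a b) differentiable (at x)" for v a b
    using smooth_on_has_derivative[OF dm_smooth[OF assms(1)] open_cdom[OF assms(1)] assms(2)]
      by (rule differentiableI)
  show "(\<lambda>y. (dm \<kappa> y a b d + dm \<kappa> y b a d - dm \<kappa> y d a b) / 2) differentiable (at x)" for d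
    by (intro differentiable_divide differentiable_add differentiable_diff d differentiable_const) simp
qed

definition d\<Gamma> :: "('m, 'e) chart \<Rightarrow> 'e \<Rightarrow> 'e \<Rightarrow> 'e \<Rightarrow> 'e \<Rightarrow> 'e" where
  "d\<Gamma> \<kappa> x v a b = frechet_derivative (\<lambda>y. \<Gamma> \<kappa> y a b) (at x) v"

lemma christoffel_has_derivative:
  "\<kappa> \<in> \<A> \<Longrightarrow> x \<in> cdom \<kappa> \<Longrightarrow> ((\<lambda>y. \<Gamma> \<kappa> y a b) has_derivative (\<lambda>v. d\<Gamma> \<kappa> x v a b)) (at x)"
  unfolding d\<Gamma>_def frechet_derivative_works[symmetric] by (rule christoffel_differentiable)

lemma d\<Gamma>_bilinear: "\<kappa> \<in> \<A> \<Longrightarrow> x \<in> cdom \<kappa> \<Longrightarrow> bilinear (d\<Gamma> \<kappa> x v)"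
  by (rule bilinear_family_derivative_bilinear[OF open_cdom _ christoffel_bilinear christoffel_has_derivative])

lemma d\<Gamma>_linear: "\<kappa> \<in> \<A> \<Longrightarrow> x \<in> cdom \<kappa> \<Longrightarrow> linear (\<lambda>v. d\<Gamma> \<kappa> x v a b)"
  using has_derivative_linear[OF christoffel_has_derivative] .

lemma christoffel_tendsto:
  assumes "\<kappa> \<in> \<A>" "x \<in> cdom \<kappa>"
  shows "((\<lambda>y. \<Gamma> \<kappa> y a b) \<longlongrightarrow> \<Gamma> \<kappa> x a b) (at x)"
  using has_derivative_continuous[OF christoffel_has_derivative[OF assms]] by (simp add: continuous_within)

text \<open>Differentiating the Koszul formula along \<open>v\<close> gives a linear system for the
  derivative of \<open>\<Gamma>\<close> with the same form \<open>m \<kappa> y\<close> and a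
  continuous right side, made of second derivatives of the metric and of \<open>\<Gamma>\<close>
  itself. The curvature contains this derivative and has to be continuous along the
  geodesic.\<close>

lemma d\<Gamma>_isCont:
  assumes "\<kappa> \<in> \<A>" "x \<in> cdom \<kappa>"
  shows "isCont (\<lambda>y. d\<Gamma> \<kappa> y v a b) x"
proof -
  let ?k = "\<lambda>y d. (dm \<kappa> y a b d + dm \<kappa> y b a d - dm \<kappa> y d a b) / 2"
  define ddm where "ddm y u a b = frechet_derivative (\<lambda>y. dm \<kappa> y u a b) (at y) v" for y u a b
  let ?dk = "\<lambda>y d. (ddm y a b d + ddm y b a d - ddm y d a b) / 2"
  have ddm: "((\<lambda>y. dm \<kappa> y u a b) has_derivative frechet_derivative (\<lambda>y. dm \<kappa> y u a b) (at y)) (at y)"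
    if "y \<in> cdom \<kappa>" for y u a b
    by (rule smooth_on_has_derivative[OF dm_smooth open_cdom that]) (use assms in auto)
  \<comment> \<open>The term in which the metric is differentiated is moved to the right and its
    argument \<open>\<Gamma> \<kappa> y a b\<close> is expanded in the basis, since
    \<open>dm\<close> is known to be continuous for fixed arguments.\<close>
  have eq: "m \<kappa> y (d\<Gamma> \<kappa> y v a b) d = ?dk y d - (\<Sum>i\<in>Basis. (\<Gamma> \<kappa> y a b \<bullet> i) * dm \<kappa> y v i d)"
    if y: "y \<in> cdom \<kappa>" for y d
  proof -
    have "((\<lambda>y. m \<kappa> y (\<Gamma> \<kappa> y a b) d) has_derivative
       (\<lambda>h. dm \<kappa> y h (\<Gamma> \<kappa> y a b) d + m \<kappa> y (d\<Gamma> \<kappa> y h a b) d + m \<kappa> y (\<Gamma> \<kappa> y a b) 0)) (at y)"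
      by (rule bilinear_family_has_derivative[where X = "\<lambda>y. y" and X' = "\<lambda>h. h" and D = "cdom \<kappa>"])
        (use y assms in \<open>auto intro: open_cdom m_bilinear m_has_derivative christoffel_has_derivative\<close>)
    moreover have "((\<lambda>y. m \<kappa> y (\<Gamma> \<kappa> y a b) d) has_derivative (\<lambda>h. (frechet_derivative (\<lambda>y. dm \<kappa> y a b d)
        (at y) h +
       frechet_derivative (\<lambda>y. dm \<kappa> y b a d) (at y) h - frechet_derivative (\<lambda>y. dm \<kappa> y d a b) (at y) h)
         / 2)) (at y)"
    proof (rule has_derivative_transform_within_open[where f = "\<lambda>y. ?k y d" and s = "cdom \<kappa>"])
      show "((\<lambda>y. ?k y d) has_derivative (\<lambda>h. (frechet_derivative (\<lambda>y. dm \<kappa> y a b d) (at y) h +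
       frechet_derivative (\<lambda>y. dm \<kappa> y b a d) (at y) h - frechet_derivative (\<lambda>y. dm \<kappa> y d a b) (at y) h)
         / 2)) (at y)"
        using has_derivative_divide[OF has_derivative_diff[OF has_derivative_add[OF ddm[OF y] ddm[OF y]]
          ddm[OF y]] has_derivative_const, of 2]
        by simp
      show "?k y d = m \<kappa> y (\<Gamma> \<kappa> y a b) d" if "y \<in> cdom \<kappa>" for y
        using koszul[OF assms(1) that, of a b d] by simp
    qed (use y assms open_cdom in auto)
    ultimately have "(\<lambda>h. dm \<kappa> y h (\<Gamma> \<kappa> y a b) d + m \<kappa> y (d\<Gamma> \<kappa> y h a b) d + m \<kappa> y (\<Gamma> \<kappa> y a b) 0) =
      (\<lambda>h. (frechet_derivative (\<lambda>y. dm \<kappa> y a b d) (at y) h +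
       frechet_derivative (\<lambda>y. dm \<kappa> y b a d) (at y) h - frechet_derivative (\<lambda>y. dm \<kappa> y d a b) (at y) h) / 2)"
      by (rule has_derivative_unique)
    from fun_cong[OF this, of v] have "dm \<kappa> y v (\<Gamma> \<kappa> y a b) d + m \<kappa> y (d\<Gamma> \<kappa> y v a b) d = ?dk y d"
      by (simp add: ddm_def bilinear_rzero[OF m_bilinear[OF assms(1) y]])
    moreover have "dm \<kappa> y v (\<Gamma> \<kappa> y a b) d = (\<Sum>i\<in>Basis. (\<Gamma> \<kappa> y a b \<bullet> i) * dm \<kappa> y v i d)"
      using bilinear_expand_left[OF dm_bilinear[OF assms(1) y], of v "\<Gamma> \<kappa> y a b" d] by simp
    ultimately show ?thesis by linarith
  qed
  have ddm_lim: "((\<lambda>y. ddm y u a b) \<longlongrightarrow> ddm x u a b) (at x)" for u a b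
    unfolding ddm_def
    by (rule smooth_on_tendsto[OF smooth_on_derivative[OF dm_smooth[OF assms(1)] open_cdom[OF assms(1)]]
      open_cdom[OF assms(1)] assms(2)])
  have dm_lim: "((\<lambda>y. dm \<kappa> y u a b) \<longlongrightarrow> dm \<kappa> x u a b) (at x)" for u a b
    by (rule smooth_on_tendsto[OF dm_smooth[OF assms(1)] open_cdom[OF assms(1)] assms(2)])
  have "((\<lambda>y. d\<Gamma> \<kappa> y v a b) \<longlongrightarrow> d\<Gamma> \<kappa> x v a b) (at x)"
  proof (rule nondegenerate_solution_tendsto[where G = "m \<kappa>" and ?G0.0 = "m \<kappa> x"
      and w = "\<lambda>y d. ?dk y d - (\<Sum>i\<in>Basis. (\<Gamma> \<kappa> y a b \<bullet> i) * dm \<kappa> y v i d)"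
      and ?w0.0 = "\<lambda>d. ?dk x d - (\<Sum>i\<in>Basis. (\<Gamma> \<kappa> x a b \<bullet> i) * dm \<kappa> x v i d)"])
    show "bilinear (m \<kappa> x)" by (rule m_bilinear[OF assms])
    show "0 < m \<kappa> x u u" if "u \<noteq> 0" for u by (rule m_pos[OF assms that])
    show "m \<kappa> x (d\<Gamma> \<kappa> x v a b) d = ?dk x d - (\<Sum>i\<in>Basis. (\<Gamma> \<kappa> x a b \<bullet> i) * dm \<kappa> x v i d)" for d
      by (rule eq[OF assms(2)])
    have "\<forall>\<^sub>F y in at x. y \<in> cdom \<kappa>"
      using open_cdom[OF assms(1)] assms(2) by (rule eventually_at_in_open')
    then show "\<forall>\<^sub>F y in at x. bilinear (m \<kappa> y) \<and> (\<forall>d. m \<kappa> y (d\<Gamma> \<kappa> y v a b) d = ?dk y d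
        - (\<Sum>i\<in>Basis. (\<Gamma> \<kappa> y a b \<bullet> i) * dm \<kappa> y v i d))"
    proof eventually_elim
      case (elim y)
      then show ?case using eq[OF elim] m_bilinear[OF assms(1) elim] by simp
    qed
    show "((\<lambda>y. m \<kappa> y a b) \<longlongrightarrow> m \<kappa> x a b) (at x)" for a b
      using has_derivative_continuous[OF m_has_derivative[OF assms]] by (simp add: continuous_within)
    show "((\<lambda>y. ?dk y d - (\<Sum>i\<in>Basis. (\<Gamma> \<kappa> y a b \<bullet> i) * dm \<kappa> y v i d)) \<longlongrightarrow> ?dk x d
        - (\<Sum>i\<in>Basis. (\<Gamma> \<kappa> x a b \<bullet> i) * dm \<kappa> x v i d)) (at x)" for d
      by (intro tendsto_intros ddm_lim dm_lim christoffel_tendsto assms) simp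
  qed
  then show ?thesis by (simp add: isCont_def)
qed

section \<open>The connection under chart changes\<close>

definition d2trans :: "('m, 'e) chart \<Rightarrow> ('m, 'e) chart \<Rightarrow> 'e \<Rightarrow> 'e \<Rightarrow> 'e \<Rightarrow> 'e" where
  "d2trans \<kappa> \<kappa>' x v w = frechet_derivative (\<lambda>y. frechet_derivative (transition \<kappa> \<kappa>') (at y) w) (at x) v"

lemma dtrans_has_derivative:
  assumes "\<kappa> \<in> \<A>" "\<kappa>' \<in> \<A>" "x \<in> overlap \<kappa> \<kappa>'"
  shows "((\<lambda>y. frechet_derivative (transition \<kappa> \<kappa>') (at y) w) has_derivative (\<lambda>v. d2trans \<kappa> \<kappa>' x v w)) (at x)"
  unfolding d2trans_def
  by (rule smooth_on_second_derivative[OF smooth_transition[OF assms(1,2)] open_overlap[OF assms(1,2)]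
    assms(3)])

lemma trans_has_derivative:
  assumes "\<kappa> \<in> \<A>" "\<kappa>' \<in> \<A>" "x \<in> overlap \<kappa> \<kappa>'"
  shows "(transition \<kappa> \<kappa>' has_derivative frechet_derivative (transition \<kappa> \<kappa>') (at x)) (at x)"
  by (rule smooth_on_has_derivative[OF smooth_transition[OF assms(1,2)] open_overlap[OF assms(1,2)] assms(3)])

lemma d2trans_sym:
  assumes "\<kappa> \<in> \<A>" "\<kappa>' \<in> \<A>" "x \<in> overlap \<kappa> \<kappa>'"
  shows "d2trans \<kappa> \<kappa>' x v w = d2trans \<kappa> \<kappa>' x w v"
  by (rule second_derivative_symmetric[OF open_overlap[OF assms(1,2)] assms(3) trans_has_derivative[OF
    assms(1,2)]
    dtrans_has_derivative[OF assms] dtrans_has_derivative[OF assms]])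

text \<open>The identity \<open>m_change\<close> holds at every point of the overlap and can be
  differentiated. The transition derivative varies with the point, which produces the two terms with
  \<open>d2trans\<close>.\<close>

lemma dm_change:
  assumes "\<kappa> \<in> charts_at \<A> p" "\<kappa>' \<in> charts_at \<A> p"
  defines "T \<equiv> transition_deriv \<kappa> \<kappa>' p" and "x \<equiv> coord \<kappa> p" and "x' \<equiv> coord \<kappa>' p"
  shows "dm \<kappa> x h a b = dm \<kappa>' x' (T h) (T a) (T b) + m \<kappa>' x' (d2trans \<kappa> \<kappa>' x h a) (T b)
      + m \<kappa>' x' (T a) (d2trans \<kappa> \<kappa>' x h b)"
proof -
  have A: "\<kappa> \<in> \<A>" "\<kappa>' \<in> \<A>" using assms(1,2) charts_atD(1) by blast+
  have pd: "p \<in> chart_dom \<kappa>" by (rule charts_atD(2)[OF assms(1)])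
  have xO: "x \<in> overlap \<kappa> \<kappa>'" unfolding x_def by (rule charts_at_overlap[OF assms(1,2)])
  have xc: "x \<in> cdom \<kappa>" using xO by blast
  let ?D = "\<lambda>y. frechet_derivative (transition \<kappa> \<kappa>') (at y)"
  have TD: "T = ?D x" unfolding T_def x_def transition_deriv_def ..
  have tx: "transition \<kappa> \<kappa>' x = x'" using A pd by (simp add: x_def x'_def)
  have xc': "x' \<in> cdom \<kappa>'" unfolding x'_def by (rule charts_at_cdom[OF assms(2)])
  have "((\<lambda>y. m \<kappa>' (transition \<kappa> \<kappa>' y) (?D y a) (?D y b)) has_derivative
     (\<lambda>h. dm \<kappa>' x' (T h) (T a) (T b) + m \<kappa>' x' (d2trans \<kappa> \<kappa>' x h a) (T b) + m \<kappa>' x' (T a) (d2trans \<kappa> \<kappa>'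
       x h b))) (at x)"
    unfolding TD tx[symmetric]
  proof (rule bilinear_family_has_derivative[where D = "cdom \<kappa>'"])
    show "bilinear (m \<kappa>' y)" if "y \<in> cdom \<kappa>'" for y by (rule m_bilinear[OF A(2) that])
    show "((\<lambda>x. m \<kappa>' x a b) has_derivative (\<lambda>h. dm \<kappa>' (transition \<kappa> \<kappa>' x) h a b))
        (at (transition \<kappa> \<kappa>' x))" for a b
      by (rule m_has_derivative[OF A(2)]) (use tx xc' in simp)
  qed (use tx xc' in \<open>simp_all add: open_cdom[OF A(2)] dtrans_has_derivative[OF A xO]
    trans_has_derivative[OF A xO] del: comp_apply\<close>)
  then have "((\<lambda>y. m \<kappa> y a b) has_derivative
     (\<lambda>h. dm \<kappa>' x' (T h) (T a) (T b) + m \<kappa>' x' (d2trans \<kappa> \<kappa>' x h a) (T b) + m \<kappa>' x' (T a) (d2trans \<kappa> \<kappa>'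
       x h b))) (at x)"
  proof (rule has_derivative_transform_within_open[OF _ open_overlap[OF A] xO])
    fix y assume "y \<in> overlap \<kappa> \<kappa>'"
    then obtain q where q: "y = coord \<kappa> q" "q \<in> chart_dom \<kappa>" "q \<in> chart_dom \<kappa>'" by blast
    have k: "\<kappa> \<in> charts_at \<A> q" "\<kappa>' \<in> charts_at \<A> q" using q A by (simp_all add: charts_at_def)
    have "transition \<kappa> \<kappa>' y = coord \<kappa>' q" using q A by simp
    then show "m \<kappa>' (transition \<kappa> \<kappa>' y) (?D y a) (?D y b) = m \<kappa> y a b"
      using m_change[OF k, of a b] unfolding transition_deriv_def q(1) by simp
  qed
  from has_derivative_unique[OF m_has_derivative[OF A(1) xc] this]
  show ?thesis by (rule fun_cong)
qed

text \<open>Inserting \<open>dm_change\<close> into the Koszul formula gives six terms with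
  \<open>d2trans\<close>. By symmetry of second derivatives four of them cancel and the two with
  directions \<open>v\<close> and \<open>w\<close> add up; they account for the inhomogeneous
  term.\<close>

lemma christoffel_change:
  assumes "\<kappa> \<in> charts_at \<A> p" "\<kappa>' \<in> charts_at \<A> p"
  defines "T \<equiv> transition_deriv \<kappa> \<kappa>' p" and "x \<equiv> coord \<kappa> p" and "x' \<equiv> coord \<kappa>' p"
  shows "T (\<Gamma> \<kappa> x v w) = \<Gamma> \<kappa>' x' (T v) (T w) + d2trans \<kappa> \<kappa>' x v w"
proof -
  have A: "\<kappa> \<in> \<A>" "\<kappa>' \<in> \<A>" using assms(1,2) charts_atD(1) by blast+
  have xO: "x \<in> overlap \<kappa> \<kappa>'" unfolding x_def by (rule charts_at_overlap[OF assms(1,2)])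
  have xc: "x \<in> cdom \<kappa>" using xO by blast
  have xc': "x' \<in> cdom \<kappa>'" unfolding x'_def by (rule charts_at_cdom[OF assms(2)])
  note dmc = dm_change[OF assms(1,2), folded T_def x_def x'_def]
  note mc = m_change[OF assms(1,2), folded T_def x_def x'_def]
  note s = d2trans_sym[OF A xO] and ms = m_sym[OF A(2) xc']
  have "\<Gamma> \<kappa>' x' (T v) (T w) = T (\<Gamma> \<kappa> x v w) - d2trans \<kappa> \<kappa>' x v w"
  proof (rule christoffel_eqI[OF A(2) xc'])
    fix d'
    \<comment> \<open>The transition derivative is invertible, so it suffices to test against
      vectors of the form \<open>T d\<close>.\<close>
    define d where "d = transition_deriv \<kappa>' \<kappa> p d'"
    have d': "d' = T d" unfolding T_def d_def by (rule transition_deriv_inverse[OF assms(2,1), symmetric])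
    have "2 * m \<kappa>' x' (T (\<Gamma> \<kappa> x v w) - d2trans \<kappa> \<kappa>' x v w) (T d) = 2 * m \<kappa> x (\<Gamma> \<kappa> x v w) d
        - 2 * m \<kappa>' x' (d2trans \<kappa> \<kappa>' x v w) (T d)"
      by (simp add: bilinear_lsub[OF m_bilinear[OF A(2) xc']] mc)
    also have "\<dots> = dm \<kappa>' x' (T v) (T w) (T d) + dm \<kappa>' x' (T w) (T v) (T d) - dm \<kappa>' x' (T d) (T v) (T w)"
      unfolding koszul[OF A(1) xc] dmc
      using s[of w v] s[of w d] s[of v d] ms[of "T w" "d2trans \<kappa> \<kappa>' x v d"] ms[of "T v" "d2trans \<kappa> \<kappa>' x w d"]
       ms[of "T w" "d2trans \<kappa> \<kappa>' x d v"] ms[of "T v" "d2trans \<kappa> \<kappa>' x d w"] by simp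
    finally show "2 * m \<kappa>' x' (T (\<Gamma> \<kappa> x v w) - d2trans \<kappa> \<kappa>' x v w) d' =
       dm \<kappa>' x' (T v) (T w) d' + dm \<kappa>' x' (T w) (T v) d' - dm \<kappa>' x' d' (T v) (T w)" by (simp only: d')
  qed
  then show ?thesis by simp
qed

lemma transition_vector_has_derivative:
  fixes X :: "'p::real_normed_vector \<Rightarrow> 'e"
  assumes A: "\<kappa> \<in> \<A>" "\<kappa>' \<in> \<A>" and "z \<in> S" and Xz: "X z \<in> overlap \<kappa> \<kappa>'"
    and X: "(X has_derivative X') (at z within S)" and W: "(W has_derivative W') (at z within S)"
  shows "((\<lambda>y. frechet_derivative (transition \<kappa> \<kappa>') (at (X y)) (W y)) has_derivative
    (\<lambda>h. d2trans \<kappa> \<kappa>' (X z) (X' h) (W z) + frechet_derivative (transition \<kappa> \<kappa>') (at (X z)) (W' h))) (at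
      z within S)"
proof -
  \<comment> \<open>The factor \<open>a \<bullet> c\<close> turns the linear family into a bilinear one.\<close>
  obtain c :: 'e where c: "c \<in> Basis" using nonempty_Basis by blast
  let ?D = "\<lambda>y. frechet_derivative (transition \<kappa> \<kappa>') (at y)"
  define H where "H y a b = (a \<bullet> c) *\<^sub>R ?D y b" for y and a b :: 'e
  have bil: "bilinear (H y)" if "y \<in> overlap \<kappa> \<kappa>'" for y
    unfolding bilinear_def H_def
    using has_derivative_linear[OF trans_has_derivative[OF A that]]
    by (auto intro!: linearI simp: inner_add_left scaleR_add_left linear_add linear_scale scaleR_add_right)
  have "((\<lambda>y. H (X y) c (W y)) has_derivative
      (\<lambda>h. (c \<bullet> c) *\<^sub>R d2trans \<kappa> \<kappa>' (X z) (X' h) (W z) + H (X z) 0 (W z) + H (X z) c (W' h))) (at z within S)"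
  proof (rule bilinear_family_has_derivative[where D = "overlap \<kappa> \<kappa>'"
    and dH = "\<lambda>h a b. (a \<bullet> c) *\<^sub>R d2trans \<kappa> \<kappa>' (X z) h b"])
    show "((\<lambda>x. H x a b) has_derivative (\<lambda>h. (a \<bullet> c) *\<^sub>R d2trans \<kappa> \<kappa>' (X z) h b)) (at (X z))" for a b
      unfolding H_def by (rule has_derivative_scaleR_right[OF dtrans_has_derivative[OF A Xz]])
  qed (rule assms open_overlap[OF A] bil has_derivative_const | assumption)+
  then show ?thesis using c by (simp add: H_def)
qed

end

section \<open>Covariant differentiation along a geodesic\<close>

locale geodesic_curve = riemannian \<A> g
  for \<A> :: "('m::{t2_space,second_countable_topology}, 'e::euclidean_space) chart set"
    and g :: "('m, 'e) metric" +
  fixes I :: "real set" and c :: "real \<Rightarrow> 'm"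
  assumes interval: "is_interval I" and geod: "geodesic \<A> g I c" and nonconst: "\<not> c constant_on I"
begin

abbreviation TM :: "real \<Rightarrow> ('m, 'e) tvec set" where
  "TM t \<equiv> tangent_space \<A> (c t)"

abbreviation charts :: "real \<Rightarrow> ('m, 'e) chart set" where
  "charts t \<equiv> charts_at \<A> (c t)"

abbreviation vel :: "real \<Rightarrow> ('m, 'e) tvec" where
  "vel \<equiv> velocity \<A> I c"

abbreviation cov :: "(real \<Rightarrow> ('m, 'e) tvec) \<Rightarrow> real \<Rightarrow> ('m, 'e) tvec" where
  "cov \<equiv> cov_deriv \<A> g I c"

abbreviation xc :: "('m, 'e) chart \<Rightarrow> real \<Rightarrow> 'e" where
  "xc \<kappa> s \<equiv> coord \<kappa> (c s)"

lemma curve_smooth: "smooth_curve \<A> I c"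
  using geod by (simp add: geodesic_def)

lemma curve_continuous: "continuous_on I c"
  using curve_smooth by (simp add: smooth_curve_def)

lemma curve_points: "t \<in> I \<Longrightarrow> c t \<in> points \<A>"
  using curve_smooth unfolding smooth_curve_def by blast

lemma chart_exists:
  assumes "t \<in> I"
  obtains \<kappa> where "\<kappa> \<in> charts t"
  using curve_points[OF assms] unfolding points_def charts_at_def by blast

lemma curve_coord_smooth: "\<kappa> \<in> \<A> \<Longrightarrow> smooth_on {t\<in>I. c t \<in> chart_dom \<kappa>} (xc \<kappa>)"
  using curve_smooth by (simp add: smooth_curve_def)

lemma xc_cdom: "\<kappa> \<in> charts t \<Longrightarrow> xc \<kappa> t \<in> cdom \<kappa>"
  by (rule charts_at_cdom)

section \<open>Charts and one-sided derivatives along the curve\<close>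

lemma charts_near:
  assumes "t \<in> I" "\<kappa> \<in> charts t"
  shows "\<forall>\<^sub>F s in nhds t. s \<in> I \<longrightarrow> \<kappa> \<in> charts s"
proof -
  have "continuous (at t within I) c" using curve_continuous assms(1)
    by (simp add: continuous_on_eq_continuous_within)
  then have "\<forall>\<^sub>F s in at t within I. c s \<in> chart_dom \<kappa>"
    unfolding continuous_within
    by (rule topological_tendstoD) (use assms charts_atD open_chart_dom in blast)+
  then show ?thesis
    unfolding eventually_at_filter by eventually_elim (use assms in \<open>auto simp: charts_at_def\<close>)
qed

text \<open>A nonconstant curve cannot live on a single parameter. Hence every point of
  \<open>I\<close>, end points included, is an accumulation point, and derivatives within
  \<open>I\<close> are unique.\<close>

lemma islimpt_interval:
  assumes "t \<in> I"
  shows "t islimpt I"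
proof (rule connected_imp_perfect)
  show "connected I" using interval by (simp add: is_interval_connected)
  show "I \<noteq> {u}" for u using nonconst by (auto simp: constant_on_def)
qed fact

lemma within_nontrivial: "t \<in> I \<Longrightarrow> at t within I \<noteq> bot"
  using islimpt_interval by (simp add: trivial_limit_within)

lemma vd_eq: "t \<in> I \<Longrightarrow> (f has_vector_derivative D) (at t within I) \<Longrightarrow> vector_derivative f (at t within I) = D"
  by (rule vector_derivative_within[OF within_nontrivial])

text \<open>Smoothness refers to the parameters sent into the chart domain, whereas velocities and
  covariant derivatives are taken within \<open>I\<close>. The former set is relatively open in
  \<open>I\<close>, so the derivatives agree.\<close>

lemma at_within_chart:
  assumes "t \<in> I" "c t \<in> chart_dom \<kappa>" "\<kappa> \<in> \<A>"
  shows "at t within {s\<in>I. c s \<in> chart_dom \<kappa>} = at t within I"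
proof -
  have "\<forall>\<^sub>F s in nhds t. s \<in> I \<longrightarrow> \<kappa> \<in> charts s"
    by (rule charts_near) (use assms in \<open>simp_all add: charts_at_def\<close>)
  then obtain S where S: "open S" "t \<in> S" "\<And>s. s \<in> S \<Longrightarrow> s \<in> I \<longrightarrow> \<kappa> \<in> charts s"
    unfolding eventually_nhds by blast
  show ?thesis
    by (rule at_within_nhd[OF S(2,1)]) (use S(3) in \<open>auto simp: charts_at_def\<close>)
qed

lemma smooth_on_has_vd:
  fixes f :: "real \<Rightarrow> 'e"
  assumes f: "smooth_on {s\<in>I. c s \<in> chart_dom \<kappa>} f" and k: "\<kappa> \<in> \<A>"
  shows "t \<in> I \<Longrightarrow> c t \<in> chart_dom \<kappa> \<Longrightarrow>
      (f has_vector_derivative vector_derivative f (at t within I)) (at t within I)"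
    and "smooth_on {s\<in>I. c s \<in> chart_dom \<kappa>} (\<lambda>s. vector_derivative f (at s within I))"
proof -
  let ?U = "{s\<in>I. c s \<in> chart_dom \<kappa>}"
  have D: "(f has_vector_derivative frechet_derivative f (at t within ?U) 1) (at t within I)"
    if t: "t \<in> ?U" for t
  proof -
    have "f differentiable (at t within ?U)"
      using smooth_on_differentiable_on[OF f] t by (simp add: differentiable_on_def)
    then have d: "(f has_derivative frechet_derivative f (at t within ?U)) (at t within ?U)"
      by (simp add: frechet_derivative_works)
    have "frechet_derivative f (at t within ?U) = (\<lambda>h. h *\<^sub>R frechet_derivative f (at t within ?U) 1)"
    proof
      show "frechet_derivative f (at t within ?U) h = h *\<^sub>R frechet_derivative f (at t within ?U) 1" for h
        using linear_scale[OF has_derivative_linear[OF d], of h 1] by simp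
    qed
    from has_derivative_eq_rhs[OF d this] have "(f has_vector_derivative frechet_derivative f
        (at t within ?U) 1) (at t within ?U)"
      unfolding has_vector_derivative_def .
    then show ?thesis using at_within_chart[of t \<kappa>] t k by simp
  qed
  have eq: "frechet_derivative f (at t within ?U) 1 = vector_derivative f (at t within I)" if "t \<in> ?U" for t
    using vd_eq[OF _ D[OF that]] that by simp
  show "(f has_vector_derivative vector_derivative f (at t within I)) (at t within I)"
    if "t \<in> I" "c t \<in> chart_dom \<kappa>"
    using D[of t] eq[of t] that by simp
  show "smooth_on ?U (\<lambda>s. vector_derivative f (at s within I))"
    unfolding smooth_on_def
  proof
    fix k
    have "Ck_on (Suc k) ?U f" using f unfolding smooth_on_def by (rule spec)
    then have "Ck_on k ?U (\<lambda>x. frechet_derivative f (at x within ?U) 1)" by simp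
    then show "Ck_on k ?U (\<lambda>s. vector_derivative f (at s within I))"
      by (rule Ck_on_cong[where f = "\<lambda>x. frechet_derivative f (at x within ?U) 1", rotated]) (rule eq)
  qed
qed

lemma vel_apply: "\<kappa> \<in> charts t \<Longrightarrow> vel t \<kappa> = vector_derivative (xc \<kappa>) (at t within I)"
  by (simp add: velocity_def)

lemma position_has_vd:
  assumes "t \<in> I" "\<kappa> \<in> charts t"
  shows "(xc \<kappa> has_vector_derivative vel t \<kappa>) (at t within I)"
proof -
  note k = charts_atD[OF assms(2)]
  show ?thesis
    unfolding vel_apply[OF assms(2)]
      by (rule smooth_on_has_vd(1)[OF curve_coord_smooth[OF k(1)] k(1) assms(1) k(2)])
qed

lemma xc_continuous: "t \<in> I \<Longrightarrow> \<kappa> \<in> charts t \<Longrightarrow> continuous (at t within I) (xc \<kappa>)"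
  by (rule has_vector_derivative_continuous[OF position_has_vd])

lemma vel_smooth:
  assumes "\<kappa> \<in> \<A>"
  shows "smooth_on {s\<in>I. c s \<in> chart_dom \<kappa>} (\<lambda>s. vel s \<kappa>)"
  unfolding smooth_on_def
proof
  fix k
  show "Ck_on k {s\<in>I. c s \<in> chart_dom \<kappa>} (\<lambda>s. vel s \<kappa>)"
    by (rule Ck_on_cong[where f = "\<lambda>s. vector_derivative (xc \<kappa>) (at s within I)"])
      (use smooth_on_has_vd(2)[OF curve_coord_smooth[OF assms] assms] assms in \<open>simp_all add:
        smooth_on_def vel_apply charts_at_def\<close>)
qed

lemma transition_position:
  assumes "t \<in> I" "\<kappa> \<in> charts t" "\<kappa>' \<in> charts t"
  shows "\<forall>\<^sub>F s in nhds t. s \<in> I \<longrightarrow> transition \<kappa> \<kappa>' (xc \<kappa> s) = xc \<kappa>' s"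
  using charts_near[OF assms(1,2)] charts_near[OF assms(1,3)]
proof eventually_elim
  case (elim s)
  then show ?case using chart_inv_coord[OF charts_atD[of \<kappa> "c s"]] by simp
qed

lemma transition_deriv_position: "transition_deriv \<kappa> \<kappa>' (c s) = frechet_derivative (transition \<kappa> \<kappa>')
    (at (xc \<kappa> s))"
  by (simp add: transition_deriv_def)

lemma vel_tangent:
  assumes t: "t \<in> I"
  shows "vel t \<in> TM t"
proof (rule tangent_spaceI)
  show "vel t \<kappa> = 0" if "\<kappa> \<notin> charts t" for \<kappa> using that by (simp add: velocity_def)
  fix \<kappa> \<kappa>' assume k: "\<kappa> \<in> charts t" "\<kappa>' \<in> charts t"
  have "((transition \<kappa> \<kappa>' \<circ> xc \<kappa>) has_vector_derivative transition_deriv \<kappa> \<kappa>' (c t) (vel t \<kappa>)) (at t within I)"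
    by (rule vector_derivative_diff_chain_within[OF position_has_vd[OF t k(1)]])
      (rule has_derivative_at_withinI[OF transition_has_derivative[OF k]])
  then have "(xc \<kappa>' has_vector_derivative transition_deriv \<kappa> \<kappa>' (c t) (vel t \<kappa>)) (at t within I)"
    using has_vector_derivative_within_cong_ev[OF transition_position[OF t k] t] by (simp add: comp_def)
  then show "vel t \<kappa>' = transition_deriv \<kappa> \<kappa>' (c t) (vel t \<kappa>)"
    using vd_eq[OF t] by (simp add: vel_apply[OF k(2)])
qed

section \<open>Fields along the curve under chart changes\<close>

text \<open>The transition derivative is taken at the moving point \<open>c s\<close>, whence the
  second-derivative term. It makes the plain derivative non-tensorial and is compensated by the
  inhomogeneous term of \<open>christoffel_change\<close>.\<close>

lemma field_change_chart:
  assumes t: "t \<in> I" and k: "\<kappa> \<in> charts t" "\<kappa>' \<in> charts t"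
    and X: "\<forall>\<^sub>F s in nhds t. s \<in> I \<longrightarrow> X s \<in> TM s"
    and D: "((\<lambda>s. X s \<kappa>) has_vector_derivative D) (at t within I)"
  shows "((\<lambda>s. X s \<kappa>') has_vector_derivative
    d2trans \<kappa> \<kappa>' (xc \<kappa> t) (vel t \<kappa>) (X t \<kappa>) + transition_deriv \<kappa> \<kappa>' (c t) D) (at t within I)"
proof -
  have A: "\<kappa> \<in> \<A>" "\<kappa>' \<in> \<A>" using k charts_atD(1) by blast+
  have O: "xc \<kappa> t \<in> overlap \<kappa> \<kappa>'" by (rule charts_at_overlap[OF k])
  note l = has_derivative_linear[OF dtrans_has_derivative[OF A O]] and l' = linear_transition_deriv[OF k]
  have "((\<lambda>s. frechet_derivative (transition \<kappa> \<kappa>') (at (xc \<kappa> s)) (X s \<kappa>)) has_derivative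
    (\<lambda>h. d2trans \<kappa> \<kappa>' (xc \<kappa> t) (h *\<^sub>R vel t \<kappa>) (X t \<kappa>) + frechet_derivative (transition \<kappa> \<kappa>') (at (xc \<kappa>
      t)) (h *\<^sub>R D))) (at t within I)"
    by (rule transition_vector_has_derivative[where X = "xc \<kappa>" and W = "\<lambda>s. X s \<kappa>", OF A t O])
      (use position_has_vd[OF t k(1)] D in \<open>simp_all add: has_vector_derivative_def\<close>)
  then have "((\<lambda>s. transition_deriv \<kappa> \<kappa>' (c s) (X s \<kappa>)) has_vector_derivative
    d2trans \<kappa> \<kappa>' (xc \<kappa> t) (vel t \<kappa>) (X t \<kappa>) + transition_deriv \<kappa> \<kappa>' (c t) D) (at t within I)"
    unfolding has_vector_derivative_def transition_deriv_position[symmetric]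
    by (simp add: linear_scale[OF l] linear_scale[OF l'] scaleR_right_distrib)
  moreover have "\<forall>\<^sub>F s in nhds t. s \<in> I \<longrightarrow> transition_deriv \<kappa> \<kappa>' (c s) (X s \<kappa>) = X s \<kappa>'"
    using charts_near[OF t k(1)] charts_near[OF t k(2)] X
  proof eventually_elim
    case (elim s)
    then show ?case using tangent_transition[of "X s" "c s" \<kappa> \<kappa>'] by simp
  qed
  ultimately show ?thesis 
    using has_vector_derivative_within_cong_ev[where f = "\<lambda>s. transition_deriv \<kappa> \<kappa>' (c s) (X s \<kappa>)"
      and g = "\<lambda>s. X s \<kappa>'", OF _ t] by simp
qed

lemma cov_apply:
  assumes "t \<in> I" "\<kappa> \<in> charts t" "((\<lambda>s. X s \<kappa>) has_vector_derivative D) (at t within I)"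
  shows "cov X t \<kappa> = D + \<Gamma> \<kappa> (xc \<kappa> t) (vel t \<kappa>) (X t \<kappa>)"
  using assms vd_eq[OF assms(1,3)] by (simp add: cov_deriv_def)

text \<open>\<open>cov_differentiable\<close> refers to all charts around \<open>c t\<close>;
  \<open>field_change_chart\<close> transports differentiability from one of them. The covariant
  derivative is tangent because the second-derivative term and the Christoffel term in the new chart
  add up to the image of the Christoffel term in the old one.\<close>

lemma cov_differentiableI:
  assumes t: "t \<in> I" and k: "\<kappa> \<in> charts t" and X: "\<forall>\<^sub>F s in nhds t. s \<in> I \<longrightarrow> X s \<in> TM s"
    and D: "(\<lambda>s. X s \<kappa>) differentiable (at t within I)"
  shows "cov_differentiable \<A> I c X t" and "cov X t \<in> TM t"
proof -
  obtain D' where D': "((\<lambda>s. X s \<kappa>) has_vector_derivative D') (at t within I)"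
    using D vector_derivative_works by blast
  show 1: "cov_differentiable \<A> I c X t"
    unfolding cov_differentiable_def
    using field_change_chart[where X = X, OF t k _ X D'] by (blast intro: differentiableI_vector)
  show "cov X t \<in> TM t"
  proof (rule tangent_spaceI)
    show "cov X t \<kappa> = 0" if "\<kappa> \<notin> charts t" for \<kappa> using that by (simp add: cov_deriv_def)
    fix \<kappa> \<kappa>' assume k: "\<kappa> \<in> charts t" "\<kappa>' \<in> charts t"
    obtain E where E: "((\<lambda>s. X s \<kappa>) has_vector_derivative E) (at t within I)"
      using 1 k(1) vector_derivative_works unfolding cov_differentiable_def by blast
    have Xt: "X t \<in> TM t" using X t eventually_nhds_x_imp_x by blast
    show "cov X t \<kappa>' = transition_deriv \<kappa> \<kappa>' (c t) (cov X t \<kappa>)"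
      unfolding cov_apply[where X = X, OF t k(1) E] cov_apply[where X = X, OF t k(2)
        field_change_chart[where X = X, OF t k X E]]
        linear_add[OF linear_transition_deriv[OF k]] christoffel_change[OF k]
        tangent_transition[OF Xt k] tangent_transition[OF vel_tangent[OF t] k] by simp
  qed
qed

text \<open>\<open>tendsto_along\<close> tests every chart around \<open>c t\<close>. The transition
  derivative depends continuously on the point, so convergence in one chart implies convergence in
  the others.\<close>

lemma field_tendsto_change_chart:
  assumes t: "t \<in> I" and k: "\<kappa> \<in> charts t" "\<kappa>' \<in> charts t" and "S \<subseteq> I"
    and X: "\<forall>\<^sub>F s in at t within S. X s \<in> TM s" and w: "w \<in> TM t"
    and lim: "((\<lambda>s. X s \<kappa>) \<longlongrightarrow> w \<kappa>) (at t within S)"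
  shows "((\<lambda>s. X s \<kappa>') \<longlongrightarrow> w \<kappa>') (at t within S)"
proof -
  have A: "\<kappa> \<in> \<A>" "\<kappa>' \<in> \<A>" using k charts_atD(1) by blast+
  let ?D = "\<lambda>y. frechet_derivative (transition \<kappa> \<kappa>') (at y)"
  have O: "xc \<kappa> t \<in> overlap \<kappa> \<kappa>'" by (rule charts_at_overlap[OF k])
  have x: "(xc \<kappa> \<longlongrightarrow> xc \<kappa> t) (at t within S)"
    using xc_continuous[OF t k(1)] \<open>S \<subseteq> I\<close> unfolding continuous_within by (rule tendsto_within_subset)
  have "isCont (\<lambda>y. ?D y i) (xc \<kappa> t)" for i
    by (rule has_derivative_continuous[OF dtrans_has_derivative[OF A O]])
  then have Dlim: "((\<lambda>s. ?D (xc \<kappa> s) i) \<longlongrightarrow> ?D (xc \<kappa> t) i) (at t within S)" for i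
    using x by (rule isCont_tendsto_compose)
  have expand: "?D (xc \<kappa> s) a = (\<Sum>i\<in>Basis. (a \<bullet> i) *\<^sub>R ?D (xc \<kappa> s) i)"
    if k: "\<kappa> \<in> charts s" "\<kappa>' \<in> charts s" for s a
  proof -
    have l: "linear (?D (xc \<kappa> s))" using linear_transition_deriv[OF k] by (simp add: transition_deriv_position)
    have "?D (xc \<kappa> s) (\<Sum>i\<in>Basis. (a \<bullet> i) *\<^sub>R i) = (\<Sum>i\<in>Basis. (a \<bullet> i) *\<^sub>R ?D (xc \<kappa> s) i)"
      by (simp add: linear_sum[OF l] linear_scale[OF l])
    then show ?thesis by (simp add: euclidean_representation)
  qed
  have "((\<lambda>s. \<Sum>i\<in>Basis. (X s \<kappa> \<bullet> i) *\<^sub>R ?D (xc \<kappa> s) i) \<longlongrightarrow> (\<Sum>i\<in>Basis. (w \<kappa> \<bullet> i) *\<^sub>R ?D (xc \<kappa> t) i))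
      (at t within S)"
    by (intro tendsto_intros lim Dlim)
  also have "(\<Sum>i\<in>Basis. (w \<kappa> \<bullet> i) *\<^sub>R ?D (xc \<kappa> t) i) = w \<kappa>'"
    using expand[OF k, of "w \<kappa>"] tangent_transition[OF w k] by (simp add: transition_deriv_position)
  finally have lim2: "((\<lambda>s. \<Sum>i\<in>Basis. (X s \<kappa> \<bullet> i) *\<^sub>R ?D (xc \<kappa> s) i) \<longlongrightarrow> w \<kappa>') (at t within S)" .
  have "\<forall>\<^sub>F s in at t within S. \<kappa> \<in> charts s \<and> \<kappa>' \<in> charts s"
    using charts_near[OF t k(1)] charts_near[OF t k(2)]
    unfolding eventually_at_filter by eventually_elim (use \<open>S \<subseteq> I\<close> in blast)
  then have "\<forall>\<^sub>F s in at t within S. (\<Sum>i\<in>Basis. (X s \<kappa> \<bullet> i) *\<^sub>R ?D (xc \<kappa> s) i) = X s \<kappa>'"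
    using X
  proof eventually_elim
    case (elim s)
    then show ?case
      using expand[of s "X s \<kappa>"] tangent_transition[of "X s" "c s" \<kappa> \<kappa>']
        by (simp add: transition_deriv_position)
  qed
  then show ?thesis using lim2 by (rule Lim_transform_eventually[rotated])
qed

end

section \<open>Limits and bounds for linear and bilinear families\<close>

lemma linear_expand:
  fixes L :: "'e::euclidean_space \<Rightarrow> 'b::real_normed_vector"
  assumes l: "linear L"
  shows "L u = (\<Sum>b\<in>Basis. (u \<bullet> b) *\<^sub>R L b)"
proof -
  have "L (\<Sum>b\<in>Basis. (u \<bullet> b) *\<^sub>R b) = (\<Sum>b\<in>Basis. (u \<bullet> b) *\<^sub>R L b)"
    by (simp add: linear_sum[OF l] linear_scale[OF l])
  then show ?thesis by (simp add: euclidean_representation)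
qed

lemma linear_family_tendsto:
  fixes L :: "'p \<Rightarrow> 'e::euclidean_space \<Rightarrow> 'b::real_normed_vector"
  assumes ev: "\<forall>\<^sub>F s in F. linear (L s)" and L0: "linear L0"
    and L: "\<And>a. ((\<lambda>s. L s a) \<longlongrightarrow> L0 a) F" and V: "(V \<longlongrightarrow> V0) F"
  shows "((\<lambda>s. L s (V s)) \<longlongrightarrow> L0 V0) F"
proof -
  have "((\<lambda>s. \<Sum>b\<in>Basis. (V s \<bullet> b) *\<^sub>R L s b) \<longlongrightarrow> (\<Sum>b\<in>Basis. (V0 \<bullet> b) *\<^sub>R L0 b)) F"
    by (intro tendsto_intros L V)
  then have "((\<lambda>s. \<Sum>b\<in>Basis. (V s \<bullet> b) *\<^sub>R L s b) \<longlongrightarrow> L0 V0) F"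
    by (simp add: linear_expand[OF L0, of V0])
  moreover have "\<forall>\<^sub>F s in F. (\<Sum>b\<in>Basis. (V s \<bullet> b) *\<^sub>R L s b) = L s (V s)"
    using ev by eventually_elim (simp add: linear_expand[symmetric])
  ultimately show ?thesis by (rule Lim_transform_eventually)
qed

lemma bilinear_family_tendsto:
  fixes H :: "'p \<Rightarrow> 'e::euclidean_space \<Rightarrow> 'e \<Rightarrow> 'b::real_normed_vector"
  assumes ev: "\<forall>\<^sub>F s in F. bilinear (H s)" and H0: "bilinear H0"
    and H: "\<And>a b. ((\<lambda>s. H s a b) \<longlongrightarrow> H0 a b) F" and V: "(V \<longlongrightarrow> V0) F" and W: "(W \<longlongrightarrow> W0) F"
  shows "((\<lambda>s. H s (V s) (W s)) \<longlongrightarrow> H0 V0 W0) F"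
proof -
  have "((\<lambda>s. \<Sum>a\<in>Basis. \<Sum>b\<in>Basis. ((V s \<bullet> a) * (W s \<bullet> b)) *\<^sub>R H s a b) \<longlongrightarrow> (\<Sum>a\<in>Basis. \<Sum>b\<in>Basis. ((V0 \<bullet> a)
      * (W0 \<bullet> b)) *\<^sub>R H0 a b)) F"
    by (intro tendsto_intros H V W)
  then have "((\<lambda>s. \<Sum>a\<in>Basis. \<Sum>b\<in>Basis. ((V s \<bullet> a) * (W s \<bullet> b)) *\<^sub>R H s a b) \<longlongrightarrow> H0 V0 W0) F"
    by (simp add: bilinear_expand[OF H0, of V0])
  moreover have "\<forall>\<^sub>F s in F. (\<Sum>a\<in>Basis. \<Sum>b\<in>Basis. ((V s \<bullet> a) * (W s \<bullet> b)) *\<^sub>R H s a b) = H s (V s) (W s)"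
    using ev by eventually_elim (simp add: bilinear_expand[symmetric])
  ultimately show ?thesis by (rule Lim_transform_eventually)
qed

text \<open>Continuity on the finitely many basis vectors bounds the operator norms uniformly near
  \<open>t\<close>. This supplies the growth constants of the Jacobi system.\<close>

lemma linear_family_bounded_near:
  fixes L :: "real \<Rightarrow> 'e::euclidean_space \<Rightarrow> 'b::real_normed_vector"
  assumes t: "t \<in> I" and lin: "\<forall>\<^sub>F s in nhds t. s \<in> I \<longrightarrow> linear (L s)"
    and L: "\<And>a. continuous (at t within I) (\<lambda>s. L s a)"
  obtains C where "C \<ge> 0" "\<forall>\<^sub>F s in nhds t. s \<in> I \<longrightarrow> (\<forall>a. norm (L s a) \<le> C * norm a)"
proof -
  have "\<forall>\<^sub>F s in nhds t. s \<in> I \<longrightarrow> norm (L s i) < norm (L t i) + 1" for i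
  proof -
    have "((\<lambda>s. norm (L s i)) \<longlongrightarrow> norm (L t i)) (at t within I)"
      using L[of i] unfolding continuous_within by (rule tendsto_norm)
    then have "\<forall>\<^sub>F s in at t within I. norm (L s i) < norm (L t i) + 1"
      by (rule order_tendstoD(2)) simp
    then show ?thesis unfolding eventually_at_filter by eventually_elim auto
  qed
  then have "\<forall>\<^sub>F s in nhds t. \<forall>i\<in>Basis. s \<in> I \<longrightarrow> norm (L s i) < norm (L t i) + 1"
    by (intro eventually_ball_finite) auto
  with lin have ev: "\<forall>\<^sub>F s in nhds t. s \<in> I \<longrightarrow> (\<forall>a. norm (L s a) \<le> (\<Sum>i\<in>Basis. norm (L t i) + 1) * norm a)"
  proof eventually_elim
    case (elim s)
    show ?case
    proof (intro impI allI)
      fix a assume s: "s \<in> I"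
      have "norm (L s a) \<le> (\<Sum>i\<in>Basis. norm ((a \<bullet> i) *\<^sub>R L s i))"
        using linear_expand[of "L s" a] elim(1) s norm_sum[of "\<lambda>i. (a \<bullet> i) *\<^sub>R L s i" Basis] by simp
      also have "\<dots> \<le> (\<Sum>i\<in>Basis. norm a * (norm (L t i) + 1))"
        using elim(2) s by (intro sum_mono) (auto simp: less_imp_le intro!: mult_mono Basis_le_norm)
      finally show "norm (L s a) \<le> (\<Sum>i\<in>Basis. norm (L t i) + 1) * norm a"
        by (simp add: sum_distrib_left mult.commute)
    qed
  qed
  show ?thesis by (rule that[OF _ ev]) (auto intro: sum_nonneg)
qed

text \<open>Stated for an indexed family, so that frame vectors, the velocity and a remainder can
  later be counted together by means of a sum type.\<close>

lemma orthogonal_family_card: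
  fixes G :: "'e::euclidean_space \<Rightarrow> 'e \<Rightarrow> real"
  assumes G: "bilinear G" and "finite F"
    and pos: "\<And>i. i \<in> F \<Longrightarrow> G (b i) (b i) > 0" and orth: "\<And>i j. i \<in> F \<Longrightarrow> j \<in> F \<Longrightarrow> i \<noteq> j \<Longrightarrow> G (b i) (b j) = 0"
  shows "inj_on b F" and "independent (b ` F)" and "card F \<le> DIM('e)"
proof -
  show inj: "inj_on b F"
    using pos orth by (intro inj_onI) (metis less_irrefl)
  show ind: "independent (b ` F)"
  proof (rule independent_if_scalars_zero)
    show "finite (b ` F)" using \<open>finite F\<close> by simp
    fix f x assume s: "(\<Sum>x\<in>b ` F. f x *\<^sub>R x) = 0" and "x \<in> b ` F"
    then obtain j where j: "j \<in> F" "x = b j" by blast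
    have l: "linear (\<lambda>u. G u (b j))" using G by (simp add: bilinear_def)
    have "(\<Sum>i\<in>F. f (b i) *\<^sub>R b i) = 0" using s by (simp add: sum.reindex[OF inj])
    then have "G (\<Sum>i\<in>F. f (b i) *\<^sub>R b i) (b j) = 0" by (simp add: linear_0[OF l])
    then have "(\<Sum>i\<in>F. f (b i) * G (b i) (b j)) = 0" by (simp add: linear_sum[OF l] linear_scale[OF l])
    also have "(\<Sum>i\<in>F. f (b i) * G (b i) (b j)) = (\<Sum>i\<in>F. if i = j then f (b j) * G (b j) (b j) else 0)"
      by (rule sum.cong) (use orth j in auto)
    finally show "f x = 0" using j \<open>finite F\<close> pos[of j] by simp
  qed
  have "card F = card (b ` F)" using inj by (simp add: card_image)
  then show "card F \<le> DIM('e)" using independent_bound[OF ind] by simp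
qed

context geodesic_curve
begin

section \<open>Metric and connection along the geodesic\<close>

abbreviation \<Gamma>c :: "('m, 'e) chart \<Rightarrow> real \<Rightarrow> 'e \<Rightarrow> 'e" where
  "\<Gamma>c \<kappa> s a \<equiv> \<Gamma> \<kappa> (xc \<kappa> s) (vel s \<kappa>) a"

abbreviation gc :: "('m, 'e) chart \<Rightarrow> real \<Rightarrow> 'e \<Rightarrow> 'e \<Rightarrow> real" where
  "gc \<kappa> s \<equiv> m \<kappa> (xc \<kappa> s)"

lemma gc_bilinear: "\<kappa> \<in> charts s \<Longrightarrow> bilinear (gc \<kappa> s)"
  by (rule m_bilinear[OF charts_atD(1) xc_cdom])

lemma gc_sym: "\<kappa> \<in> charts s \<Longrightarrow> gc \<kappa> s a b = gc \<kappa> s b a"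
  by (rule m_sym[OF charts_atD(1) xc_cdom])

lemma gc_pos: "\<kappa> \<in> charts s \<Longrightarrow> a \<noteq> 0 \<Longrightarrow> gc \<kappa> s a a > 0"
  by (rule m_pos[OF charts_atD(1) xc_cdom])

lemma metric_eq_gc: "\<kappa> \<in> charts s \<Longrightarrow> u \<in> TM s \<Longrightarrow> v \<in> TM s \<Longrightarrow> g (c s) u v = gc \<kappa> s (u \<kappa>) (v \<kappa>)"
  by (rule metric_eq_m)

lemma \<Gamma>c_linear: "\<kappa> \<in> charts s \<Longrightarrow> linear (\<Gamma>c \<kappa> s)"
  using christoffel_bilinear[OF charts_atD(1) xc_cdom] by (simp add: bilinear_def)

text \<open>The product rule for the metric along the geodesic: \<open>metric_compatible\<close>
  absorbs the derivative of the metric into Christoffel terms. \<open>X\<close> and \<open>Z\<close>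
  are coordinate curves because the frame fields \<open>e b\<close> are given by their components in
  one chart.\<close>

lemma gc_has_derivative:
  assumes t: "t \<in> I" and k: "\<kappa> \<in> charts t"
    and X: "(X has_vector_derivative X1) (at t within I)" and Z: "(Z has_vector_derivative Z1) (at t within I)"
  shows "((\<lambda>s. gc \<kappa> s (X s) (Z s)) has_real_derivative
     gc \<kappa> t (X1 + \<Gamma>c \<kappa> t (X t)) (Z t) + gc \<kappa> t (X t) (Z1 + \<Gamma>c \<kappa> t (Z t))) (at t within I)"
proof -
  have A: "\<kappa> \<in> \<A>" by (rule charts_atD(1)[OF k])
  note x = xc_cdom[OF k]
  note B = m_bilinear[OF A x]
  have "((\<lambda>s. m \<kappa> (xc \<kappa> s) (X s) (Z s)) has_derivative
     (\<lambda>h. dm \<kappa> (xc \<kappa> t) (h *\<^sub>R vel t \<kappa>) (X t) (Z t) + m \<kappa> (xc \<kappa> t) (h *\<^sub>R X1) (Z t) + m \<kappa> (xc \<kappa> t) (X t)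
       (h *\<^sub>R Z1))) (at t within I)"
    by (rule bilinear_family_has_derivative[where X = "xc \<kappa>" and \<alpha> = X
      and \<beta> = Z, OF t open_cdom[OF A] x m_bilinear[OF A] m_has_derivative[OF A x]])
      (use position_has_vd[OF t k] X Z in \<open>simp_all add: has_vector_derivative_def\<close>)
  moreover have "dm \<kappa> (xc \<kappa> t) (h *\<^sub>R vel t \<kappa>) (X t) (Z t) + m \<kappa> (xc \<kappa> t) (h *\<^sub>R X1) (Z t)
      + m \<kappa> (xc \<kappa> t) (X t) (h *\<^sub>R Z1)
     = h *\<^sub>R (gc \<kappa> t (X1 + \<Gamma>c \<kappa> t (X t)) (Z t) + gc \<kappa> t (X t) (Z1 + \<Gamma>c \<kappa> t (Z t)))" for h
    by (simp add: linear_scale[OF dm_linear[OF A x]] bilinear_lmul[OF B] bilinear_rmul[OF B]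
      bilinear_ladd[OF B] bilinear_radd[OF B]
      metric_compatible[OF A x] bilinear_lmul[OF christoffel_bilinear[OF A x]] algebra_simps)
  ultimately show ?thesis
    by (simp add: has_real_derivative_iff_has_vector_derivative has_vector_derivative_def)
qed

text \<open>The shape of the derivative is what counts: where \<open>X t = 0\<close>, linearity
  removes \<open>D\<close> and only \<open>\<Gamma>c \<kappa> t X1\<close> remains. This is used at
  zeros of Jacobi fields.\<close>

lemma \<Gamma>c_has_vd:
  assumes t: "t \<in> I" and k: "\<kappa> \<in> charts t" and X: "(X has_vector_derivative X1) (at t within I)"
  obtains D where "linear D" "((\<lambda>s. \<Gamma>c \<kappa> s (X s)) has_vector_derivative D (X t) + \<Gamma>c \<kappa> t X1) (at t within I)"
proof -
  have A: "\<kappa> \<in> \<A>" by (rule charts_atD(1)[OF k])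
  note x = xc_cdom[OF k]
  define V where "V = vector_derivative (\<lambda>s. vel s \<kappa>) (at t within I)"
  have V: "((\<lambda>s. vel s \<kappa>) has_vector_derivative V) (at t within I)"
    unfolding V_def by (rule smooth_on_has_vd(1)[OF vel_smooth[OF A] A t charts_atD(2)[OF k]])
  define D where "D a = d\<Gamma> \<kappa> (xc \<kappa> t) (vel t \<kappa>) (vel t \<kappa>) a + \<Gamma> \<kappa> (xc \<kappa> t) V a" for a
  have lD: "linear D"
    unfolding D_def using d\<Gamma>_bilinear[OF A x] christoffel_bilinear[OF A x]
    by (intro linear_compose_add) (auto simp: bilinear_def)
  have "((\<lambda>s. \<Gamma> \<kappa> (xc \<kappa> s) (vel s \<kappa>) (X s)) has_derivative
     (\<lambda>h. d\<Gamma> \<kappa> (xc \<kappa> t) (h *\<^sub>R vel t \<kappa>) (vel t \<kappa>) (X t) + \<Gamma> \<kappa> (xc \<kappa> t) (h *\<^sub>R V) (X t) + \<Gamma> \<kappa> (xc \<kappa> t)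
       (vel t \<kappa>) (h *\<^sub>R X1))) (at t within I)"
    by (rule bilinear_family_has_derivative[where X = "xc \<kappa>" and \<alpha> = "\<lambda>s. vel s \<kappa>"
      and \<beta> = X, OF t open_cdom[OF A] x christoffel_bilinear[OF A] christoffel_has_derivative[OF A x]])
      (use position_has_vd[OF t k] V X in \<open>simp_all add: has_vector_derivative_def\<close>)
  moreover have "d\<Gamma> \<kappa> (xc \<kappa> t) (h *\<^sub>R vel t \<kappa>) (vel t \<kappa>) (X t) + \<Gamma> \<kappa> (xc \<kappa> t) (h *\<^sub>R V) (X t)
      + \<Gamma> \<kappa> (xc \<kappa> t) (vel t \<kappa>) (h *\<^sub>R X1)
     = h *\<^sub>R (D (X t) + \<Gamma>c \<kappa> t X1)" for h
    by (simp add: D_def linear_scale[OF d\<Gamma>_linear[OF A x]] bilinear_lmul[OF christoffel_bilinear[OF A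
      x]] bilinear_rmul[OF christoffel_bilinear[OF A x]] scaleR_right_distrib)
  ultimately have "((\<lambda>s. \<Gamma>c \<kappa> s (X s)) has_vector_derivative D (X t) + \<Gamma>c \<kappa> t X1) (at t within I)"
    by (simp add: has_vector_derivative_def)
  with lD show ?thesis by (rule that)
qed

lemma \<Gamma>c_continuous:
  assumes "t \<in> I" "\<kappa> \<in> charts t"
  shows "continuous (at t within I) (\<lambda>s. \<Gamma>c \<kappa> s a)"
proof -
  obtain D where "((\<lambda>s. \<Gamma>c \<kappa> s a) has_vector_derivative D) (at t within I)"
    using \<Gamma>c_has_vd[OF assms has_vector_derivative_const] by metis
  then show ?thesis by (rule has_vector_derivative_continuous)
qed

lemma charts_near_within:
  assumes "t \<in> I" "\<kappa> \<in> charts t"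
  shows "\<forall>\<^sub>F s in at t within I. \<kappa> \<in> charts s"
  using charts_near[OF assms] unfolding eventually_at_filter by eventually_elim blast

lemma vel_tendsto:
  assumes "t \<in> I" "\<kappa> \<in> charts t"
  shows "((\<lambda>s. vel s \<kappa>) \<longlongrightarrow> vel t \<kappa>) (at t within I)"
  using has_vector_derivative_continuous[OF smooth_on_has_vd(1)[OF vel_smooth[OF charts_atD(1)[OF
    assms(2)]] charts_atD(1)[OF assms(2)] assms(1) charts_atD(2)[OF assms(2)]]]
  by (simp add: continuous_within)

lemma gc_C1:
  assumes t: "t \<in> I" and k: "\<kappa> \<in> charts t"
  shows "C1_at I t (\<lambda>s. gc \<kappa> s a b)"
proof (rule C1_atI)
  have A: "\<kappa> \<in> \<A>" by (rule charts_atD(1)[OF k])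
  show "\<forall>\<^sub>F s in nhds t. s \<in> I \<longrightarrow> ((\<lambda>s. gc \<kappa> s a b) has_vector_derivative dm \<kappa> (xc \<kappa> s) (vel s \<kappa>) a b)
      (at s within I)"
    using charts_near[OF t k]
  proof eventually_elim
    case (elim s)
    show ?case
    proof
      assume s: "s \<in> I"
      then have k: "\<kappa> \<in> charts s" using elim by blast
      have "((\<lambda>s. m \<kappa> (xc \<kappa> s) a b) has_derivative (\<lambda>h. dm \<kappa> (xc \<kappa> s) (h *\<^sub>R vel s \<kappa>) a b)) (at s within I)"
        using position_has_vd[OF s k] unfolding has_vector_derivative_def
        by (rule has_derivative_compose) (rule m_has_derivative[OF A xc_cdom[OF k]])
      then show "((\<lambda>s. gc \<kappa> s a b) has_vector_derivative dm \<kappa> (xc \<kappa> s) (vel s \<kappa>) a b) (at s within I)"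
        by (simp add: has_vector_derivative_def linear_scale[OF dm_linear[OF A xc_cdom[OF k]]])
    qed
  qed
  show "continuous (at t within I) (\<lambda>s. dm \<kappa> (xc \<kappa> s) (vel s \<kappa>) a b)"
    unfolding continuous_within
  proof (rule linear_family_tendsto[where L = "\<lambda>s v. dm \<kappa> (xc \<kappa> s) v a b" and ?L0.0 = "\<lambda>v. dm \<kappa> (xc \<kappa> t) v a b"
        and V = "\<lambda>s. vel s \<kappa>" and ?V0.0 = "vel t \<kappa>"])
    show "\<forall>\<^sub>F s in at t within I. linear (\<lambda>v. dm \<kappa> (xc \<kappa> s) v a b)"
      using charts_near_within[OF t k] by eventually_elim (rule dm_linear[OF A xc_cdom])
    show "linear (\<lambda>v. dm \<kappa> (xc \<kappa> t) v a b)" by (rule dm_linear[OF A xc_cdom[OF k]])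
    have "isCont (\<lambda>x. dm \<kappa> x v a b) (xc \<kappa> t)" for v
      using smooth_on_tendsto[OF dm_smooth[OF A] open_cdom[OF A] xc_cdom[OF k]] by (simp add: isCont_def)
    then show "((\<lambda>s. dm \<kappa> (xc \<kappa> s) v a b) \<longlongrightarrow> dm \<kappa> (xc \<kappa> t) v a b) (at t within I)" for v
      using xc_continuous[OF t k, unfolded continuous_within] by (rule isCont_tendsto_compose)
    show "((\<lambda>s. vel s \<kappa>) \<longlongrightarrow> vel t \<kappa>) (at t within I)" by (rule vel_tendsto[OF t k])
  qed
qed

text \<open>The speed of a geodesic is constant, so one zero of the velocity makes it vanish
  identically. Then \<open>c\<close> is constant on small segments in a chart, hence on the
  connected interval. The velocity later supplies the direction missing from the values of
  \<open>\<Lambda>\<close>.\<close>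

lemma vel_nonzero:
  assumes t: "t \<in> I"
  shows "vel t \<noteq> 0"
proof
  assume v0: "vel t = 0"
  define f where "f s = g (c s) (vel s) (vel s)" for s
  have "(f has_field_derivative 0) (at s within I)" if s: "s \<in> I" for s
  proof -
    obtain \<kappa> where k: "\<kappa> \<in> charts s" using chart_exists[OF s] .
    define V where "V = vector_derivative (\<lambda>s. vel s \<kappa>) (at s within I)"
    have V: "((\<lambda>s. vel s \<kappa>) has_vector_derivative V) (at s within I)"
      unfolding V_def by (rule smooth_on_has_vd(1)[OF vel_smooth charts_atD(1)[OF k] s charts_atD(2)[OF
        k]]) (rule charts_atD(1)[OF k])
    have "cov vel s = 0" using geod s by (simp add: geodesic_def)
    then have z: "V + \<Gamma>c \<kappa> s (vel s \<kappa>) = 0" using cov_apply[where X = vel, OF s k V] by simp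
    have "((\<lambda>s. gc \<kappa> s (vel s \<kappa>) (vel s \<kappa>)) has_vector_derivative 0) (at s within I)"
      using gc_has_derivative[OF s k V V] unfolding z
      by (simp add: bilinear_lzero[OF gc_bilinear[OF k]] bilinear_rzero[OF gc_bilinear[OF k]]
        has_real_derivative_iff_has_vector_derivative)
    moreover have "\<forall>\<^sub>F r in nhds s. r \<in> I \<longrightarrow> gc \<kappa> r (vel r \<kappa>) (vel r \<kappa>) = f r"
      using charts_near[OF s k]
    proof eventually_elim
      case (elim r)
      then show ?case using metric_eq_gc[of \<kappa> r "vel r" "vel r"] vel_tangent[of r] by (simp add: f_def)
    qed
    ultimately have "(f has_vector_derivative 0) (at s within I)"
      using has_vector_derivative_within_cong_ev[where f = "\<lambda>r. gc \<kappa> r (vel r \<kappa>) (vel r \<kappa>)"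
        and g = f, OF _ s] by simp
    then show ?thesis by (simp add: has_real_derivative_iff_has_vector_derivative)
  qed
  then obtain C where C: "\<And>s. s \<in> I \<Longrightarrow> f s = C"
    using has_field_derivative_zero_constant[of I f] interval by (auto simp: is_interval_convex_1)
  have ft: "f t = 0"
  proof -
    have "g (c t) (0 *\<^sub>R vel t) (vel t) = 0 * g (c t) (vel t) (vel t)"
      by (rule metric_scale[OF curve_points[OF t] vel_tangent[OF t] vel_tangent[OF t]])
    then show ?thesis using v0 by (simp add: f_def)
  qed
  have V0: "vel s = 0" if s: "s \<in> I" for s
    using metric_pos[OF curve_points[OF s] vel_tangent[OF s]] C[OF s] C[OF t] ft by (auto simp: f_def)
  have "c constant_on I"
    unfolding constant_on_def
  proof (intro exI[of _ "c t"] ballI)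
    fix u assume u: "u \<in> I"
    show "c u = c t"
    proof (rule connected_local_const[OF _ u t])
      show "connected I" using interval by (simp add: is_interval_connected)
      show "\<forall>a\<in>I. \<forall>\<^sub>F b in at a within I. c a = c b"
      proof
        fix a assume a: "a \<in> I"
        obtain \<kappa> where k: "\<kappa> \<in> charts a" using chart_exists[OF a] .
        have A: "\<kappa> \<in> \<A>" by (rule charts_atD(1)[OF k])
        have "\<forall>\<^sub>F s in nhds a. s \<in> I \<longrightarrow> closed_segment a s \<subseteq> I \<and> (\<forall>r\<in>closed_segment a s. \<kappa> \<in> charts r)"
          by (rule eventually_within_segment[OF interval a charts_near[OF a k]])
        then have "\<forall>\<^sub>F s in nhds a. s \<in> I \<longrightarrow> c a = c s"
        proof eventually_elim
          case (elim s)
          show ?case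
          proof
            assume s: "s \<in> I"
            have "(xc \<kappa> has_derivative (\<lambda>h. 0)) (at r within closed_segment a s)"
              if r: "r \<in> closed_segment a s" for r
            proof -
              have ri: "r \<in> I" "\<kappa> \<in> charts r" using elim s r by auto
              have "(xc \<kappa> has_vector_derivative 0) (at r within I)"
                using position_has_vd[OF ri] V0[OF ri(1)] by simp
              then show ?thesis
                using has_vector_derivative_within_subset[of "xc \<kappa>" 0 r I "closed_segment a s"] elim s
                  by (simp add: has_vector_derivative_def)
            qed
            then obtain C' where "\<And>r. r \<in> closed_segment a s \<Longrightarrow> xc \<kappa> r = C'"
              using has_derivative_zero_constant[of "closed_segment a s" "xc \<kappa>"] by auto
            then have "xc \<kappa> a = xc \<kappa> s" by simp
            moreover have "\<kappa> \<in> charts s" using elim s by auto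
            ultimately show "c a = c s"
              using chart_inv_coord[OF A charts_atD(2)[OF k]] chart_inv_coord[OF A, of "c s"]
                charts_atD(2) by metis
          qed
        qed
        then show "\<forall>\<^sub>F b in at a within I. c a = c b"
          unfolding eventually_at_filter by eventually_elim blast
      qed
    qed
  qed
  then show False using nonconst by simp
qed

end

section \<open>Jacobi fields\<close>

context geodesic_curve
begin

section \<open>Continuity of the curvature along the geodesic\<close>

lemma christoffel_family_tendsto:
  assumes t: "t \<in> I" and k: "\<kappa> \<in> charts t"
    and V: "(V \<longlongrightarrow> V0) (at t within I)" and W: "(W \<longlongrightarrow> W0) (at t within I)"
  shows "((\<lambda>s. \<Gamma> \<kappa> (xc \<kappa> s) (V s) (W s)) \<longlongrightarrow> \<Gamma> \<kappa> (xc \<kappa> t) V0 W0) (at t within I)"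
proof (rule bilinear_family_tendsto[where H = "\<lambda>s. \<Gamma> \<kappa> (xc \<kappa> s)" and ?H0.0 = "\<Gamma> \<kappa> (xc \<kappa> t)", OF _ _ _ V W])
  have A: "\<kappa> \<in> \<A>" by (rule charts_atD(1)[OF k])
  show "\<forall>\<^sub>F s in at t within I. bilinear (\<Gamma> \<kappa> (xc \<kappa> s))"
    using charts_near_within[OF t k] by eventually_elim (rule christoffel_bilinear[OF A xc_cdom])
  show "bilinear (\<Gamma> \<kappa> (xc \<kappa> t))" by (rule christoffel_bilinear[OF A xc_cdom[OF k]])
  have "isCont (\<lambda>x. \<Gamma> \<kappa> x a b) (xc \<kappa> t)" for a b
    using christoffel_tendsto[OF A xc_cdom[OF k]] by (simp add: isCont_def)
  then show "((\<lambda>s. \<Gamma> \<kappa> (xc \<kappa> s) a b) \<longlongrightarrow> \<Gamma> \<kappa> (xc \<kappa> t) a b) (at t within I)" for a b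
    using xc_continuous[OF t k, unfolded continuous_within] by (rule isCont_tendsto_compose)
qed

lemma d\<Gamma>_family_tendsto:
  assumes t: "t \<in> I" and k: "\<kappa> \<in> charts t" and U: "(U \<longlongrightarrow> U0) (at t within I)"
    and V: "(V \<longlongrightarrow> V0) (at t within I)" and W: "(W \<longlongrightarrow> W0) (at t within I)"
  shows "((\<lambda>s. d\<Gamma> \<kappa> (xc \<kappa> s) (U s) (V s) (W s)) \<longlongrightarrow> d\<Gamma> \<kappa> (xc \<kappa> t) U0 V0 W0) (at t within I)"
proof (rule linear_family_tendsto[where L = "\<lambda>s u. d\<Gamma> \<kappa> (xc \<kappa> s) u (V s) (W s)"
  and ?L0.0 = "\<lambda>u. d\<Gamma> \<kappa> (xc \<kappa> t) u V0 W0", OF _ _ _ U])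
  have A: "\<kappa> \<in> \<A>" by (rule charts_atD(1)[OF k])
  show "\<forall>\<^sub>F s in at t within I. linear (\<lambda>u. d\<Gamma> \<kappa> (xc \<kappa> s) u (V s) (W s))"
    using charts_near_within[OF t k] by eventually_elim (rule d\<Gamma>_linear[OF A xc_cdom])
  show "linear (\<lambda>u. d\<Gamma> \<kappa> (xc \<kappa> t) u V0 W0)" by (rule d\<Gamma>_linear[OF A xc_cdom[OF k]])
  fix u
  show "((\<lambda>s. d\<Gamma> \<kappa> (xc \<kappa> s) u (V s) (W s)) \<longlongrightarrow> d\<Gamma> \<kappa> (xc \<kappa> t) u V0 W0) (at t within I)"
  proof (rule bilinear_family_tendsto[where H = "\<lambda>s. d\<Gamma> \<kappa> (xc \<kappa> s) u"
    and ?H0.0 = "d\<Gamma> \<kappa> (xc \<kappa> t) u", OF _ _ _ V W])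
    show "\<forall>\<^sub>F s in at t within I. bilinear (d\<Gamma> \<kappa> (xc \<kappa> s) u)"
      using charts_near_within[OF t k] by eventually_elim (rule d\<Gamma>_bilinear[OF A xc_cdom])
    show "bilinear (d\<Gamma> \<kappa> (xc \<kappa> t) u)" by (rule d\<Gamma>_bilinear[OF A xc_cdom[OF k]])
    show "((\<lambda>s. d\<Gamma> \<kappa> (xc \<kappa> s) u a b) \<longlongrightarrow> d\<Gamma> \<kappa> (xc \<kappa> t) u a b) (at t within I)" for a b
      using d\<Gamma>_isCont[OF A xc_cdom[OF k]] xc_continuous[OF t k, unfolded continuous_within]
        by (rule isCont_tendsto_compose)
  qed
qed

definition Rc :: "('m, 'e) chart \<Rightarrow> real \<Rightarrow> 'e \<Rightarrow> 'e" where
  "Rc \<kappa> s a = curvature_in_chart \<A> g \<kappa> (xc \<kappa> s) a (vel s \<kappa>) (vel s \<kappa>)"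

lemma Rc_eq: "Rc \<kappa> s a = d\<Gamma> \<kappa> (xc \<kappa> s) a (vel s \<kappa>) (vel s \<kappa>) - d\<Gamma> \<kappa> (xc \<kappa> s) (vel s \<kappa>) a (vel s \<kappa>)
    + \<Gamma> \<kappa> (xc \<kappa> s) a (\<Gamma> \<kappa> (xc \<kappa> s) (vel s \<kappa>) (vel s \<kappa>)) - \<Gamma> \<kappa> (xc \<kappa> s) (vel s \<kappa>) (\<Gamma> \<kappa> (xc \<kappa> s) a (vel s \<kappa>))"
  by (simp add: Rc_def curvature_in_chart_def d\<Gamma>_def)

lemma Rc_linear:
  assumes k: "\<kappa> \<in> charts s"
  shows "linear (Rc \<kappa> s)"
proof -
  have A: "\<kappa> \<in> \<A>" by (rule charts_atD(1)[OF k])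
  note x = xc_cdom[OF k]
  note D = d\<Gamma>_bilinear[OF A x] and L = d\<Gamma>_linear[OF A x] and B = christoffel_bilinear[OF A x]
  show ?thesis
    unfolding Rc_eq[abs_def]
    by (intro linearI) (simp_all add: linear_add[OF L] linear_scale[OF L] bilinear_ladd[OF D]
      bilinear_lmul[OF D]
      bilinear_ladd[OF B] bilinear_lmul[OF B] bilinear_radd[OF B] bilinear_rmul[OF B] algebra_simps)
qed

lemma Rc_continuous:
  assumes t: "t \<in> I" and k: "\<kappa> \<in> charts t"
  shows "continuous (at t within I) (\<lambda>s. Rc \<kappa> s a)"
  unfolding continuous_within Rc_eq
  by (intro tendsto_add tendsto_diff d\<Gamma>_family_tendsto[OF t k] christoffel_family_tendsto[OF t k]
    vel_tendsto[OF t k] tendsto_const)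

lemma curvature_apply: "\<kappa> \<in> charts s \<Longrightarrow> curvature \<A> g (c s) u (vel s) (vel s) \<kappa> = Rc \<kappa> s (u \<kappa>)"
  by (simp add: curvature_def Rc_def)

section \<open>The Jacobi equation as a first-order system\<close>

lemma jacobi_tangent: "jacobi_field \<A> g I c J \<Longrightarrow> t \<in> I \<Longrightarrow> J t \<in> TM t"
  by (simp add: jacobi_field_def smooth_field_along_def)

lemma jacobi_outside: "jacobi_field \<A> g I c J \<Longrightarrow> t \<notin> I \<Longrightarrow> J t = 0"
  by (simp add: jacobi_field_def smooth_field_along_def)

lemma jacobi_smooth: "jacobi_field \<A> g I c J \<Longrightarrow> \<kappa> \<in> \<A> \<Longrightarrow> smooth_on {s\<in>I. c s \<in> chart_dom \<kappa>} (\<lambda>s. J s \<kappa>)"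
  unfolding jacobi_field_def smooth_field_along_def by blast

lemma jacobi_equation:
  "jacobi_field \<A> g I c J \<Longrightarrow> t \<in> I \<Longrightarrow> cov (cov J) t + curvature \<A> g (c t) (J t) (vel t) (vel t) = 0"
  by (simp add: jacobi_field_def)

lemma jacobi_has_vd:
  assumes J: "jacobi_field \<A> g I c J" and t: "t \<in> I" and k: "\<kappa> \<in> charts t"
  shows "((\<lambda>s. J s \<kappa>) has_vector_derivative cov J t \<kappa> - \<Gamma>c \<kappa> t (J t \<kappa>)) (at t within I)"
    and "cov J t \<in> TM t"
proof -
  have A: "\<kappa> \<in> \<A>" by (rule charts_atD(1)[OF k])
  have D: "((\<lambda>s. J s \<kappa>) has_vector_derivative vector_derivative (\<lambda>s. J s \<kappa>) (at t within I)) (at t within I)"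
    by (rule smooth_on_has_vd(1)[OF jacobi_smooth[OF J A] A t charts_atD(2)[OF k]])
  show "((\<lambda>s. J s \<kappa>) has_vector_derivative cov J t \<kappa> - \<Gamma>c \<kappa> t (J t \<kappa>)) (at t within I)"
    using D cov_apply[where X = J, OF t k D] by simp
  show "cov J t \<in> TM t"
    by (rule cov_differentiableI(2)[OF t k]) (use jacobi_tangent[OF J] D differentiableI_vector in \<open>auto
      intro: always_eventually\<close>)
qed

lemma jacobi_cov_has_vd:
  assumes J: "jacobi_field \<A> g I c J" and t: "t \<in> I" and k: "\<kappa> \<in> charts t"
  shows "((\<lambda>s. cov J s \<kappa>) has_vector_derivative cov (cov J) t \<kappa> - \<Gamma>c \<kappa> t (cov J t \<kappa>)) (at t within I)"
    and "cov (cov J) t \<in> TM t"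
proof -
  have A: "\<kappa> \<in> \<A>" by (rule charts_atD(1)[OF k])
  let ?f = "\<lambda>s. vector_derivative (\<lambda>s. J s \<kappa>) (at s within I)"
  have f: "(?f has_vector_derivative vector_derivative ?f (at t within I)) (at t within I)"
    by (rule smooth_on_has_vd(1)[OF smooth_on_has_vd(2)[OF jacobi_smooth[OF J A] A] A t charts_atD(2)[OF k]])
  obtain D0 where "((\<lambda>s. \<Gamma>c \<kappa> s (J s \<kappa>)) has_vector_derivative D0 (J t \<kappa>) + \<Gamma>c \<kappa> t (cov J t \<kappa>
      - \<Gamma>c \<kappa> t (J t \<kappa>))) (at t within I)"
    by (rule \<Gamma>c_has_vd[where X = "\<lambda>s. J s \<kappa>", OF t k jacobi_has_vd(1)[OF J t k]])
  then obtain D where D: "((\<lambda>s. \<Gamma>c \<kappa> s (J s \<kappa>)) has_vector_derivative D) (at t within I)" by blast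
  have "((\<lambda>s. ?f s + \<Gamma>c \<kappa> s (J s \<kappa>)) has_vector_derivative (vector_derivative ?f (at t within I) + D))
      (at t within I)"
    by (rule has_vector_derivative_add[OF f D])
  moreover have "\<forall>\<^sub>F s in nhds t. s \<in> I \<longrightarrow> ?f s + \<Gamma>c \<kappa> s (J s \<kappa>) = cov J s \<kappa>"
    using charts_near[OF t k] by eventually_elim (simp add: cov_deriv_def)
  ultimately have D': "((\<lambda>s. cov J s \<kappa>) has_vector_derivative (vector_derivative ?f
      (at t within I) + D)) (at t within I)"
    using has_vector_derivative_within_cong_ev[where f = "\<lambda>s. ?f s + \<Gamma>c \<kappa> s (J s \<kappa>)"
      and g = "\<lambda>s. cov J s \<kappa>", OF _ t] by simp
  then show "((\<lambda>s. cov J s \<kappa>) has_vector_derivative cov (cov J) t \<kappa> - \<Gamma>c \<kappa> t (cov J t \<kappa>)) (at t within I)"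
    using cov_apply[where X = "cov J", OF t k D'] by simp
  have tm: "cov J s \<in> TM s" if "s \<in> I" for s
  proof -
    obtain \<kappa>' where "\<kappa>' \<in> charts s" using chart_exists[OF \<open>s \<in> I\<close>] .
    then show ?thesis by (rule jacobi_has_vd(2)[OF J \<open>s \<in> I\<close>])
  qed
  show "cov (cov J) t \<in> TM t"
    by (rule cov_differentiableI(2)[OF t k]) (use tm D' differentiableI_vector in \<open>auto intro:
      always_eventually\<close>)
qed

lemma cov_jacobi_tangent:
  assumes "jacobi_field \<A> g I c J" "t \<in> I"
  shows "cov J t \<in> TM t"
proof -
  obtain \<kappa> where "\<kappa> \<in> charts t" using chart_exists[OF assms(2)] .
  then show ?thesis by (rule jacobi_has_vd(2)[OF assms])
qed

lemma jacobi_second: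
  assumes J: "jacobi_field \<A> g I c J" and t: "t \<in> I" and k: "\<kappa> \<in> charts t"
  shows "cov (cov J) t \<kappa> = - Rc \<kappa> t (J t \<kappa>)"
  using fun_cong[OF jacobi_equation[OF J t], of \<kappa>] curvature_apply[OF k, of "J t"]
  by (simp add: add_eq_0_iff)

text \<open>With \<open>cov J\<close> in place of the coordinate derivative, the Jacobi equation
  becomes a first-order linear system for the pair of \<open>J\<close> and \<open>cov J\<close> in a
  chart, and its coefficients \<open>\<Gamma>c\<close> and \<open>Rc\<close> are bounded near
  \<open>t\<close>.\<close>

lemma jacobi_vanishes_near:
  assumes J: "jacobi_field \<A> g I c J" and t: "t \<in> I" and J0: "J t = 0" and J1: "cov J t = 0"
  shows "\<forall>\<^sub>F s in nhds t. s \<in> I \<longrightarrow> J s = 0 \<and> cov J s = 0"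
proof -
  obtain \<kappa> where k: "\<kappa> \<in> charts t" using chart_exists[OF t] .
  obtain C1 where C1: "C1 \<ge> 0" "\<forall>\<^sub>F s in nhds t. s \<in> I \<longrightarrow> (\<forall>a. norm (\<Gamma>c \<kappa> s a) \<le> C1 * norm a)"
  proof (rule linear_family_bounded_near[where L = "\<Gamma>c \<kappa>", OF t])
    show "\<forall>\<^sub>F s in nhds t. s \<in> I \<longrightarrow> linear (\<Gamma>c \<kappa> s)"
      using charts_near[OF t k] by eventually_elim (blast intro: \<Gamma>c_linear)
  qed (rule \<Gamma>c_continuous[OF t k])
  obtain C2 where C2: "C2 \<ge> 0" "\<forall>\<^sub>F s in nhds t. s \<in> I \<longrightarrow> (\<forall>a. norm (Rc \<kappa> s a) \<le> C2 * norm a)"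
  proof (rule linear_family_bounded_near[where L = "Rc \<kappa>", OF t])
    show "\<forall>\<^sub>F s in nhds t. s \<in> I \<longrightarrow> linear (Rc \<kappa> s)"
      using charts_near[OF t k] by eventually_elim (blast intro: Rc_linear)
  qed (rule Rc_continuous[OF t k])
  define z where "z s = (J s \<kappa>, cov J s \<kappa>)" for s
  define z' where "z' s = (cov J s \<kappa> - \<Gamma>c \<kappa> s (J s \<kappa>), cov (cov J) s \<kappa> - \<Gamma>c \<kappa> s (cov J s \<kappa>))" for s
  \<comment> \<open>The four summands of the constant stem from \<open>cov J\<close>, the
    Christoffel term of \<open>J\<close>, the curvature term and the Christoffel term of
    \<open>cov J\<close>.\<close>
  have "\<forall>\<^sub>F s in nhds t. s \<in> I \<longrightarrow> (z has_vector_derivative z' s) (at s within I) \<and> norm (z' s) \<le> (1 + C1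
      + C2 + C1) * norm (z s)"
    using charts_near[OF t k] C1(2) C2(2)
  proof eventually_elim
    case (elim s)
    show ?case
    proof (intro impI conjI)
      assume s: "s \<in> I"
      then have k: "\<kappa> \<in> charts s" using elim by blast
      show "(z has_vector_derivative z' s) (at s within I)"
        unfolding z_def z'_def by (rule has_vector_derivative_Pair[OF jacobi_has_vd(1)[OF J s k]
          jacobi_cov_has_vd(1)[OF J s k]])
      have n: "norm (J s \<kappa>) \<le> norm (z s)" "norm (cov J s \<kappa>) \<le> norm (z s)"
        unfolding z_def by (simp_all add: norm_fst_le norm_snd_le)
      have b: "C1 * norm (J s \<kappa>) \<le> C1 * norm (z s)" "C1 * norm (cov J s \<kappa>)
          \<le> C1 * norm (z s)" "C2 * norm (J s \<kappa>) \<le> C2 * norm (z s)"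
        using n C1(1) C2(1) by (auto intro: mult_left_mono)
      have e: "norm (\<Gamma>c \<kappa> s (J s \<kappa>)) \<le> C1 * norm (J s \<kappa>)" "norm (\<Gamma>c \<kappa> s (cov J s \<kappa>)) \<le> C1 * norm (cov J s \<kappa>)"
        "norm (Rc \<kappa> s (J s \<kappa>)) \<le> C2 * norm (J s \<kappa>)"
        using elim s by auto
      have "norm (z' s) \<le> norm (cov J s \<kappa> - \<Gamma>c \<kappa> s (J s \<kappa>)) + norm (cov (cov J) s \<kappa> - \<Gamma>c \<kappa> s (cov J s \<kappa>))"
        unfolding z'_def by (rule norm_Pair_le)
      also have "\<dots> \<le> (norm (cov J s \<kappa>) + norm (\<Gamma>c \<kappa> s (J s \<kappa>))) + (norm (Rc \<kappa> s (J s \<kappa>))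
          + norm (\<Gamma>c \<kappa> s (cov J s \<kappa>)))"
        unfolding jacobi_second[OF J s k]
        by (intro add_mono order_trans[OF norm_triangle_ineq4]) simp_all
      also have "\<dots> \<le> (1 + C1 + C2 + C1) * norm (z s)"
        using n b e by (simp add: algebra_simps)
      finally show "norm (z' s) \<le> (1 + C1 + C2 + C1) * norm (z s)" .
    qed
  qed
  moreover have "z t = 0" using J0 J1 by (simp add: z_def zero_prod_def)
  ultimately have "\<forall>\<^sub>F s in nhds t. s \<in> I \<longrightarrow> z s = 0"
    by (rule linear_growth_vanishes_near[OF interval t])
  with charts_near[OF t k] show ?thesis
  proof eventually_elim
    case (elim s)
    show ?case
    proof
      assume s: "s \<in> I"
      have k: "\<kappa> \<in> charts s" and z: "J s \<kappa> = 0" "cov J s \<kappa> = 0" using elim s by (auto simp: z_def zero_prod_def)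
      show "J s = 0 \<and> cov J s = 0"
        using tangent_eqI[OF jacobi_tangent[OF J s] tangent_zero k] tangent_eqI[OF cov_jacobi_tangent[OF
          J s] tangent_zero k] z by simp
    qed
  qed
qed

lemma jacobi_nonvanishing_near:
  assumes J: "jacobi_field \<A> g I c J" and t: "t \<in> I" and nz: "\<not> (J t = 0 \<and> cov J t = 0)"
  shows "\<forall>\<^sub>F s in nhds t. s \<in> I \<longrightarrow> \<not> (J s = 0 \<and> cov J s = 0)"
proof -
  obtain \<kappa> where k: "\<kappa> \<in> charts t" using chart_exists[OF t] .
  define z where "z s = (J s \<kappa>, cov J s \<kappa>)" for s
  have "(z has_vector_derivative (cov J t \<kappa> - \<Gamma>c \<kappa> t (J t \<kappa>), cov (cov J) t \<kappa> - \<Gamma>c \<kappa> t (cov J t \<kappa>)))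
      (at t within I)"
    unfolding z_def by (rule has_vector_derivative_Pair[OF jacobi_has_vd(1)[OF J t k]
      jacobi_cov_has_vd(1)[OF J t k]])
  from has_vector_derivative_continuous[OF this] have "(z \<longlongrightarrow> z t) (at t within I)"
    by (simp add: continuous_within)
  moreover have "z t \<noteq> 0"
  proof
    assume "z t = 0"
    then have "J t \<kappa> = 0" "cov J t \<kappa> = 0" by (auto simp: z_def zero_prod_def)
    then show False
      using tangent_eqI[OF jacobi_tangent[OF J t] tangent_zero k] tangent_eqI[OF cov_jacobi_tangent[OF J
        t] tangent_zero k] nz by simp
  qed
  ultimately have "\<forall>\<^sub>F s in at t within I. z s \<noteq> 0" by (rule tendsto_imp_eventually_ne)
  then show ?thesis
    unfolding eventually_at_filter
    by eventually_elim (use nz in \<open>auto simp: z_def zero_prod_def\<close>)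
qed

text \<open>The set where \<open>J\<close> and \<open>cov J\<close> both vanish is relatively open
  in \<open>I\<close> by the estimate for the linear system and relatively closed by continuity, so
  it is the whole connected interval. Outside \<open>I\<close> the convention for fields gives
  equality.\<close>

theorem jacobi_unique:
  assumes J: "jacobi_field \<A> g I c J" and t: "t \<in> I" and J0: "J t = 0" and J1: "cov J t = 0"
  shows "J = 0"
proof
  fix u
  define P where "P s \<longleftrightarrow> J s = 0 \<and> cov J s = 0" for s
  show "J u = 0 u"
  proof (cases "u \<in> I")
    case u: True
    have "P u = P t"
    proof (rule connected_local_const[OF _ u t])
      show "connected I" using interval by (simp add: is_interval_connected)
      show "\<forall>a\<in>I. \<forall>\<^sub>F b in at a within I. P a = P b"
      proof
        fix a assume a: "a \<in> I"
        have "\<forall>\<^sub>F b in nhds a. b \<in> I \<longrightarrow> P a = P b"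
        proof (cases "P a")
          case True
          then have "\<forall>\<^sub>F b in nhds a. b \<in> I \<longrightarrow> J b = 0 \<and> cov J b = 0"
            using jacobi_vanishes_near[OF J a] by (simp add: P_def)
          then show ?thesis using True by (simp add: P_def)
        next
          case False
          then have "\<forall>\<^sub>F b in nhds a. b \<in> I \<longrightarrow> \<not> (J b = 0 \<and> cov J b = 0)"
            using jacobi_nonvanishing_near[OF J a] by (simp add: P_def)
          then show ?thesis by eventually_elim (use False in \<open>auto simp: P_def\<close>)
        qed
        then show "\<forall>\<^sub>F b in at a within I. P a = P b"
          unfolding eventually_at_filter by eventually_elim blast
      qed
    qed
    then show ?thesis using J0 J1 by (simp add: P_def zero_fun_def)
  next
    case False
    then show ?thesis using jacobi_outside[OF J] by simp
  qed
qed

end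

section \<open>Lagrangian spaces of Jacobi fields\<close>

text \<open>An orthonormal subset of \<open>W\<close> of maximal cardinality works: a vector
  different from its projection would have a nonzero remainder, whose normalisation enlarges the
  set. Cardinalities are bounded by the dimension.\<close>

lemma orthonormal_basis_form:
  fixes G :: "'e::euclidean_space \<Rightarrow> 'e \<Rightarrow> real"
  assumes G: "bilinear G" and sym: "\<And>a b. G a b = G b a" and pos: "\<And>a. a \<noteq> 0 \<Longrightarrow> G a a > 0"
    and W: "subspace W"
  shows "\<exists>B. finite B \<and> B \<subseteq> W \<and> (\<forall>a\<in>B. \<forall>b\<in>B. G a b = (if a = b then 1 else 0)) \<and>
    (\<forall>w\<in>W. w = (\<Sum>b\<in>B. G w b *\<^sub>R b))"
proof -
  define Q where "Q B \<longleftrightarrow> finite B \<and> B \<subseteq> W \<and> (\<forall>a\<in>B. \<forall>b\<in>B. G a b = (if a = b then 1 else 0))" for B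
  have "card B < DIM('e) + 1" if "Q B" for B
    using orthogonal_family_card(3)[OF G, of B "\<lambda>b. b"] that by (auto simp: Q_def less_Suc_eq_le)
  moreover have "Q {}" by (simp add: Q_def)
  ultimately obtain B where B: "Q B" "\<And>B'. Q B' \<Longrightarrow> card B' \<le> card B"
    using ex_has_greatest_nat[of Q "{}" card "DIM('e) + 1"] by blast
  have fin: "finite B" and BW: "B \<subseteq> W" and on: "\<And>a b. a \<in> B \<Longrightarrow> b \<in> B \<Longrightarrow> G a b = (if a = b then 1 else 0)"
    using B(1) by (auto simp: Q_def)
  have "w = (\<Sum>b\<in>B. G w b *\<^sub>R b)" if w: "w \<in> W" for w
  proof (rule ccontr)
    assume ne: "w \<noteq> (\<Sum>b\<in>B. G w b *\<^sub>R b)"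
    define r where "r = w - (\<Sum>b\<in>B. G w b *\<^sub>R b)"
    have rW: "r \<in> W" unfolding r_def using BW W w by (intro subspace_diff subspace_sum subspace_scale) auto
    have r0: "r \<noteq> 0" using ne by (simp add: r_def)
    define n where "n = inverse (sqrt (G r r)) *\<^sub>R r"
    have orth: "G r b = 0" if b: "b \<in> B" for b
    proof -
      have l: "linear (\<lambda>u. G u b)" using G by (simp add: bilinear_def)
      have "G r b = G w b - (\<Sum>a\<in>B. G w a * G a b)"
        unfolding r_def by (simp add: linear_diff[OF l] linear_sum[OF l] linear_scale[OF l])
      also have "(\<Sum>a\<in>B. G w a * G a b) = (\<Sum>a\<in>B. if a = b then G w b else 0)"
        by (rule sum.cong) (auto simp: on b)
      finally show ?thesis using b fin by simp
    qed
    have nn: "G n n = 1"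
      using pos[OF r0] by (simp add: n_def bilinear_lmul[OF G] bilinear_rmul[OF G] field_simps)
    have nb: "G n b = 0" if "b \<in> B" for b by (simp add: n_def bilinear_lmul[OF G] orth[OF that])
    then have nB: "n \<notin> B" using nn by auto
    have "Q (insert n B)"
      unfolding Q_def using fin BW rW W nn nb on sym nB by (auto simp: n_def intro: subspace_scale)
    then show False using B(2)[of "insert n B"] fin nB by simp
  qed
  then show ?thesis using fin BW on by (intro exI[of _ B]) auto
qed

text \<open>The orthonormal family is independent, so the common span has dimension
  \<open>card F\<close>, and a spanning family with that many indices is independent. This
  transports independence from the Gram-Schmidt frame back to the original fields.\<close>

lemma span_eq_orthonormal_imp_independent:
  fixes G :: "'e::euclidean_space \<Rightarrow> 'e \<Rightarrow> real"
  assumes G: "bilinear G" and fin: "finite F"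
    and on: "\<And>i j. i \<in> F \<Longrightarrow> j \<in> F \<Longrightarrow> G (e i) (e j) = (if i = j then 1 else 0)"
    and sp: "span (e ` F) = span (E ` F)"
    and s: "(\<Sum>i\<in>F. a i *\<^sub>R E i) = 0" and "j \<in> F"
  shows "a j = 0"
proof -
  have ind: "independent (e ` F)" and inj: "inj_on e F"
    using orthogonal_family_card[OF G fin, of e] on by auto
  have "dim (span (E ` F)) = card F"
    using dim_eq_card_independent[OF ind] inj sp by (simp add: card_image) (metis dim_span)
  then have d: "dim (E ` F) = card F" by (simp add: dim_span)
  then have c: "card (E ` F) = card F"
    using dim_le_card'[of "E ` F"] card_image_le[OF fin, of E] fin by simp
  then have injE: "inj_on E F" by (rule eq_card_imp_inj_on[OF fin])
  have indE: "independent (E ` F)"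
    by (rule card_le_dim_spanning[of _ "span (E ` F)"]) (use fin c d in \<open>auto simp: span_base dim_span\<close>)
  have "(\<Sum>v\<in>E ` F. a (the_inv_into F E v) *\<^sub>R v) = 0"
    using s by (simp add: sum.reindex[OF injE] the_inv_into_f_f[OF injE])
  then have "a (the_inv_into F E (E j)) = 0"
    using independentD[OF indE, of "E ` F" "\<lambda>v. a (the_inv_into F E v)" "E j"] fin \<open>j \<in> F\<close> by auto
  then show ?thesis using the_inv_into_f_f[OF injE \<open>j \<in> F\<close>] by simp
qed

lemma scaleR_fun_apply: "(r *\<^sub>R f) x = r *\<^sub>R f x"
  for f :: "'a \<Rightarrow> 'b::scaleR"
  by (simp add: scaleR_fun_def)

lemma sum_fun_apply: "(\<Sum>i\<in>F. f i) x = (\<Sum>i\<in>F. f i x)"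
  for f :: "'i \<Rightarrow> 'a \<Rightarrow> 'b::comm_monoid_add"
  by (induction F rule: infinite_finite_induct) auto

locale lagrangian = geodesic_curve \<A> g I c
  for \<A> :: "('m::{t2_space,second_countable_topology}, 'e::euclidean_space) chart set"
    and g :: "('m, 'e) metric" and I :: "real set" and c :: "real \<Rightarrow> 'm" +
  fixes \<Lambda> :: "(real \<Rightarrow> ('m, 'e) tvec) set"
  assumes \<Lambda>_subspace: "subspace \<Lambda>" and \<Lambda>_dim: "dim \<Lambda> = DIM('e) - 1"
    and \<Lambda>_normal: "\<forall>K\<in>\<Lambda>. normal_jacobi_field \<A> g I c K"
    and \<Lambda>_self_adjoint: "riccati_self_adjoint \<A> g I c \<Lambda>"
begin

lemma \<Lambda>_jacobi: "K \<in> \<Lambda> \<Longrightarrow> jacobi_field \<A> g I c K"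
  using \<Lambda>_normal by (simp add: normal_jacobi_field_def)

lemma \<Lambda>_tangent: "K \<in> \<Lambda> \<Longrightarrow> t \<in> I \<Longrightarrow> K t \<in> TM t"
  by (rule jacobi_tangent[OF \<Lambda>_jacobi])

lemma \<Lambda>_cov_tangent: "K \<in> \<Lambda> \<Longrightarrow> t \<in> I \<Longrightarrow> cov K t \<in> TM t"
  by (rule cov_jacobi_tangent[OF \<Lambda>_jacobi])

lemma \<Lambda>_symmetric:
  assumes "K \<in> \<Lambda>" "L \<in> \<Lambda>" "t \<in> I" "\<kappa> \<in> charts t"
  shows "gc \<kappa> t (cov K t \<kappa>) (L t \<kappa>) = gc \<kappa> t (K t \<kappa>) (cov L t \<kappa>)"
  using \<Lambda>_self_adjoint assms \<Lambda>_tangent \<Lambda>_cov_tangent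
  by (simp add: riccati_self_adjoint_def metric_eq_gc[OF assms(4), symmetric])

lemma cov_outside: "\<kappa> \<notin> charts t \<Longrightarrow> cov X t \<kappa> = 0"
  by (simp add: cov_deriv_def)

section \<open>Covariant derivatives of linear combinations\<close>

lemma cov_add:
  assumes K: "K \<in> \<Lambda>" and L: "L \<in> \<Lambda>" and t: "t \<in> I"
  shows "cov (K + L) t = cov K t + cov L t"
proof
  fix \<kappa>
  show "cov (K + L) t \<kappa> = (cov K t + cov L t) \<kappa>"
  proof (cases "\<kappa> \<in> charts t")
    case k: True
    have "((\<lambda>s. (K + L) s \<kappa>) has_vector_derivative (cov K t \<kappa> - \<Gamma>c \<kappa> t (K t \<kappa>)) + (cov L t \<kappa>
        - \<Gamma>c \<kappa> t (L t \<kappa>))) (at t within I)"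
      unfolding plus_fun_apply
      by (rule has_vector_derivative_add[OF jacobi_has_vd(1)[OF \<Lambda>_jacobi[OF K] t k] jacobi_has_vd(1)[OF
        \<Lambda>_jacobi[OF L] t k]])
    from cov_apply[where X = "K + L", OF t k this] show ?thesis
      by (simp add: linear_add[OF \<Gamma>c_linear[OF k]])
  qed (simp add: cov_outside)
qed

lemma cov_scale:
  assumes K: "K \<in> \<Lambda>" and t: "t \<in> I"
  shows "cov (r *\<^sub>R K) t = r *\<^sub>R cov K t"
proof
  fix \<kappa>
  show "cov (r *\<^sub>R K) t \<kappa> = (r *\<^sub>R cov K t) \<kappa>"
  proof (cases "\<kappa> \<in> charts t")
    case k: True
    have "((\<lambda>s. (r *\<^sub>R K) s \<kappa>) has_vector_derivative r *\<^sub>R (cov K t \<kappa> - \<Gamma>c \<kappa> t (K t \<kappa>))) (at t within I)"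
      unfolding scaleR_fun_def
      by (rule bounded_linear.has_vector_derivative[OF bounded_linear_scaleR_right jacobi_has_vd(1)[OF
        \<Lambda>_jacobi[OF K] t k]])
    from cov_apply[where X = "r *\<^sub>R K", OF t k this] show ?thesis
      by (simp add: scaleR_fun_def linear_scale[OF \<Gamma>c_linear[OF k]] scaleR_diff_right)
  qed (simp add: cov_outside scaleR_fun_def)
qed

lemma cov_zero: "t \<in> I \<Longrightarrow> cov 0 t = 0"
  using cov_scale[of 0 t 0] subspace_0[OF \<Lambda>_subspace] by simp

lemma cov_diff:
  assumes K: "K \<in> \<Lambda>" and L: "L \<in> \<Lambda>" and t: "t \<in> I"
  shows "cov (K - L) t = cov K t - cov L t"
  using cov_add[OF K subspace_scale[OF \<Lambda>_subspace L, of "-1"] t] cov_scale[OF L t, of "-1"] by simp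

lemma \<Lambda>_sum: "(\<And>i. i \<in> F \<Longrightarrow> K i \<in> \<Lambda>) \<Longrightarrow> (\<Sum>i\<in>F. a i *\<^sub>R K i) \<in> \<Lambda>"
  by (intro subspace_sum subspace_scale \<Lambda>_subspace)

lemma sum_apply2: "(\<Sum>i\<in>F. a i *\<^sub>R K i) s \<kappa> = (\<Sum>i\<in>F. a i *\<^sub>R K i s \<kappa>)"
  for K :: "'i \<Rightarrow> real \<Rightarrow> ('m, 'e) tvec"
  by (simp add: sum_fun_apply scaleR_fun_def)

lemma cov_sum:
  assumes "finite F" "\<And>i. i \<in> F \<Longrightarrow> K i \<in> \<Lambda>" "t \<in> I"
  shows "cov (\<Sum>i\<in>F. a i *\<^sub>R K i) t \<kappa> = (\<Sum>i\<in>F. a i *\<^sub>R cov (K i) t \<kappa>)"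
  using assms(1,2)
proof (induction F rule: finite_induct)
  case empty
  then show ?case using cov_zero[OF assms(3)] by (simp add: zero_fun_def)
next
  case (insert i F)
  have "cov (a i *\<^sub>R K i + (\<Sum>i\<in>F. a i *\<^sub>R K i)) t = a i *\<^sub>R cov (K i) t + cov (\<Sum>i\<in>F. a i *\<^sub>R K i) t"
    using insert.prems assms(3) by (subst cov_add) (auto simp: cov_scale intro: subspace_scale \<Lambda>_subspace \<Lambda>_sum)
  then have eq: "cov (a i *\<^sub>R K i + (\<Sum>i\<in>F. a i *\<^sub>R K i)) t \<kappa> = a i *\<^sub>R cov (K i) t \<kappa>
      + cov (\<Sum>i\<in>F. a i *\<^sub>R K i) t \<kappa>"
    by (simp only: plus_fun_apply scaleR_fun_apply)
  have IH: "cov (\<Sum>i\<in>F. a i *\<^sub>R K i) t \<kappa> = (\<Sum>i\<in>F. a i *\<^sub>R cov (K i) t \<kappa>)"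
    by (rule insert.IH) (use insert.prems in simp)
  show ?case
    unfolding sum.insert[OF insert.hyps] by (rule trans[OF eq]) (simp only: IH)
qed

lemma \<Lambda>_eq_zero:
  assumes K: "K \<in> \<Lambda>" and t: "t \<in> I" and k: "\<kappa> \<in> charts t" and "K t \<kappa> = 0" "cov K t \<kappa> = 0"
  shows "K = 0"
  by (rule jacobi_unique[OF \<Lambda>_jacobi[OF K] t])
    (use tangent_eqI[OF \<Lambda>_tangent[OF K t] tangent_zero k] tangent_eqI[OF \<Lambda>_cov_tangent[OF K t]
      tangent_zero k] assms in \<open>simp_all add: zero_fun_def\<close>)

lemma \<Lambda>_C1:
  assumes K: "K \<in> \<Lambda>" and t: "t \<in> I" and k: "\<kappa> \<in> charts t"
  shows "C1_at I t (\<lambda>s. K s \<kappa>)"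
proof (rule C1_atI)
  show "\<forall>\<^sub>F s in nhds t. s \<in> I \<longrightarrow> ((\<lambda>s. K s \<kappa>) has_vector_derivative cov K s \<kappa> - \<Gamma>c \<kappa> s (K s \<kappa>)) (at s within I)"
    using charts_near[OF t k] by eventually_elim (blast intro: jacobi_has_vd(1)[OF \<Lambda>_jacobi[OF K]])
  show "continuous (at t within I) (\<lambda>s. cov K s \<kappa> - \<Gamma>c \<kappa> s (K s \<kappa>))"
    using has_vector_derivative_continuous[OF jacobi_cov_has_vd(1)[OF \<Lambda>_jacobi[OF K] t k]]
      has_vector_derivative_continuous[OF jacobi_has_vd(1)[OF \<Lambda>_jacobi[OF K] t k]]
      christoffel_family_tendsto[OF t k vel_tendsto[OF t k], of "\<lambda>s. K s \<kappa>" "K t \<kappa>"]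
    by (auto simp: continuous_within intro!: tendsto_diff)
qed

text \<open>
  At a zero \<open>t\<close> of \<open>K\<close> the vertical bundle is framed by \<open>K(s) / (s - t)\<close>. This field is
  covariantly stationary at \<open>t\<close>, since \<open>K'' = - R(K, c')c'\<close> vanishes there.
\<close>

lemma \<Lambda>_divided_difference:
  assumes K: "K \<in> \<Lambda>" and t: "t \<in> I" and k: "\<kappa> \<in> charts t" and K0: "K t = 0"
  defines "q \<equiv> \<lambda>s. if s = t then cov K t \<kappa> else K s \<kappa> /\<^sub>R (s - t)"
  shows "C1_at I t q" and "(q has_vector_derivative - \<Gamma>c \<kappa> t (q t)) (at t within I)"
proof -
  note J = \<Lambda>_jacobi[OF K]
  define f1 where "f1 s = cov K s \<kappa> - \<Gamma>c \<kappa> s (K s \<kappa>)" for s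
  note l = \<Gamma>c_linear[OF k]
  have K0': "K t \<kappa> = 0" using K0 by simp
  have f1t: "f1 t = cov K t \<kappa>" by (simp add: f1_def K0' linear_0[OF l])
  obtain D where D: "linear D" "((\<lambda>s. \<Gamma>c \<kappa> s (K s \<kappa>)) has_vector_derivative D (K t \<kappa>)
      + \<Gamma>c \<kappa> t (cov K t \<kappa> - \<Gamma>c \<kappa> t (K t \<kappa>))) (at t within I)"
    by (rule \<Gamma>c_has_vd[where X = "\<lambda>s. K s \<kappa>", OF t k jacobi_has_vd(1)[OF J t k]])
  \<comment> \<open>\<open>K t = 0\<close> removes the curvature from \<open>K''\<close> and the
    summand \<open>D\<close> of the Christoffel term. One of the two copies of
    \<open>\<Gamma>c\<close> comes from the coordinate derivative of \<open>cov K\<close>, the other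
    from differentiating \<open>\<Gamma>c \<kappa> s (K s \<kappa>)\<close>. Halving in the divided
    difference leaves one copy, so that the covariant derivative of \<open>q\<close> at
    \<open>t\<close> is 0.\<close>
  have f2: "(f1 has_vector_derivative - (2 *\<^sub>R \<Gamma>c \<kappa> t (cov K t \<kappa>))) (at t within I)"
    unfolding f1_def
    using has_vector_derivative_diff[OF jacobi_cov_has_vd(1)[OF J t k] D(2)]
    by (simp add: K0' linear_0[OF l] linear_0[OF D(1)] jacobi_second[OF J t k] linear_0[OF Rc_linear[OF
      k]] scaleR_2)
  have f1': "\<forall>\<^sub>F s in nhds t. s \<in> I \<longrightarrow> ((\<lambda>s. K s \<kappa>) has_vector_derivative f1 s) (at s within I)"
    unfolding f1_def using charts_near[OF t k] by eventually_elim (blast intro: jacobi_has_vd(1)[OF J])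
  note dd = divided_difference_C1[OF interval t f1' f2 K0', folded f1t]
  have q: "q = (\<lambda>s. if s = t then f1 t else K s \<kappa> /\<^sub>R (s - t))" unfolding q_def f1t ..
  show "C1_at I t q" unfolding q by (rule C1_atI[OF dd(1) dd(2)])
  have "((\<lambda>s. if s = t then f1 t else K s \<kappa> /\<^sub>R (s - t)) has_vector_derivative
      - (2 *\<^sub>R \<Gamma>c \<kappa> t (cov K t \<kappa>)) /\<^sub>R 2) (at t within I)"
    using eventually_nhds_x_imp_x[OF dd(1)] t by (simp add: f1t[symmetric])
  then show "(q has_vector_derivative - \<Gamma>c \<kappa> t (q t)) (at t within I)" unfolding q by (simp add: f1t)
qed

end

section \<open>Adapted frames of the vertical bundle\<close>

context lagrangian
begin

abbreviation vert :: "(real \<Rightarrow> ('m, 'e) tvec) set \<Rightarrow> real \<Rightarrow> ('m, 'e) tvec set" where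
  "vert \<equiv> vertical_space \<A> g I c"

lemma eval_linear: "linear (\<lambda>v::('m, 'e) tvec. v \<kappa>)"
  by (rule linearI) (simp_all add: scaleR_fun_apply)

lemma vert_subspace:
  assumes \<Upsilon>: "subspace \<Upsilon>" "\<Upsilon> \<subseteq> \<Lambda>" and s: "s \<in> I"
  shows "subspace (vert \<Upsilon> s)"
  unfolding subspace_def
proof (intro conjI ballI allI)
  have 0: "0 \<in> \<Upsilon>" by (rule subspace_0[OF \<Upsilon>(1)])
  show "0 \<in> vert \<Upsilon> s"
    unfolding vertical_space_def using 0 cov_zero[OF s] by (force simp: zero_fun_def)
  show "u + v \<in> vert \<Upsilon> s" if "u \<in> vert \<Upsilon> s" "v \<in> vert \<Upsilon> s" for u v
  proof -
    obtain J1 J2 where u: "u = J1 s + cov J2 s" "J1 \<in> \<Upsilon>" "J2 \<in> \<Upsilon>" "J2 s = 0"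
      using \<open>u \<in> vert \<Upsilon> s\<close> unfolding vertical_space_def by blast
    obtain K1 K2 where v: "v = K1 s + cov K2 s" "K1 \<in> \<Upsilon>" "K2 \<in> \<Upsilon>" "K2 s = 0"
      using \<open>v \<in> vert \<Upsilon> s\<close> unfolding vertical_space_def by blast
    have "cov (J2 + K2) s = cov J2 s + cov K2 s" using u v \<Upsilon>(2) s by (intro cov_add) auto
    then have "u + v = (J1 + K1) s + cov (J2 + K2) s" unfolding u(1) v(1) plus_fun_apply[of J1]
      by (simp only: add_ac)
    moreover have "J1 + K1 \<in> \<Upsilon>" "J2 + K2 \<in> \<Upsilon>" using u v subspace_add[OF \<Upsilon>(1)] by auto
    moreover have "(J2 + K2) s = 0" using u v by simp
    ultimately show ?thesis unfolding vertical_space_def by blast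
  qed
  show "r *\<^sub>R u \<in> vert \<Upsilon> s" if "u \<in> vert \<Upsilon> s" for r u
  proof -
    obtain J1 J2 where u: "u = J1 s + cov J2 s" "J1 \<in> \<Upsilon>" "J2 \<in> \<Upsilon>" "J2 s = 0"
      using \<open>u \<in> vert \<Upsilon> s\<close> unfolding vertical_space_def by blast
    have "cov (r *\<^sub>R J2) s = r *\<^sub>R cov J2 s" using u \<Upsilon>(2) s by (intro cov_scale) auto
    then have "r *\<^sub>R u = (r *\<^sub>R J1) s + cov (r *\<^sub>R J2) s" unfolding u(1) scaleR_fun_apply[of r J1]
      by (simp only: scaleR_right_distrib)
    moreover have "r *\<^sub>R J1 \<in> \<Upsilon>" "r *\<^sub>R J2 \<in> \<Upsilon>" using u subspace_scale[OF \<Upsilon>(1)] by auto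
    moreover have "(r *\<^sub>R J2) s = 0" using u by (simp add: scaleR_fun_apply)
    ultimately show ?thesis unfolding vertical_space_def by blast
  qed
qed

lemma vert_tangent:
  assumes "\<Upsilon> \<subseteq> \<Lambda>" "s \<in> I" "v \<in> vert \<Upsilon> s"
  shows "v \<in> TM s"
proof -
  obtain J1 J2 where "v = J1 s + cov J2 s" "J1 \<in> \<Upsilon>" "J2 \<in> \<Upsilon>"
    using assms(3) unfolding vertical_space_def by blast
  then show ?thesis using tangent_add[OF \<Lambda>_tangent \<Lambda>_cov_tangent] assms(1,2) by blast
qed

lemma vertI1:
  assumes \<Upsilon>: "subspace \<Upsilon>" "\<Upsilon> \<subseteq> \<Lambda>" and s: "s \<in> I" and L: "L \<in> \<Upsilon>"
  shows "L s \<in> vert \<Upsilon> s"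
proof -
  have "L s = L s + cov 0 s" using cov_zero[OF s] by simp
  moreover have "0 \<in> \<Upsilon>" by (rule subspace_0[OF \<Upsilon>(1)])
  moreover have "(0 :: real \<Rightarrow> ('m, 'e) tvec) s = 0" by (simp add: zero_fun_def)
  ultimately show ?thesis unfolding vertical_space_def using L by blast
qed

lemma vertI2:
  assumes \<Upsilon>: "subspace \<Upsilon>" and L: "L \<in> \<Upsilon>" "L s = 0"
  shows "cov L s \<in> vert \<Upsilon> s"
proof -
  have "cov L s = (0 :: real \<Rightarrow> ('m, 'e) tvec) s + cov L s" by (simp add: zero_fun_def)
  moreover have "0 \<in> \<Upsilon>" by (rule subspace_0[OF \<Upsilon>])
  ultimately show ?thesis unfolding vertical_space_def using L by blast
qed

text \<open>
  The fields \<open>K b\<close> span \<open>\<Upsilon>\<close> and the \<open>e b\<close> are an orthonormal frame of the vertical bundle near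
  \<open>t\<close>. By the last clause, every \<open>J \<in> \<Lambda>\<close> can be changed by an element of \<open>\<Upsilon>\<close> so that at \<open>t\<close> it
  becomes perpendicular to the vertical space and satisfies \<open>\<langle>J', e b\<rangle> = \<langle>J, (e b)'\<rangle>\<close>. The latter
  is self-adjointness when \<open>e b\<close> is the value of a field in \<open>\<Upsilon>\<close>; for the other frame vectors
  \<open>K'(t)\<close>, \<open>K(t) = 0\<close>, it is the normalisation \<open>\<langle>J', K'\<rangle> = 0\<close>, possible because adding \<open>K\<close>
  changes \<open>J'(t)\<close> but not \<open>J(t)\<close>.
\<close>

definition adapted :: "('m, 'e) chart \<Rightarrow> real \<Rightarrow> (real \<Rightarrow> ('m, 'e) tvec) set \<Rightarrow>
    'e set \<Rightarrow> ('e \<Rightarrow> real \<Rightarrow> ('m, 'e) tvec) \<Rightarrow> ('e \<Rightarrow> real \<Rightarrow> 'e) \<Rightarrow> bool" where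
  "adapted \<kappa> t \<Upsilon> F K e \<longleftrightarrow>
     finite F \<and> (\<forall>b\<in>F. K b \<in> \<Upsilon>) \<and> (\<forall>L\<in>\<Upsilon>. \<exists>a. L = (\<Sum>b\<in>F. a b *\<^sub>R K b)) \<and>
     (\<forall>b\<in>F. C1_at I t (e b)) \<and>
     (\<forall>\<^sub>F s in nhds t. s \<in> I \<longrightarrow> \<kappa> \<in> charts s \<and>
       (\<forall>b\<in>F. \<forall>b'\<in>F. gc \<kappa> s (e b s) (e b' s) = (if b = b' then 1 else 0)) \<and>
       (\<lambda>v. v \<kappa>) ` vert \<Upsilon> s = span ((\<lambda>b. e b s) ` F) \<and>
       (s \<noteq> t \<longrightarrow> (\<forall>a. (\<Sum>b\<in>F. a b *\<^sub>R K b s \<kappa>) = 0 \<longrightarrow> (\<forall>b\<in>F. a b = 0)))) \<and>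
     (\<forall>J\<in>\<Lambda>. \<exists>L\<in>\<Upsilon>. \<forall>b\<in>F. gc \<kappa> t ((J - L) t \<kappa>) (e b t) = 0 \<and>
       (\<forall>D. (e b has_vector_derivative D) (at t within I) \<longrightarrow>
         gc \<kappa> t (cov (J - L) t \<kappa>) (e b t) = gc \<kappa> t ((J - L) t \<kappa>) (D + \<Gamma>c \<kappa> t (e b t))))"

text \<open>At \<open>t\<close> the vertical space is the orthogonal sum of the values
  \<open>W1\<close> and of the derivatives \<open>W2\<close> of fields with a zero. Orthonormal
  bases of both are realised by fields in \<open>\<Upsilon>\<close>, and Gram-Schmidt makes the
  resulting frame orthonormal nearby. The frame is indexed by its own values at
  \<open>t\<close>.\<close>

lemma adapted_frame_exists:
  assumes t: "t \<in> I" and k: "\<kappa> \<in> charts t" and \<Upsilon>: "subspace \<Upsilon>" "\<Upsilon> \<subseteq> \<Lambda>"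
  shows "\<exists>F K e. adapted \<kappa> t \<Upsilon> F K e"
proof -
  have \<Upsilon>\<Lambda>: "L \<in> \<Lambda>" if "L \<in> \<Upsilon>" for L using that \<Upsilon>(2) by blast
  define W1 where "W1 = (\<lambda>L. L t \<kappa>) ` \<Upsilon>"
  define W2 where "W2 = (\<lambda>L. cov L t \<kappa>) ` {L\<in>\<Upsilon>. L t = 0}"
  have sW1: "subspace W1"
    unfolding subspace_def
  proof (intro conjI ballI allI)
    have "(0 :: real \<Rightarrow> ('m, 'e) tvec) t \<kappa> \<in> W1" unfolding W1_def using subspace_0[OF \<Upsilon>(1)] by (rule imageI)
    then show "0 \<in> W1" by (simp add: zero_fun_def)
    show "x + y \<in> W1" if "x \<in> W1" "y \<in> W1" for x y
    proof -
      obtain L M where "x = L t \<kappa>" "L \<in> \<Upsilon>" "y = M t \<kappa>" "M \<in> \<Upsilon>" using \<open>x \<in> W1\<close> \<open>y \<in> W1\<close> unfolding W1_def by blast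
      then have "x + y = (L + M) t \<kappa>" "L + M \<in> \<Upsilon>" using subspace_add[OF \<Upsilon>(1)] by auto
      then show ?thesis unfolding W1_def by blast
    qed
    show "r *\<^sub>R x \<in> W1" if "x \<in> W1" for r x
    proof -
      obtain L where "x = L t \<kappa>" "L \<in> \<Upsilon>" using \<open>x \<in> W1\<close> unfolding W1_def by blast
      then have "r *\<^sub>R x = (r *\<^sub>R L) t \<kappa>" "r *\<^sub>R L \<in> \<Upsilon>" using subspace_scale[OF \<Upsilon>(1)]
        by (auto simp: scaleR_fun_apply)
      then show ?thesis unfolding W1_def by blast
    qed
  qed
  have sW2: "subspace W2"
    unfolding subspace_def
  proof (intro conjI ballI allI)
    have "cov 0 t \<kappa> \<in> W2" unfolding W2_def using subspace_0[OF \<Upsilon>(1)] by (intro imageI) (simp add: zero_fun_def)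
    then show "0 \<in> W2" using cov_zero[OF t] by simp
    show "x + y \<in> W2" if "x \<in> W2" "y \<in> W2" for x y
    proof -
      obtain L M where LM: "x = cov L t \<kappa>" "L \<in> \<Upsilon>" "L t = 0" "y = cov M t \<kappa>" "M \<in> \<Upsilon>" "M t = 0"
        using \<open>x \<in> W2\<close> \<open>y \<in> W2\<close> unfolding W2_def by blast
      then have "x + y = cov (L + M) t \<kappa>" unfolding cov_add[OF \<Upsilon>\<Lambda>[OF LM(2)] \<Upsilon>\<Lambda>[OF LM(5)] t] by simp
      moreover have "L + M \<in> {L\<in>\<Upsilon>. L t = 0}" using LM subspace_add[OF \<Upsilon>(1) LM(2) LM(5)] by simp
      ultimately show ?thesis unfolding W2_def by blast
    qed
    show "r *\<^sub>R x \<in> W2" if "x \<in> W2" for r x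
    proof -
      obtain L where L: "x = cov L t \<kappa>" "L \<in> \<Upsilon>" "L t = 0" using \<open>x \<in> W2\<close> unfolding W2_def by blast
      then have "r *\<^sub>R x = cov (r *\<^sub>R L) t \<kappa>" unfolding cov_scale[OF \<Upsilon>\<Lambda>[OF L(2)] t]
        by (simp add: scaleR_fun_apply)
      moreover have "r *\<^sub>R L \<in> {L\<in>\<Upsilon>. L t = 0}" using L subspace_scale[OF \<Upsilon>(1) L(2)]
        by (simp add: scaleR_fun_apply)
      ultimately show ?thesis unfolding W2_def by blast
    qed
  qed
  note G = gc_bilinear[OF k] and Gs = gc_sym[OF k] and Gp = gc_pos[OF k]
  have "\<exists>B1. finite B1 \<and> B1 \<subseteq> W1 \<and> (\<forall>a\<in>B1. \<forall>b\<in>B1. gc \<kappa> t a b = (if a = b then 1 else 0)) \<and>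
    (\<forall>w\<in>W1. w = (\<Sum>b\<in>B1. gc \<kappa> t w b *\<^sub>R b))"
    by (rule orthonormal_basis_form[OF G Gs Gp sW1])
  then obtain B1 where B1': "finite B1 \<and> B1 \<subseteq> W1 \<and> (\<forall>a\<in>B1. \<forall>b\<in>B1. gc \<kappa> t a b = (if a = b then 1 else 0)) \<and>
    (\<forall>w\<in>W1. w = (\<Sum>b\<in>B1. gc \<kappa> t w b *\<^sub>R b))" by (elim exE)
  have B1: "finite B1" "B1 \<subseteq> W1" "\<And>a b. a \<in> B1 \<Longrightarrow> b \<in> B1 \<Longrightarrow> gc \<kappa> t a b = (if a = b then 1 else 0)"
    "\<And>w. w \<in> W1 \<Longrightarrow> w = (\<Sum>b\<in>B1. gc \<kappa> t w b *\<^sub>R b)"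
    using B1' by (simp, simp, simp, blast)
  have "\<exists>B2. finite B2 \<and> B2 \<subseteq> W2 \<and> (\<forall>a\<in>B2. \<forall>b\<in>B2. gc \<kappa> t a b = (if a = b then 1 else 0)) \<and>
    (\<forall>w\<in>W2. w = (\<Sum>b\<in>B2. gc \<kappa> t w b *\<^sub>R b))"
    by (rule orthonormal_basis_form[OF G Gs Gp sW2])
  then obtain B2 where B2': "finite B2 \<and> B2 \<subseteq> W2 \<and> (\<forall>a\<in>B2. \<forall>b\<in>B2. gc \<kappa> t a b = (if a = b then 1 else 0)) \<and>
    (\<forall>w\<in>W2. w = (\<Sum>b\<in>B2. gc \<kappa> t w b *\<^sub>R b))" by (elim exE)
  have B2: "finite B2" "B2 \<subseteq> W2" "\<And>a b. a \<in> B2 \<Longrightarrow> b \<in> B2 \<Longrightarrow> gc \<kappa> t a b = (if a = b then 1 else 0)"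
    "\<And>w. w \<in> W2 \<Longrightarrow> w = (\<Sum>b\<in>B2. gc \<kappa> t w b *\<^sub>R b)"
    using B2' by (simp, simp, simp, blast)
  \<comment> \<open>By self-adjointness the pairing equals that of \<open>J'\<close> with
    \<open>L t = 0\<close>. As this holds for all \<open>J\<close> in \<open>\<Lambda>\<close>, it
    gives both the orthogonality of \<open>W1\<close> and \<open>W2\<close> and the perpendicularity
    of a corrected field to \<open>B2\<close>.\<close>
  have J2: "gc \<kappa> t (J t \<kappa>) w = 0" if J: "J \<in> \<Lambda>" and w: "w \<in> W2" for J w
  proof -
    obtain L where L: "w = cov L t \<kappa>" "L \<in> \<Upsilon>" "L t = 0" using w unfolding W2_def by blast
    have "gc \<kappa> t (J t \<kappa>) w = gc \<kappa> t (cov J t \<kappa>) (L t \<kappa>)"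
      using \<Lambda>_symmetric[OF J \<Upsilon>\<Lambda>[OF L(2)] t k] L(1) by simp
    then show ?thesis using L(3) bilinear_rzero[OF G] by simp
  qed
  have cross: "gc \<kappa> t a b = 0" if "a \<in> B1" "b \<in> B2" for a b
  proof -
    obtain L where "a = L t \<kappa>" "L \<in> \<Upsilon>" using \<open>a \<in> B1\<close> B1(2) unfolding W1_def by blast
    then show ?thesis using J2[OF \<Upsilon>\<Lambda>] that(2) B2(2) by blast
  qed
  have disj: "B1 \<inter> B2 = {}" using B1(3) cross by fastforce
  define F where "F = B1 \<union> B2"
  have finF: "finite F" using B1 B2 by (simp add: F_def)
  have onF: "gc \<kappa> t a b = (if a = b then 1 else 0)" if "a \<in> F" "b \<in> F" for a b
    using that B1(3) B2(3) cross[of a b] cross[of b a] Gs[of a b] disj unfolding F_def by auto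
  define K where "K b = (if b \<in> B1 then (SOME L. L \<in> \<Upsilon> \<and> L t \<kappa> = b) else (SOME L. L \<in> \<Upsilon> \<and> L t = 0
      \<and> cov L t \<kappa> = b))" for b
  have K1: "K b \<in> \<Upsilon> \<and> K b t \<kappa> = b" if "b \<in> B1" for b
  proof -
    have "\<exists>L. L \<in> \<Upsilon> \<and> L t \<kappa> = b" using that B1(2) unfolding W1_def by blast
    from someI_ex[OF this] show ?thesis using that by (simp add: K_def)
  qed
  have K2: "K b \<in> \<Upsilon> \<and> K b t = 0 \<and> cov (K b) t \<kappa> = b" if "b \<in> B2" for b
  proof -
    have "\<exists>L. L \<in> \<Upsilon> \<and> L t = 0 \<and> cov L t \<kappa> = b" using that B2(2) unfolding W2_def by blast
    moreover have "b \<notin> B1" using that disj by blast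
    ultimately show ?thesis using someI_ex[of "\<lambda>L. L \<in> \<Upsilon> \<and> L t = 0 \<and> cov L t \<kappa> = b"] by (simp add: K_def)
  qed
  have K\<Upsilon>: "K b \<in> \<Upsilon>" if "b \<in> F" for b using that K1 K2 by (auto simp: F_def)
  have K\<Lambda>: "K b \<in> \<Lambda>" if "b \<in> F" for b using K\<Upsilon>[OF that] \<Upsilon>\<Lambda> by blast
  define E where "E b = (if b \<in> B1 then (\<lambda>s. K b s \<kappa>) else (\<lambda>s. if s
      = t then cov (K b) t \<kappa> else K b s \<kappa> /\<^sub>R (s - t)))" for b
  \<comment> \<open>\<open>N b\<close> is the covariant derivative of \<open>E b\<close> at
    \<open>t\<close>: that of the field \<open>K b\<close> in the first case, and 0 for a divided
    difference, which is stationary at \<open>t\<close>.\<close>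
  define N where "N b = (if b \<in> B1 then cov (K b) t \<kappa> else 0)" for b
  have Et: "E b t = b" if "b \<in> F" for b
    using that K1 K2 unfolding F_def E_def by (cases "b \<in> B1") auto
  have EC1: "C1_at I t (E b)" and Ed: "(E b has_vector_derivative N b - \<Gamma>c \<kappa> t b) (at t within I)"
    if b: "b \<in> F" for b
  proof -
    show "C1_at I t (E b)"
    proof (cases "b \<in> B1")
      case True
      then show ?thesis using \<Lambda>_C1[OF K\<Lambda>[OF b] t k] by (simp add: E_def)
    next
      case False
      then have "K b t = 0" using b K2 by (auto simp: F_def)
      from \<Lambda>_divided_difference(1)[OF K\<Lambda>[OF b] t k this] show ?thesis using False by (simp add: E_def)
    qed
    show "(E b has_vector_derivative N b - \<Gamma>c \<kappa> t b) (at t within I)"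
    proof (cases "b \<in> B1")
      case True
      then show ?thesis using jacobi_has_vd(1)[OF \<Lambda>_jacobi[OF K\<Lambda>[OF b]] t k] K1[OF True]
        by (simp add: E_def N_def)
    next
      case False
      then have K: "K b t = 0" "cov (K b) t \<kappa> = b" using b K2 by (auto simp: F_def)
      from \<Lambda>_divided_difference(2)[OF K\<Lambda>[OF b] t k K(1)] show ?thesis using False K(2)
        by (simp add: E_def N_def)
    qed
  qed
  \<comment> \<open>The factor relating field and frame vector. It is nonzero for
    \<open>s \<noteq> t\<close>, so that independence and spans can be moved between
    \<open>K\<close> and \<open>E\<close> there.\<close>
  define \<sigma> where "\<sigma> b s = (if b \<in> B1 then 1 else s - t)" for b s
  have KE: "K b s \<kappa> = \<sigma> b s *\<^sub>R E b s" if b: "b \<in> F" for b s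
    using b K2[of b] by (cases "b \<in> B1") (auto simp: F_def \<sigma>_def E_def)
  have sum_split: "(\<Sum>b\<in>F. f b) = (\<Sum>b\<in>B1. f b) + (\<Sum>b\<in>B2. f b)" for f :: "'e \<Rightarrow> 'x::comm_monoid_add"
    unfolding F_def using B1(1) B2(1) disj by (rule sum.union_disjoint)
  \<comment> \<open>Subtracting the combination over \<open>B1\<close> makes the field vanish at
    \<open>t\<close>; the combination over \<open>B2\<close> then removes its derivative without
    changing the value. The remainder has zero initial data and is 0 by uniqueness.\<close>
  have span\<Upsilon>: "\<exists>a. L = (\<Sum>b\<in>F. a b *\<^sub>R K b)" if L: "L \<in> \<Upsilon>" for L
  proof -
    define L1 where "L1 = L - (\<Sum>b\<in>B1. gc \<kappa> t (L t \<kappa>) b *\<^sub>R K b)"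
    define S2 where "S2 = (\<Sum>b\<in>B2. gc \<kappa> t (cov L1 t \<kappa>) b *\<^sub>R K b)"
    have S1\<Upsilon>: "(\<Sum>b\<in>B1. gc \<kappa> t (L t \<kappa>) b *\<^sub>R K b) \<in> \<Upsilon>"
      using K1 by (intro subspace_sum subspace_scale \<Upsilon>(1)) auto
    have S2\<Upsilon>: "S2 \<in> \<Upsilon>" unfolding S2_def using K2 by (intro subspace_sum subspace_scale \<Upsilon>(1)) auto
    have L1: "L1 \<in> \<Upsilon>" unfolding L1_def by (rule subspace_diff[OF \<Upsilon>(1) L S1\<Upsilon>])
    have "(\<Sum>b\<in>B1. gc \<kappa> t (L t \<kappa>) b *\<^sub>R K b) t \<kappa> = L t \<kappa>"
      unfolding sum_apply2 using B1(4)[of "L t \<kappa>"] L K1 by (simp add: W1_def)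
    then have "L1 t \<kappa> = 0 \<kappa>" unfolding L1_def by simp
    then have L1t: "L1 t = 0"
      by (rule tangent_eqI[OF \<Lambda>_tangent[OF \<Upsilon>\<Lambda>[OF L1] t] tangent_zero k])
    have S2t: "S2 t \<kappa> = 0" unfolding S2_def sum_apply2 using K2 by simp
    have "cov S2 t \<kappa> = (\<Sum>b\<in>B2. gc \<kappa> t (cov L1 t \<kappa>) b *\<^sub>R b)"
      unfolding S2_def using K2 \<Upsilon>\<Lambda> by (subst cov_sum[OF B2(1) _ t]) auto
    also have "\<dots> = cov L1 t \<kappa>" using B2(4)[of "cov L1 t \<kappa>"] L1 L1t by (simp add: W2_def)
    finally have c: "cov S2 t \<kappa> = cov L1 t \<kappa>" .
    have "L1 - S2 = 0"
    proof (rule \<Lambda>_eq_zero[OF _ t k])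
      show "L1 - S2 \<in> \<Lambda>" by (rule \<Upsilon>\<Lambda>[OF subspace_diff[OF \<Upsilon>(1) L1 S2\<Upsilon>]])
      show "(L1 - S2) t \<kappa> = 0" using S2t L1t by simp
      show "cov (L1 - S2) t \<kappa> = 0"
        unfolding cov_diff[OF \<Upsilon>\<Lambda>[OF L1] \<Upsilon>\<Lambda>[OF S2\<Upsilon>] t] using c by simp
    qed
    then have "L1 = S2" by (rule eq_iff_diff_eq_0[THEN iffD2])
    then have "L = S2 + (\<Sum>b\<in>B1. gc \<kappa> t (L t \<kappa>) b *\<^sub>R K b)"
      unfolding L1_def by (rule diff_eq_eq[THEN iffD1])
    also have "\<dots> = (\<Sum>b\<in>B1. gc \<kappa> t (L t \<kappa>) b *\<^sub>R K b) + S2" by (rule add.commute)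
    also have "\<dots> = (\<Sum>b\<in>F. (if b \<in> B1 then gc \<kappa> t (L t \<kappa>) b else gc \<kappa> t (cov L1 t \<kappa>) b) *\<^sub>R K b)"
      unfolding sum_split S2_def using disj by (intro arg_cong2[where f = "(+)"] sum.cong) auto
    finally show ?thesis by (rule exI[where x = "\<lambda>b. if b
        \<in> B1 then gc \<kappa> t (L t \<kappa>) b else gc \<kappa> t (cov L1 t \<kappa>) b"])
  qed
  have orthE: "gc \<kappa> t (E i t) (E j t) = (if i = j then 1 else 0)" if "i \<in> F" "j \<in> F" for i j
    using onF that by (simp add: Et)
  have "\<exists>e. (\<forall>i\<in>F. C1_at I t (e i) \<and> e i t = E i t) \<and>
    (\<forall>\<^sub>F s in nhds t. s \<in> I \<longrightarrow> (\<forall>i\<in>F. \<forall>j\<in>F. gc \<kappa> s (e i s) (e j s) = (if i = j then 1 else 0)) \<and>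
       span ((\<lambda>i. e i s) ` F) = span ((\<lambda>i. E i s) ` F))"
  proof (rule gram_schmidt_fields[OF _ _ t gc_C1[OF t k] finF EC1 orthE])
    show "\<forall>\<^sub>F s in nhds t. s \<in> I \<longrightarrow> bilinear (gc \<kappa> s)"
      using charts_near[OF t k] by eventually_elim (blast intro: gc_bilinear)
    show "\<forall>\<^sub>F s in nhds t. s \<in> I \<longrightarrow> (\<forall>a b. gc \<kappa> s a b = gc \<kappa> s b a)"
      using charts_near[OF t k] by eventually_elim (blast intro: gc_sym)
  qed
  then obtain e where e: "\<forall>i\<in>F. C1_at I t (e i) \<and> e i t = E i t"
    and ev: "\<forall>\<^sub>F s in nhds t. s \<in> I \<longrightarrow> (\<forall>i\<in>F. \<forall>j\<in>F. gc \<kappa> s (e i s) (e j s) = (if i = j then 1 else 0)) \<and>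
       span ((\<lambda>i. e i s) ` F) = span ((\<lambda>i. E i s) ` F)" by (elim exE conjE)
  have vdC1: "(X has_vector_derivative vector_derivative X (at t within I)) (at t within I)"
    if "C1_at I t X" for X :: "real \<Rightarrow> 'x::real_normed_vector"
  proof -
    obtain D where D: "(X has_vector_derivative D) (at t within I)"
      using C1_at_has_derivative[OF \<open>C1_at I t X\<close> t] .
    show ?thesis using D vd_eq[OF t D] by simp
  qed
  have eC1: "C1_at I t (e b)" if "b \<in> F" for b using e that by blast
  have et: "e b t = b" if "b \<in> F" for b using e that Et by simp
  have ev': "\<forall>\<^sub>F s in nhds t. s \<in> I \<longrightarrow> \<kappa> \<in> charts s \<and>
       (\<forall>b\<in>F. \<forall>b'\<in>F. gc \<kappa> s (e b s) (e b' s) = (if b = b' then 1 else 0)) \<and>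
       (\<lambda>v. v \<kappa>) ` vert \<Upsilon> s = span ((\<lambda>b. e b s) ` F) \<and>
       (s \<noteq> t \<longrightarrow> (\<forall>a. (\<Sum>b\<in>F. a b *\<^sub>R K b s \<kappa>) = 0 \<longrightarrow> (\<forall>b\<in>F. a b = 0)))"
    using ev charts_near[OF t k]
  proof eventually_elim
    case (elim s)
    show ?case
    proof
      assume s: "s \<in> I"
      have ks: "\<kappa> \<in> charts s" and on: "\<And>i j. i \<in> F \<Longrightarrow> j \<in> F \<Longrightarrow> gc \<kappa> s (e i s) (e j s) = (if i = j then 1 else 0)"
        and sp: "span ((\<lambda>i. e i s) ` F) = span ((\<lambda>i. E i s) ` F)" using elim s by blast+
      \<comment> \<open>The orthonormal frame has the same span as \<open>E\<close>, which forces
        \<open>E\<close> to be independent at \<open>s\<close>; the factor \<open>\<sigma>\<close>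
        is cancelled for \<open>s \<noteq> t\<close>.\<close>
      have ind: "a b = 0" if "s \<noteq> t" "(\<Sum>b\<in>F. a b *\<^sub>R K b s \<kappa>) = 0" "b \<in> F" for a b
      proof -
        have "(\<Sum>b\<in>F. (a b * \<sigma> b s) *\<^sub>R E b s) = 0" using that(2) KE by simp
        from span_eq_orthonormal_imp_independent[OF gc_bilinear[OF ks] finF on sp this that(3)]
        show ?thesis using that(1) by (simp add: \<sigma>_def split: if_splits)
      qed
      have sub: "subspace ((\<lambda>v. v \<kappa>) ` vert \<Upsilon> s)"
        by (rule linear_subspace_image[OF eval_linear vert_subspace[OF \<Upsilon> s]])
      have "(\<lambda>v. v \<kappa>) ` vert \<Upsilon> s = span ((\<lambda>b. E b s) ` F)"
      proof (rule antisym)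
        have L1: "L s \<kappa> \<in> span ((\<lambda>b. E b s) ` F)" if L: "L \<in> \<Upsilon>" for L
        proof -
          obtain a where a: "L = (\<Sum>b\<in>F. a b *\<^sub>R K b)" using span\<Upsilon>[OF L] by (elim exE)
          show ?thesis unfolding a sum_apply2
            using KE by (intro span_sum span_scale) (simp add: span_scale span_base)
        qed
        \<comment> \<open>For \<open>s \<noteq> t\<close> independence of the \<open>K b\<close> at
          \<open>s\<close> shows that only the zero field of \<open>\<Upsilon>\<close> vanishes at
          \<open>s\<close>, so the second summand of the vertical space is trivial. At
          \<open>s = t\<close> it is spanned by \<open>B2\<close>.\<close>
        have L2: "cov L s \<kappa> \<in> span ((\<lambda>b. E b s) ` F)" if L: "L \<in> \<Upsilon>" "L s = 0" for L
        proof (cases "s = t")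
          case True
          have "cov L t \<kappa> = (\<Sum>b\<in>B2. gc \<kappa> t (cov L t \<kappa>) b *\<^sub>R b)"
            by (rule B2(4)) (use L True in \<open>auto simp: W2_def\<close>)
          also have "\<dots> = (\<Sum>b\<in>B2. gc \<kappa> t (cov L t \<kappa>) b *\<^sub>R E b t)" using Et by (simp add: F_def)
          also have "\<dots> \<in> span ((\<lambda>b. E b t) ` F)" by (intro span_sum span_scale span_base) (auto simp: F_def)
          finally show ?thesis using True by simp
        next
          case False
          obtain a where a: "L = (\<Sum>b\<in>F. a b *\<^sub>R K b)" using span\<Upsilon>[OF L(1)] by (elim exE)
          have "(\<Sum>b\<in>F. a b *\<^sub>R K b s \<kappa>) = L s \<kappa>" unfolding a sum_apply2 ..
          also have "\<dots> = 0" using L(2) by simp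
          finally have "a b = 0" if "b \<in> F" for b using ind[OF False _ that] by blast
          then have "L = 0" unfolding a by (simp add: sum.neutral)
          then show ?thesis using cov_zero[OF s] by (simp add: span_zero)
        qed
        show "(\<lambda>v. v \<kappa>) ` vert \<Upsilon> s \<subseteq> span ((\<lambda>b. E b s) ` F)"
        proof
          fix x assume "x \<in> (\<lambda>v. v \<kappa>) ` vert \<Upsilon> s"
          then obtain J1 J2 where "x = (J1 s + cov J2 s) \<kappa>" "J1 \<in> \<Upsilon>" "J2 \<in> \<Upsilon>" "J2 s = 0"
            unfolding vertical_space_def by blast
          then show "x \<in> span ((\<lambda>b. E b s) ` F)" using L1 L2 by (simp add: span_add)
        qed
        show "span ((\<lambda>b. E b s) ` F) \<subseteq> (\<lambda>v. v \<kappa>) ` vert \<Upsilon> s"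
        proof (rule span_minimal[OF _ sub], rule image_subsetI)
          fix b assume b: "b \<in> F"
          show "E b s \<in> (\<lambda>v. v \<kappa>) ` vert \<Upsilon> s"
          proof (cases "b \<in> B1 \<or> s \<noteq> t")
            case True
            then have "E b s = inverse (\<sigma> b s) *\<^sub>R K b s \<kappa>" using KE[OF b, of s] by (auto simp: \<sigma>_def)
            moreover have "K b s \<kappa> \<in> (\<lambda>v. v \<kappa>) ` vert \<Upsilon> s" using vertI1[OF \<Upsilon> s K\<Upsilon>[OF b]] by (rule imageI)
            ultimately show ?thesis using subspace_scale[OF sub] by simp
          next
            case False
            then have "b \<in> B2" "s = t" using b by (auto simp: F_def)
            then have "E b s = cov (K b) s \<kappa>" using False by (simp add: E_def)
            moreover have "cov (K b) s \<in> vert \<Upsilon> s" using vertI2[OF \<Upsilon>(1)] K2 \<open>b \<in> B2\<close> \<open>s = t\<close> by blast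
            ultimately show ?thesis by blast
          qed
        qed
      qed
      then show "\<kappa> \<in> charts s \<and>
       (\<forall>b\<in>F. \<forall>b'\<in>F. gc \<kappa> s (e b s) (e b' s) = (if b = b' then 1 else 0)) \<and>
       (\<lambda>v. v \<kappa>) ` vert \<Upsilon> s = span ((\<lambda>b. e b s) ` F) \<and>
       (s \<noteq> t \<longrightarrow> (\<forall>a. (\<Sum>b\<in>F. a b *\<^sub>R K b s \<kappa>) = 0 \<longrightarrow> (\<forall>b\<in>F. a b = 0)))"
        using ks on sp ind by blast
    qed
  qed
  \<comment> \<open>Orthonormalisation fixes the frame at \<open>t\<close> but may change its
    derivative. Writing \<open>E b\<close> in the frame \<open>e\<close>, with coefficients that are
    0 or 1 at \<open>t\<close>, shows that the derivatives differ by a combination of frame vectors,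
    which a field perpendicular to the vertical space does not see.\<close>
  have dE: "\<exists>\<beta>. N b - \<Gamma>c \<kappa> t b = D b + (\<Sum>b'\<in>F. \<beta> b' *\<^sub>R b')"
    if b: "b \<in> F" and D: "\<And>b. b \<in> F \<Longrightarrow> (e b has_vector_derivative D b) (at t within I)" for b D
  proof -
    define co where "co b' s = gc \<kappa> s (E b s) (e b' s)" for b' s
    define \<beta> where "\<beta> b' = vector_derivative (co b') (at t within I)" for b'
    have "C1_at I t (co b')" if "b' \<in> F" for b'
      unfolding co_def
    proof (rule C1_at_bilinear_form[OF _ t gc_C1[OF t k] EC1[OF b] eC1[OF that]])
      show "\<forall>\<^sub>F s in nhds t. s \<in> I \<longrightarrow> bilinear (gc \<kappa> s)"
        using charts_near[OF t k] by eventually_elim (blast intro: gc_bilinear)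
    qed
    then have \<beta>: "(co b' has_vector_derivative \<beta> b') (at t within I)" if "b' \<in> F" for b'
      unfolding \<beta>_def by (rule vdC1) (rule that)
    have cot: "co b' t = (if b = b' then 1 else 0)" if "b' \<in> F" for b'
      using onF[OF b that] by (simp add: co_def Et[OF b] et[OF that])
    have "((\<lambda>s. \<Sum>b'\<in>F. co b' s *\<^sub>R e b' s) has_vector_derivative (\<Sum>b'\<in>F. co b' t *\<^sub>R D b'
        + \<beta> b' *\<^sub>R e b' t)) (at t within I)"
      by (intro has_vector_derivative_sum has_vector_derivative_scaleR D)
        (use \<beta> in \<open>simp_all add: has_real_derivative_iff_has_vector_derivative\<close>)
    moreover have "(\<Sum>b'\<in>F. co b' t *\<^sub>R D b' + \<beta> b' *\<^sub>R e b' t) = D b + (\<Sum>b'\<in>F. \<beta> b' *\<^sub>R b')"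
    proof -
      have "(\<Sum>b'\<in>F. co b' t *\<^sub>R D b') = (\<Sum>b'\<in>F. if b' = b then D b else 0)"
        by (rule sum.cong) (auto simp: cot)
      then have "(\<Sum>b'\<in>F. co b' t *\<^sub>R D b') = D b" using b finF by simp
      moreover have "(\<Sum>b'\<in>F. \<beta> b' *\<^sub>R e b' t) = (\<Sum>b'\<in>F. \<beta> b' *\<^sub>R b')"
        by (rule sum.cong) (simp_all add: et)
      ultimately show ?thesis by (simp add: sum.distrib)
    qed
    moreover have "\<forall>\<^sub>F s in nhds t. s \<in> I \<longrightarrow> (\<Sum>b'\<in>F. co b' s *\<^sub>R e b' s) = E b s"
      using ev charts_near[OF t k]
    proof eventually_elim
      case (elim s)
      show ?case
      proof
        assume s: "s \<in> I"
        have ks: "\<kappa> \<in> charts s" and on: "\<And>i j. i \<in> F \<Longrightarrow> j \<in> F \<Longrightarrow> gc \<kappa> s (e i s) (e j s) = (if i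
            = j then 1 else 0)"
          and sp: "span ((\<lambda>i. e i s) ` F) = span ((\<lambda>i. E i s) ` F)" using elim s by blast+
        have l: "linear (\<lambda>u. gc \<kappa> s u (e j s))" for j using gc_bilinear[OF ks] by (simp add: bilinear_def)
        have "E b s \<in> span ((\<lambda>i. e i s) ` F)" unfolding sp using b by (intro span_base) blast
        also have "span ((\<lambda>i. e i s) ` F) \<subseteq> {u. (\<Sum>b'\<in>F. gc \<kappa> s u (e b' s) *\<^sub>R e b' s) = u}"
        proof (rule span_minimal)
          show "subspace {u. (\<Sum>b'\<in>F. gc \<kappa> s u (e b' s) *\<^sub>R e b' s) = u}"
            unfolding subspace_def
            by (simp add: linear_0[OF l] linear_add[OF l] linear_scale[OF l] scaleR_left_distrib
              sum.distrib scaleR_sum_right[symmetric] scaleR_scaleR[symmetric] del: scaleR_scaleR)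
          show "(\<lambda>i. e i s) ` F \<subseteq> {u. (\<Sum>b'\<in>F. gc \<kappa> s u (e b' s) *\<^sub>R e b' s) = u}"
          proof (rule image_subsetI)
            fix i assume i: "i \<in> F"
            have "(\<Sum>b'\<in>F. gc \<kappa> s (e i s) (e b' s) *\<^sub>R e b' s) = (\<Sum>b'\<in>F. if b' = i then e i s else 0)"
              by (rule sum.cong) (auto simp: i on)
            then show "e i s \<in> {u. (\<Sum>b'\<in>F. gc \<kappa> s u (e b' s) *\<^sub>R e b' s) = u}" using i finF by simp
          qed
        qed
        finally have "E b s \<in> {u. (\<Sum>b'\<in>F. gc \<kappa> s u (e b' s) *\<^sub>R e b' s) = u}" .
        then show "(\<Sum>b'\<in>F. co b' s *\<^sub>R e b' s) = E b s" by (simp add: co_def)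
      qed
    qed
    ultimately have "(E b has_vector_derivative (D b + (\<Sum>b'\<in>F. \<beta> b' *\<^sub>R b'))) (at t within I)"
      using has_vector_derivative_within_cong_ev[where f = "\<lambda>s. \<Sum>b'\<in>F. co b' s *\<^sub>R e b' s"
        and g = "E b", OF _ t] by simp
    then have "N b - \<Gamma>c \<kappa> t b = D b + (\<Sum>b'\<in>F. \<beta> b' *\<^sub>R b')"
      using vd_eq[OF t Ed[OF b]] vd_eq[OF t, of "E b"] by simp
    then show ?thesis by (rule exI[where x = \<beta>])
  qed
  have adj: "\<exists>L\<in>\<Upsilon>. \<forall>b\<in>F. gc \<kappa> t ((J - L) t \<kappa>) (e b t) = 0 \<and>
       (\<forall>D. (e b has_vector_derivative D) (at t within I) \<longrightarrow>
         gc \<kappa> t (cov (J - L) t \<kappa>) (e b t) = gc \<kappa> t ((J - L) t \<kappa>) (D + \<Gamma>c \<kappa> t (e b t)))" if J: "J \<in> \<Lambda>" for J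
  proof -
    define S1 where "S1 = (\<Sum>b\<in>B1. gc \<kappa> t (J t \<kappa>) b *\<^sub>R K b)"
    have S1: "S1 \<in> \<Upsilon>" unfolding S1_def using K1 by (intro subspace_sum subspace_scale \<Upsilon>(1)) auto
    define J1 where "J1 = J - S1"
    have J1: "J1 \<in> \<Lambda>" unfolding J1_def by (rule subspace_diff[OF \<Lambda>_subspace J \<Upsilon>\<Lambda>[OF S1]])
    \<comment> \<open>\<open>S2\<close> vanishes at \<open>t\<close>, so it adjusts the derivative
      in the directions of \<open>B2\<close> and keeps the value arranged by
      \<open>S1\<close>.\<close>
    define S2 where "S2 = (\<Sum>b\<in>B2. gc \<kappa> t (cov J1 t \<kappa>) b *\<^sub>R K b)"
    have S2: "S2 \<in> \<Upsilon>" unfolding S2_def using K2 by (intro subspace_sum subspace_scale \<Upsilon>(1)) auto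
    define L where "L = S1 + S2"
    have L: "L \<in> \<Upsilon>" unfolding L_def by (rule subspace_add[OF \<Upsilon>(1) S1 S2])
    define H where "H = J - L"
    have H: "H \<in> \<Lambda>" unfolding H_def by (rule subspace_diff[OF \<Lambda>_subspace J \<Upsilon>\<Lambda>[OF L]])
    have HJ: "H = J1 - S2" unfolding H_def L_def J1_def by (simp only: diff_diff_eq)
    have l: "linear (\<lambda>u. gc \<kappa> t u b)" for b using G by (simp add: bilinear_def)
    have proj: "gc \<kappa> t (\<Sum>a\<in>B. gc \<kappa> t v a *\<^sub>R a) b = gc \<kappa> t v b"
      if "finite B" "\<And>a b. a \<in> B \<Longrightarrow> b \<in> B \<Longrightarrow> gc \<kappa> t a b = (if a = b then 1 else 0)" "b \<in> B" for B v b
    proof -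
      have "(\<Sum>a\<in>B. gc \<kappa> t v a * gc \<kappa> t a b) = (\<Sum>a\<in>B. if a = b then gc \<kappa> t v b else 0)"
        by (rule sum.cong) (auto simp: that)
      then show ?thesis using that by (simp add: linear_sum[OF l] linear_scale[OF l])
    qed
    have S2t: "S2 t \<kappa> = 0" unfolding S2_def sum_apply2 using K2 by simp
    have S1t: "S1 t \<kappa> = (\<Sum>a\<in>B1. gc \<kappa> t (J t \<kappa>) a *\<^sub>R a)" unfolding S1_def sum_apply2 using K1 by simp
    have Ht: "H t \<kappa> = J t \<kappa> - (\<Sum>a\<in>B1. gc \<kappa> t (J t \<kappa>) a *\<^sub>R a)"
      unfolding HJ J1_def using S1t S2t by simp
    have H1: "gc \<kappa> t (H t \<kappa>) b = 0" if "b \<in> B1" for b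
      unfolding Ht using proj[OF B1(1) B1(3) that] by (simp add: linear_diff[OF l])
    have H2: "gc \<kappa> t (H t \<kappa>) b = 0" if "b \<in> B2" for b
      using J2[OF H] that B2(2) by blast
    have HF: "gc \<kappa> t (H t \<kappa>) b = 0" if "b \<in> F" for b using that H1 H2 by (auto simp: F_def)
    have cS2: "cov S2 t \<kappa> = (\<Sum>b\<in>B2. gc \<kappa> t (cov J1 t \<kappa>) b *\<^sub>R b)"
      unfolding S2_def using K2 \<Upsilon>\<Lambda> by (subst cov_sum[OF B2(1) _ t]) auto
    have "cov H t = cov J1 t - cov S2 t" unfolding HJ by (rule cov_diff[OF J1 \<Upsilon>\<Lambda>[OF S2] t])
    then have cH: "cov H t \<kappa> = cov J1 t \<kappa> - (\<Sum>b\<in>B2. gc \<kappa> t (cov J1 t \<kappa>) b *\<^sub>R b)" by (simp add: cS2)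
    have c2: "gc \<kappa> t (cov H t \<kappa>) b = 0" if "b \<in> B2" for b
      unfolding cH using proj[OF B2(1) B2(3) that] by (simp add: linear_diff[OF l])
    \<comment> \<open>For a value of a field this is self-adjointness. For a divided difference both
      sides are 0, the left by the choice of \<open>S2\<close> and the right because
      \<open>N b = 0\<close>.\<close>
    have N: "gc \<kappa> t (cov H t \<kappa>) b = gc \<kappa> t (H t \<kappa>) (N b)" if b: "b \<in> F" for b
    proof (cases "b \<in> B1")
      case True
      then show ?thesis using \<Lambda>_symmetric[OF H K\<Lambda>[OF b] t k] K1[OF True] by (simp add: N_def)
    next
      case False
      then show ?thesis using c2 b bilinear_rzero[OF G] by (auto simp: N_def F_def)
    qed
    have "gc \<kappa> t (H t \<kappa>) (e b t) = 0 \<and> (\<forall>D. (e b has_vector_derivative D) (at t within I) \<longrightarrow>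
         gc \<kappa> t (cov H t \<kappa>) (e b t) = gc \<kappa> t (H t \<kappa>) (D + \<Gamma>c \<kappa> t (e b t)))" if b: "b \<in> F" for b
    proof (intro conjI allI impI)
      show "gc \<kappa> t (H t \<kappa>) (e b t) = 0" using HF[OF b] et[OF b] by simp
      fix D0 assume D0: "(e b has_vector_derivative D0) (at t within I)"
      define D where "D b = vector_derivative (e b) (at t within I)" for b
      have D: "(e b has_vector_derivative D b) (at t within I)" if "b \<in> F" for b
        unfolding D_def by (rule vdC1[OF eC1[OF that]])
      have DD: "D0 = D b" using vd_eq[OF t D0] vd_eq[OF t D[OF b]] by simp
      have "\<exists>\<beta>. N b - \<Gamma>c \<kappa> t b = D b + (\<Sum>b'\<in>F. \<beta> b' *\<^sub>R b')" by (rule dE[OF b D])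
      then obtain \<beta> where \<beta>: "N b - \<Gamma>c \<kappa> t b = D b + (\<Sum>b'\<in>F. \<beta> b' *\<^sub>R b')" by (elim exE)
      have lr: "linear (gc \<kappa> t (H t \<kappa>))" using G by (simp add: bilinear_def)
      have "D b + \<Gamma>c \<kappa> t (e b t) = N b - (\<Sum>b'\<in>F. \<beta> b' *\<^sub>R b')" using \<beta> et[OF b] by (simp add: algebra_simps)
      then have "gc \<kappa> t (H t \<kappa>) (D b + \<Gamma>c \<kappa> t (e b t)) = gc \<kappa> t (H t \<kappa>) (N b)"
        using HF by (simp add: linear_diff[OF lr] linear_sum[OF lr] linear_scale[OF lr])
      then show "gc \<kappa> t (cov H t \<kappa>) (e b t) = gc \<kappa> t (H t \<kappa>) (D0 + \<Gamma>c \<kappa> t (e b t))"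
        using N[OF b] et[OF b] DD by simp
    qed
    then show ?thesis unfolding H_def by (intro bexI[OF _ L] ballI)
  qed
  have "adapted \<kappa> t \<Upsilon> F K e"
    unfolding adapted_def
    by (intro conjI ballI finF ev'; (rule K\<Upsilon> span\<Upsilon> eC1 adj, assumption))
  then show ?thesis by (intro exI)
qed

end

text \<open>The difference quotient of the product is the difference quotient of \<open>f\<close>
  times \<open>p s\<close>, so continuity of \<open>p\<close> at \<open>t\<close> suffices. This
  gives the derivative at \<open>t\<close> of the terms containing \<open>perp_e1\<close>.\<close>

lemma has_vector_derivative_scaleR_vanishing:
  fixes f :: "real \<Rightarrow> real" and p :: "real \<Rightarrow> 'b::real_normed_vector"
  assumes f: "(f has_real_derivative f') (at t within S)" and f0: "f t = 0"
    and p: "(p \<longlongrightarrow> p t) (at t within S)"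
  shows "((\<lambda>s. f s *\<^sub>R p s) has_vector_derivative f' *\<^sub>R p t) (at t within S)"
proof -
  have "((\<lambda>s. (f s - f t) /\<^sub>R (s - t)) \<longlongrightarrow> f') (at t within S)"
    using f by (simp only: has_real_derivative_iff_has_vector_derivative has_vector_derivative_iff_tendsto)
  then have "((\<lambda>s. ((f s - f t) /\<^sub>R (s - t)) *\<^sub>R p s) \<longlongrightarrow> f' *\<^sub>R p t) (at t within S)"
    by (rule tendsto_scaleR[OF _ p])
  then show ?thesis by (simp add: has_vector_derivative_iff_tendsto f0)
qed

lemma bilinear_sum_left: "bilinear G \<Longrightarrow> G (\<Sum>i\<in>F. a i *\<^sub>R x i) y = (\<Sum>i\<in>F. a i *\<^sub>R G (x i) y)"
  for G :: "'a::real_vector \<Rightarrow> 'b::real_vector \<Rightarrow> 'c::real_vector"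
proof -
  assume "bilinear G"
  then have l: "linear (\<lambda>x. G x y)" by (simp add: bilinear_def)
  show ?thesis by (simp add: linear_sum[OF l] linear_scale[OF l])
qed

lemma bilinear_sum_right: "bilinear G \<Longrightarrow> G y (\<Sum>i\<in>F. a i *\<^sub>R x i) = (\<Sum>i\<in>F. a i *\<^sub>R G y (x i))"
  for G :: "'a::real_vector \<Rightarrow> 'b::real_vector \<Rightarrow> 'c::real_vector"
proof -
  assume "bilinear G"
  then have l: "linear (G y)" by (simp add: bilinear_def)
  show ?thesis by (simp add: linear_sum[OF l] linear_scale[OF l])
qed

context lagrangian
begin

section \<open>Isolation of singular parameters\<close>

text \<open>The adapted frame of \<open>\<Lambda>\<close> itself shows that evaluation at a nearby
  \<open>s \<noteq> t\<close> is injective on \<open>\<Lambda>\<close>. Since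
  \<open>dim \<Lambda> = DIM('e) - 1\<close>, the values together with the velocity leave no room
  for a further orthogonal vector, so they fill the normal space.\<close>

lemma nonsingular_near:
  assumes t: "t \<in> I"
  shows "\<forall>\<^sub>F s in at t within I. riccati_nonsingular \<A> g I c \<Lambda> s"
proof -
  obtain \<kappa> where k: "\<kappa> \<in> charts t" using chart_exists[OF t] .
  obtain F K e where ad: "adapted \<kappa> t \<Lambda> F K e"
    using adapted_frame_exists[OF t k \<Lambda>_subspace order_refl] by (elim exE)
  have F: "finite F" "\<And>b. b \<in> F \<Longrightarrow> K b \<in> \<Lambda>" "\<And>L. L \<in> \<Lambda> \<Longrightarrow> \<exists>a. L = (\<Sum>b\<in>F. a b *\<^sub>R K b)"
    and ev: "\<forall>\<^sub>F s in nhds t. s \<in> I \<longrightarrow> \<kappa> \<in> charts s \<and>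
       (\<forall>b\<in>F. \<forall>b'\<in>F. gc \<kappa> s (e b s) (e b' s) = (if b = b' then 1 else 0)) \<and>
       (\<lambda>v. v \<kappa>) ` vert \<Lambda> s = span ((\<lambda>b. e b s) ` F) \<and>
       (s \<noteq> t \<longrightarrow> (\<forall>a. (\<Sum>b\<in>F. a b *\<^sub>R K b s \<kappa>) = 0 \<longrightarrow> (\<forall>b\<in>F. a b = 0)))"
    using ad unfolding adapted_def by simp_all
  show ?thesis
    unfolding eventually_at_filter using ev
  proof eventually_elim
    case (elim s)
    show ?case
    proof (intro impI)
      assume st: "s \<noteq> t" and s: "s \<in> I"
      have ks: "\<kappa> \<in> charts s" and on: "\<And>b b'. b \<in> F \<Longrightarrow> b' \<in> F \<Longrightarrow> gc \<kappa> s (e b s) (e b' s) = (if b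
          = b' then 1 else 0)"
        and img: "(\<lambda>v. v \<kappa>) ` vert \<Lambda> s = span ((\<lambda>b. e b s) ` F)"
        and ind0: "\<forall>a. (\<Sum>b\<in>F. a b *\<^sub>R K b s \<kappa>) = 0 \<longrightarrow> (\<forall>b\<in>F. a b = 0)" using elim s st by blast+
      have ind: "a b = 0" if "(\<Sum>b\<in>F. a b *\<^sub>R K b) s \<kappa> = 0" "b \<in> F" for a b
        using ind0 that unfolding sum_apply2 by blast
      have zero: "L = 0" if L: "L \<in> \<Lambda>" "L s \<kappa> = 0" for L
      proof -
        obtain a where a: "L = (\<Sum>b\<in>F. a b *\<^sub>R K b)" using F(3)[OF L(1)] by (elim exE)
        have "a b = 0" if "b \<in> F" for b by (rule ind[OF _ that]) (use L(2) a in simp)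
        then show ?thesis unfolding a by (simp add: sum.neutral)
      qed
      have injK: "inj_on K F"
      proof (rule inj_onI, rule ccontr)
        fix b b' assume b: "b \<in> F" "b' \<in> F" "K b = K b'" "b \<noteq> b'"
        have "(\<Sum>x\<in>F. ((if x = b then 1 else 0) - (if x = b' then 1 else 0)) *\<^sub>R K x s \<kappa>)
           = (\<Sum>x\<in>F. (if x = b then K b s \<kappa> else 0) - (if x = b' then K b' s \<kappa> else 0))"
          by (rule sum.cong) auto
        also have "\<dots> = 0" using b F(1) by (simp add: sum_subtractf)
        finally have "\<forall>x\<in>F. (if x = b then 1 else 0) - (if x = b' then 1 else 0 :: real) = 0"
          using ind0[rule_format, of "\<lambda>x. (if x = b then 1 else 0) - (if x = b' then 1 else 0)"] by blast
        then show False using b by auto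
      qed
      have indK: "independent (K ` F)"
      proof (rule real_vector.independent_if_scalars_zero)
        show "finite (K ` F)" using F(1) by simp
        fix f x assume z: "(\<Sum>x\<in>K ` F. f x *\<^sub>R x) = 0" and "x \<in> K ` F"
        then obtain b where b: "b \<in> F" "x = K b" by blast
        have "(\<Sum>b\<in>F. f (K b) *\<^sub>R K b) = 0" using z by (simp add: sum.reindex[OF injK])
        then have "(\<Sum>b\<in>F. f (K b) *\<^sub>R K b) s \<kappa> = 0" by (simp add: zero_fun_def)
        then show "f x = 0" using ind[of "\<lambda>b. f (K b)" b] b by blast
      qed
      have spanK: "span (K ` F) = span \<Lambda>"
      proof (rule antisym)
        show "span (K ` F) \<subseteq> span \<Lambda>" using F(2) by (intro span_mono) blast
        have "\<Lambda> \<subseteq> span (K ` F)"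
        proof
          fix L assume "L \<in> \<Lambda>"
          then obtain a where a: "L = (\<Sum>b\<in>F. a b *\<^sub>R K b)" using F(3) by blast
          show "L \<in> span (K ` F)" unfolding a by (intro span_sum span_scale span_base imageI)
        qed
        then show "span \<Lambda> \<subseteq> span (K ` F)" by (intro span_minimal subspace_span)
      qed
      have "dim \<Lambda> = card (K ` F)" by (rule real_vector.dim_eq_card[OF spanK indK])
      then have cardF: "card F = DIM('e) - 1" using \<Lambda>_dim injK by (simp add: card_image)
      have vertL: "\<exists>L\<in>\<Lambda>. v = L s" if "v \<in> vert \<Lambda> s" for v
      proof -
        obtain J1 J2 where J: "v = J1 s + cov J2 s" "J1 \<in> \<Lambda>" "J2 \<in> \<Lambda>" "J2 s = 0"
          using \<open>v \<in> vert \<Lambda> s\<close> unfolding vertical_space_def by blast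
        have "J2 = 0" by (rule zero[OF J(3)]) (simp add: J(4))
        then have "v = J1 s" using J(1) cov_zero[OF s] by simp
        then show ?thesis using J(2) by blast
      qed
      have perpv: "gc \<kappa> s (e b s) (vel s \<kappa>) = 0" if b: "b \<in> F" for b
      proof -
        have "e b s \<in> (\<lambda>v. v \<kappa>) ` vert \<Lambda> s" unfolding img using b by (intro span_base) blast
        then obtain v where v: "e b s = v \<kappa>" "v \<in> vert \<Lambda> s" by blast
        then obtain L where L: "L \<in> \<Lambda>" "v = L s" using vertL by blast
        have "L s \<in> normal_space \<A> g I c s" using \<Lambda>_normal L(1) s by (simp add: normal_jacobi_field_def)
        then have "g (c s) (L s) (vel s) = 0" by (simp add: normal_space_def)
        then show ?thesis using metric_eq_gc[OF ks \<Lambda>_tangent[OF L(1) s] vel_tangent[OF s]] v L by simp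
      qed
      have vel0: "vel s \<kappa> \<noteq> 0"
        using vel_nonzero[OF s] tangent_eqI[OF vel_tangent[OF s] tangent_zero ks] by auto
      have surj: "\<exists>L\<in>\<Lambda>. v = L s" if v: "v \<in> normal_space \<A> g I c s" for v
      proof -
        have vT: "v \<in> TM s" and vv: "g (c s) v (vel s) = 0" using v by (auto simp: normal_space_def)
        define r where "r = v \<kappa> - (\<Sum>b\<in>F. gc \<kappa> s (v \<kappa>) (e b s) *\<^sub>R e b s)"
        note B = gc_bilinear[OF ks] and S = gc_sym[OF ks] and P = gc_pos[OF ks]
        have re: "gc \<kappa> s r (e b s) = 0" if "b \<in> F" for b
        proof -
          have "(\<Sum>a\<in>F. gc \<kappa> s (v \<kappa>) (e a s) *\<^sub>R gc \<kappa> s (e a s) (e b s)) = (\<Sum>a\<in>F. if a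
              = b then gc \<kappa> s (v \<kappa>) (e b s) else 0)"
            by (rule sum.cong) (auto simp: on that)
          then show ?thesis using that F(1) by (simp add: r_def bilinear_lsub[OF B] bilinear_sum_left[OF B])
        qed
        have rv: "gc \<kappa> s r (vel s \<kappa>) = 0"
          using vv metric_eq_gc[OF ks vT vel_tangent[OF s]] perpv
          by (simp add: r_def bilinear_lsub[OF B] bilinear_sum_left[OF B])
        have perpv': "gc \<kappa> s (vel s \<kappa>) (e b s) = 0" and re': "gc \<kappa> s (e b s) r = 0" if "b \<in> F" for b
          using perpv[OF that] re[OF that] S[of "vel s \<kappa>" "e b s"] S[of r "e b s"] by simp_all
        have rv': "gc \<kappa> s (vel s \<kappa>) r = 0" using rv S[of r "vel s \<kappa>"] by simp
        have "r = 0"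
        proof (rule ccontr)
          assume r0: "r \<noteq> 0"
          \<comment> \<open>\<open>Inl\<close> marks frame vectors, \<open>Inr True\<close> the
            velocity and \<open>Inr False\<close> the remainder. With a nonzero remainder these
            would be \<open>card F + 2\<close>, that is \<open>DIM('e) + 1\<close>, nonzero
            orthogonal vectors.\<close>
          define w where "w i = (case i of Inl b \<Rightarrow> e b s | Inr x \<Rightarrow> if x then vel s \<kappa> else r)"
            for i :: "'e + bool"
          have "card (F <+> (UNIV :: bool set)) \<le> DIM('e)"
          proof (rule orthogonal_family_card(3)[OF B, where b = w])
            show "finite (F <+> (UNIV :: bool set))" using F(1) by simp
            show "gc \<kappa> s (w i) (w i) > 0" if "i \<in> F <+> UNIV" for i
              using that on P[OF vel0] P[OF r0] by (auto simp: w_def split: sum.splits)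
            show "gc \<kappa> s (w i) (w j) = 0" if "i \<in> F <+> UNIV" "j \<in> F <+> UNIV" "i \<noteq> j" for i j
              using that on perpv re rv perpv' re' rv' by (auto simp: w_def split: sum.splits)
          qed
          moreover have "card (F <+> (UNIV :: bool set)) = card F + 2"
            using F(1) by (simp add: card_Plus)
          ultimately show False using cardF DIM_positive[where 'a = 'e] by simp
        qed
        then have "v \<kappa> = (\<Sum>b\<in>F. gc \<kappa> s (v \<kappa>) (e b s) *\<^sub>R e b s)" by (simp add: r_def)
        also have "\<dots> \<in> span ((\<lambda>b. e b s) ` F)" by (intro span_sum span_scale span_base imageI)
        finally have "v \<kappa> \<in> (\<lambda>v. v \<kappa>) ` vert \<Lambda> s" by (simp add: img)
        then obtain u where u: "v \<kappa> = u \<kappa>" "u \<in> vert \<Lambda> s" by blast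
        have "v = u" by (rule tangent_eqI[OF vT vert_tangent[OF order_refl s u(2)] ks u(1)])
        then show ?thesis using vertL[OF u(2)] by simp
      qed
      show "riccati_nonsingular \<A> g I c \<Lambda> s"
        unfolding riccati_nonsingular_def bij_betw_def
      proof
        show "inj_on (\<lambda>J. J s) \<Lambda>"
        proof (rule inj_onI)
          fix K L assume KL: "K \<in> \<Lambda>" "L \<in> \<Lambda>" "K s = L s"
          have "K - L = 0" by (rule zero[OF subspace_diff[OF \<Lambda>_subspace KL(1,2)]]) (simp add: KL(3))
          then show "K = L" by (rule eq_iff_diff_eq_0[THEN iffD2])
        qed
        show "(\<lambda>J. J s) ` \<Lambda> = normal_space \<A> g I c s"
          using surj \<Lambda>_normal s by (auto simp: normal_jacobi_field_def)
      qed
    qed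
  qed
qed

section \<open>The tensor at non-singular parameters and the projection\<close>

text \<open>At a non-singular parameter a field in \<open>\<Upsilon>\<close> vanishing at
  \<open>s\<close> is 0, so the derivative summand of the vertical space is trivial and every
  vertical vector is the value of exactly one field. This makes the description in
  \<open>A_regular\<close> meaningful.\<close>

lemma A_regular_eq:
  assumes ns: "riccati_nonsingular \<A> g I c \<Lambda> s" and s: "s \<in> I" and \<Upsilon>: "subspace \<Upsilon>" "\<Upsilon> \<subseteq> \<Lambda>" and v: "v \<in> vert \<Upsilon> s"
  obtains L where "L \<in> \<Upsilon>" "L s = v" "A_regular \<A> g I c \<Upsilon> s v = perp \<A> g I c \<Upsilon> s (cov L s)"
proof -
  have inj: "K = L" if "K \<in> \<Upsilon>" "L \<in> \<Upsilon>" "K s = L s" for K L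
    using ns that \<Upsilon>(2) unfolding riccati_nonsingular_def bij_betw_def inj_on_def by blast
  obtain J1 J2 where J: "v = J1 s + cov J2 s" "J1 \<in> \<Upsilon>" "J2 \<in> \<Upsilon>" "J2 s = 0"
    using v unfolding vertical_space_def by blast
  have "J2 = 0" by (rule inj[OF J(3) subspace_0[OF \<Upsilon>(1)]]) (simp add: J(4) zero_fun_def)
  then have v: "J1 s = v" using J(1) cov_zero[OF s] by simp
  have "(THE J. J \<in> \<Upsilon> \<and> J s = v) = J1"
    by (rule the_equality) (use J(2) v inj in auto)
  then show ?thesis using that[OF J(2) v] by (simp add: A_regular_def)
qed

text \<open>Subtracting the frame components gives a candidate for the perpendicular part; two
  candidates differ by a vector that is vertical and perpendicular to itself, hence 0.\<close>

lemma perp_apply: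
  fixes w :: "'i \<Rightarrow> 'e"
  assumes s: "s \<in> I" and k: "\<kappa> \<in> charts s" and \<Upsilon>: "subspace \<Upsilon>" "\<Upsilon> \<subseteq> \<Lambda>" and F: "finite F"
    and on: "\<And>b b'. b \<in> F \<Longrightarrow> b' \<in> F \<Longrightarrow> gc \<kappa> s (w b) (w b') = (if b = b' then 1 else 0)"
    and img: "(\<lambda>v. v \<kappa>) ` vert \<Upsilon> s = span (w ` F)" and v: "v \<in> TM s"
  shows "perp \<A> g I c \<Upsilon> s v \<in> TM s"
    and "perp \<A> g I c \<Upsilon> s v \<kappa> = v \<kappa> - (\<Sum>b\<in>F. gc \<kappa> s (v \<kappa>) (w b) *\<^sub>R w b)"
proof -
  note B = gc_bilinear[OF k]
  define p where "p = coord_tvec \<A> \<kappa> (c s) (v \<kappa> - (\<Sum>b\<in>F. gc \<kappa> s (v \<kappa>) (w b) *\<^sub>R w b))"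
  have pT: "p \<in> TM s" unfolding p_def by (rule coord_tvec_tangent[OF k])
  have pk: "p \<kappa> = v \<kappa> - (\<Sum>b\<in>F. gc \<kappa> s (v \<kappa>) (w b) *\<^sub>R w b)" unfolding p_def by (rule coord_tvec_apply[OF k])
  have pw: "gc \<kappa> s (p \<kappa>) (w b) = 0" if "b \<in> F" for b
  proof -
    have "(\<Sum>a\<in>F. gc \<kappa> s (v \<kappa>) (w a) *\<^sub>R gc \<kappa> s (w a) (w b)) = (\<Sum>a\<in>F. if a = b then gc \<kappa> s (v \<kappa>) (w b) else 0)"
      by (rule sum.cong) (auto simp: on that)
    then show ?thesis using that F by (simp add: pk bilinear_lsub[OF B] bilinear_sum_left[OF B])
  qed
  have pspan: "gc \<kappa> s (p \<kappa>) x = 0" if "x \<in> span (w ` F)" for x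
  proof -
    have "span (w ` F) \<subseteq> {x. gc \<kappa> s (p \<kappa>) x = 0}"
      by (rule span_minimal) (use pw in \<open>auto simp: subspace_def bilinear_rzero[OF B] bilinear_radd[OF
        B] bilinear_rmul[OF B]\<close>)
    then show ?thesis using that by blast
  qed
  have pp: "p \<in> perp_space \<A> g I c \<Upsilon> s"
    unfolding perp_space_def
  proof (intro CollectI conjI ballI pT)
    fix u assume u: "u \<in> vert \<Upsilon> s"
    then have "u \<kappa> \<in> span (w ` F)" unfolding img[symmetric] by (rule imageI)
    then show "g (c s) p u = 0" using pspan metric_eq_gc[OF k pT vert_tangent[OF \<Upsilon>(2) s u]] by simp
  qed
  have pv: "v - p \<in> vert \<Upsilon> s"
  proof -
    have "(v - p) \<kappa> = (\<Sum>b\<in>F. gc \<kappa> s (v \<kappa>) (w b) *\<^sub>R w b)" by (simp add: pk)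
    also have "\<dots> \<in> span (w ` F)" by (intro span_sum span_scale span_base imageI)
    finally have "(v - p) \<kappa> \<in> (\<lambda>v. v \<kappa>) ` vert \<Upsilon> s" by (simp only: img)
    then obtain u where u: "(v - p) \<kappa> = u \<kappa>" "u \<in> vert \<Upsilon> s" by blast
    have "v - p = u" by (rule tangent_eqI[OF tangent_diff[OF v pT] vert_tangent[OF \<Upsilon>(2) s u(2)] k u(1)])
    then show ?thesis using u(2) by simp
  qed
  have "perp \<A> g I c \<Upsilon> s v = p"
    unfolding perp_def
  proof (rule the_equality)
    show "p \<in> perp_space \<A> g I c \<Upsilon> s \<and> v - p \<in> vert \<Upsilon> s" using pp pv by blast
    fix q assume q: "q \<in> perp_space \<A> g I c \<Upsilon> s \<and> v - q \<in> vert \<Upsilon> s"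
    have qT: "q \<in> TM s" using q by (simp add: perp_space_def)
    have "(v - q) - (v - p) \<in> vert \<Upsilon> s" using subspace_diff[OF vert_subspace[OF \<Upsilon> s]] q pv by blast
    then have d: "p - q \<in> vert \<Upsilon> s" by simp
    have "g (c s) p (p - q) = 0" "g (c s) q (p - q) = 0" using pp q d by (auto simp: perp_space_def)
    then have "gc \<kappa> s (p \<kappa>) ((p - q) \<kappa>) = 0" "gc \<kappa> s (q \<kappa>) ((p - q) \<kappa>) = 0"
      using metric_eq_gc[OF k _ tangent_diff[OF pT qT]] pT qT by simp_all
    then have "gc \<kappa> s ((p - q) \<kappa>) ((p - q) \<kappa>) = 0" by (simp add: bilinear_lsub[OF B])
    then have "(p - q) \<kappa> = 0" using gc_pos[OF k, of "(p - q) \<kappa>"] by force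
    then have "q \<kappa> = p \<kappa>" by simp
    then show "q = p" by (rule tangent_eqI[OF qT pT k])
  qed
  then show "perp \<A> g I c \<Upsilon> s v \<in> TM s" "perp \<A> g I c \<Upsilon> s v \<kappa> = v \<kappa> - (\<Sum>b\<in>F. gc \<kappa> s (v \<kappa>) (w b) *\<^sub>R w b)"
    using pT pk by simp_all
qed

end

section \<open>The tensor A in an adapted frame\<close>

locale framed = lagrangian \<A> g I c \<Lambda>
  for \<A> :: "('m::{t2_space,second_countable_topology}, 'e::euclidean_space) chart set"
    and g :: "('m, 'e) metric" and I :: "real set" and c :: "real \<Rightarrow> 'm"
    and \<Lambda> :: "(real \<Rightarrow> ('m, 'e) tvec) set" +
  fixes \<Upsilon> :: "(real \<Rightarrow> ('m, 'e) tvec) set" and t :: real and \<kappa> :: "('m, 'e) chart"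
    and F :: "'e set" and K :: "'e \<Rightarrow> real \<Rightarrow> ('m, 'e) tvec" and e :: "'e \<Rightarrow> real \<Rightarrow> 'e"
  assumes \<Upsilon>: "subspace \<Upsilon>" "\<Upsilon> \<subseteq> \<Lambda>" and t: "t \<in> I" and k: "\<kappa> \<in> charts t"
    and ad: "adapted \<kappa> t \<Upsilon> F K e"
begin

lemma finF: "finite F"
  using ad unfolding adapted_def by simp

lemma e_C1: "b \<in> F \<Longrightarrow> C1_at I t (e b)"
  using ad unfolding adapted_def by simp

text \<open>\<open>Y\<close> and its perpendicular derivative have to be known on a neighbourhood of
  \<open>t\<close> before they can be differentiated at \<open>t\<close>, so the frame identities
  are collected for nearby parameters. Continuity of the frame derivative stays apart, being known
  at \<open>t\<close> alone.\<close>

definition good :: "real \<Rightarrow> bool" where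
  "good s \<longleftrightarrow> s \<in> I \<and> \<kappa> \<in> charts s \<and>
     (\<forall>b\<in>F. \<forall>b'\<in>F. gc \<kappa> s (e b s) (e b' s) = (if b = b' then 1 else 0)) \<and>
     (\<lambda>v. v \<kappa>) ` vert \<Upsilon> s = span ((\<lambda>b. e b s) ` F) \<and>
     (\<forall>b\<in>F. e b differentiable (at s within I))"

definition e1 :: "'e \<Rightarrow> real \<Rightarrow> 'e" where
  "e1 b s = vector_derivative (e b) (at s within I)"

definition proj :: "real \<Rightarrow> 'e \<Rightarrow> 'e" where
  "proj s a = a - (\<Sum>b\<in>F. gc \<kappa> s a (e b s) *\<^sub>R e b s)"

text \<open>The fields \<open>p_b\<close> of the overview, in coordinates. Since \<open>e\<close> is
  C1 at \<open>t\<close>, they are continuous at \<open>t\<close>.\<close>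

definition perp_e1 :: "'e \<Rightarrow> real \<Rightarrow> 'e" where
  "perp_e1 b s = proj s (e1 b s + \<Gamma>c \<kappa> s (e b s))"

lemma ev_good: "\<forall>\<^sub>F s in nhds t. s \<in> I \<longrightarrow> good s"
proof -
  have "\<forall>\<^sub>F s in nhds t. \<forall>b\<in>F. s \<in> I \<longrightarrow> e b differentiable (at s within I)"
    using finF C1_at_eventually_differentiable[OF e_C1] by (intro eventually_ball_finite) auto
  moreover have "\<forall>\<^sub>F s in nhds t. s \<in> I \<longrightarrow> \<kappa> \<in> charts s \<and>
       (\<forall>b\<in>F. \<forall>b'\<in>F. gc \<kappa> s (e b s) (e b' s) = (if b = b' then 1 else 0)) \<and>
       (\<lambda>v. v \<kappa>) ` vert \<Upsilon> s = span ((\<lambda>b. e b s) ` F) \<and>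
       (s \<noteq> t \<longrightarrow> (\<forall>a. (\<Sum>b\<in>F. a b *\<^sub>R K b s \<kappa>) = 0 \<longrightarrow> (\<forall>b\<in>F. a b = 0)))"
    using ad unfolding adapted_def by simp
  ultimately show ?thesis
    by eventually_elim (simp add: good_def)
qed

lemma good_t: "good t"
  using eventually_nhds_x_imp_x[OF ev_good] t by simp

text \<open>A derivative at a nearby parameter \<open>s\<close> requires the frame identities in a
  whole neighbourhood of \<open>s\<close>, whence the nested form.\<close>

lemma ev_good_good: "\<forall>\<^sub>F s in nhds t. s \<in> I \<longrightarrow> good s \<and> (\<forall>\<^sub>F r in nhds s. r \<in> I \<longrightarrow> good r)"
  using ev_good eventually_eventually[THEN iffD2, OF ev_good] by eventually_elim simp

lemma
  assumes "good s"
  shows good_I: "s \<in> I" and good_chart: "\<kappa> \<in> charts s"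
    and good_on: "\<And>b b'. b \<in> F \<Longrightarrow> b' \<in> F \<Longrightarrow> gc \<kappa> s (e b s) (e b' s) = (if b = b' then 1 else 0)"
    and good_img: "(\<lambda>v. v \<kappa>) ` vert \<Upsilon> s = span ((\<lambda>b. e b s) ` F)"
    and good_vd: "\<And>b. b \<in> F \<Longrightarrow> (e b has_vector_derivative e1 b s) (at s within I)"
  using assms unfolding good_def e1_def by (simp_all add: vector_derivative_works)

section \<open>Projection in the frame\<close>

lemma proj_linear:
  assumes "good s"
  shows "linear (proj s)"
proof -
  have l: "linear (\<lambda>a. gc \<kappa> s a (e b s))" for b
    using gc_bilinear[OF good_chart[OF assms]] by (simp add: bilinear_def)
  show ?thesis
    unfolding proj_def
    by (rule linearI) (simp_all add: linear_add[OF l] linear_scale[OF l] scaleR_left_distrib sum.distrib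
      scaleR_diff_right scaleR_sum_right)
qed

lemma frame_sum:
  assumes "good s" "b \<in> F"
  shows "(\<Sum>a\<in>F. x a *\<^sub>R gc \<kappa> s (e a s) (e b s)) = x b"
proof -
  have "(\<Sum>a\<in>F. x a *\<^sub>R gc \<kappa> s (e a s) (e b s)) = (\<Sum>a\<in>F. if a = b then x b else 0)"
    by (rule sum.cong) (auto simp: good_on[OF assms(1)] assms(2))
  then show ?thesis using assms(2) finF by simp
qed

lemma proj_orth:
  assumes s: "good s" and "b \<in> F"
  shows "gc \<kappa> s (proj s a) (e b s) = 0"
  using frame_sum[OF assms, of "\<lambda>b. gc \<kappa> s a (e b s)"]
  by (simp add: proj_def bilinear_lsub[OF gc_bilinear[OF good_chart[OF s]]] bilinear_sum_left[OF
    gc_bilinear[OF good_chart[OF s]]])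

lemma proj_frame:
  assumes s: "good s" and b: "b \<in> F"
  shows "proj s (e b s) = 0"
proof -
  have "(\<Sum>a\<in>F. gc \<kappa> s (e b s) (e a s) *\<^sub>R e a s) = (\<Sum>a\<in>F. if a = b then e b s else 0)"
    by (rule sum.cong) (auto simp: good_on[OF s] b)
  then show ?thesis using b finF by (simp add: proj_def)
qed

lemma proj_fix:
  assumes "\<And>b. b \<in> F \<Longrightarrow> gc \<kappa> s a (e b s) = 0"
  shows "proj s a = a"
  using assms by (simp add: proj_def)

lemma proj_perp_e1: "good s \<Longrightarrow> proj s (perp_e1 b s) = perp_e1 b s"
  by (rule proj_fix) (simp add: perp_e1_def proj_orth)

lemma perp_good:
  assumes s: "good s" and v: "v \<in> TM s"
  shows "perp \<A> g I c \<Upsilon> s v \<in> TM s" and "perp \<A> g I c \<Upsilon> s v \<kappa> = proj s (v \<kappa>)"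
  unfolding proj_def
  by (rule perp_apply[OF good_I[OF s] good_chart[OF s] \<Upsilon> finF good_on[OF s] good_img[OF s] v]; assumption)+

lemma vert_component:
  assumes s: "good s" and v: "v \<in> vert \<Upsilon> s"
  shows "v \<kappa> = (\<Sum>b\<in>F. gc \<kappa> s (v \<kappa>) (e b s) *\<^sub>R e b s)"
proof -
  have "v \<kappa> \<in> span ((\<lambda>b. e b s) ` F)" using imageI[OF v, of "\<lambda>v. v \<kappa>"] good_img[OF s] by simp
  moreover have "span ((\<lambda>b. e b s) ` F) \<subseteq> {a. proj s a = 0}"
  proof (rule span_minimal)
    show "subspace {a. proj s a = 0}" by (rule linear_subspace_kernel[OF proj_linear[OF s]])
    show "(\<lambda>b. e b s) ` F \<subseteq> {a. proj s a = 0}" using proj_frame[OF s] by blast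
  qed
  ultimately have "proj s (v \<kappa>) = 0" by blast
  then show ?thesis by (simp add: proj_def)
qed

lemma vert_proj: "good s \<Longrightarrow> v \<in> vert \<Upsilon> s \<Longrightarrow> proj s (v \<kappa>) = 0"
  using vert_component by (simp add: proj_def)

lemma frame_vert:
  assumes s: "good s"
  shows "coord_tvec \<A> \<kappa> (c s) (\<Sum>b\<in>F. x b *\<^sub>R e b s) \<in> vert \<Upsilon> s"
proof -
  have "(\<Sum>b\<in>F. x b *\<^sub>R e b s) \<in> (\<lambda>v. v \<kappa>) ` vert \<Upsilon> s"
    unfolding good_img[OF s] by (intro span_sum span_scale span_base imageI)
  then obtain v where v: "(\<Sum>b\<in>F. x b *\<^sub>R e b s) = v \<kappa>" "v \<in> vert \<Upsilon> s" by blast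
  show ?thesis
    using v coord_tvec_of_component[OF vert_tangent[OF \<Upsilon>(2) good_I[OF s] v(2)] good_chart[OF s]] by simp
qed

section \<open>The frame formula for the tensor near the parameter\<close>

lemma coefficient_has_vd:
  assumes s: "good s" and H: "H \<in> \<Lambda>" and b: "b \<in> F"
  shows "((\<lambda>r. gc \<kappa> r (H r \<kappa>) (e b r)) has_real_derivative
    gc \<kappa> s (cov H s \<kappa>) (e b s) + gc \<kappa> s (H s \<kappa>) (e1 b s + \<Gamma>c \<kappa> s (e b s))) (at s within I)"
  using gc_has_derivative[OF good_I[OF s] good_chart[OF s] jacobi_has_vd(1)[OF \<Lambda>_jacobi[OF H] good_I[OF
    s] good_chart[OF s]] good_vd[OF s b]]
  by simp

text \<open>A field in \<open>\<Upsilon>\<close> stays vertical, so near \<open>s\<close> it is the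
  sum of \<open>f b\<close> times \<open>e b\<close>. Differentiating and projecting kills the terms
  with derivatives of \<open>f b\<close>. The resulting formula involves the field only through its
  value \<open>v\<close> and makes sense at singular parameters too, where it provides the
  continuous extension.\<close>

lemma A_regular_good:
  assumes s: "good s" and near: "\<forall>\<^sub>F r in nhds s. r \<in> I \<longrightarrow> good r"
    and ns: "riccati_nonsingular \<A> g I c \<Lambda> s" and v: "v \<in> vert \<Upsilon> s"
  shows "A_regular \<A> g I c \<Upsilon> s v \<in> TM s"
    and "A_regular \<A> g I c \<Upsilon> s v \<kappa> = (\<Sum>b\<in>F. gc \<kappa> s (v \<kappa>) (e b s) *\<^sub>R perp_e1 b s)"
proof -
  note sI = good_I[OF s] and ks = good_chart[OF s]
  obtain L where L: "L \<in> \<Upsilon>" "L s = v" and A: "A_regular \<A> g I c \<Upsilon> s v = perp \<A> g I c \<Upsilon> s (cov L s)"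
    using A_regular_eq[OF ns sI \<Upsilon> v] by blast
  have L\<Lambda>: "L \<in> \<Lambda>" using L(1) \<Upsilon>(2) by blast
  have cT: "cov L s \<in> TM s" by (rule \<Lambda>_cov_tangent[OF L\<Lambda> sI])
  show "A_regular \<A> g I c \<Upsilon> s v \<in> TM s" unfolding A by (rule perp_good(1)[OF s cT])
  define f where "f b r = gc \<kappa> r (L r \<kappa>) (e b r)" for b r
  define f' where "f' b = gc \<kappa> s (cov L s \<kappa>) (e b s) + gc \<kappa> s (L s \<kappa>) (e1 b s + \<Gamma>c \<kappa> s (e b s))" for b
  have "((\<lambda>r. \<Sum>b\<in>F. f b r *\<^sub>R e b r) has_vector_derivative (\<Sum>b\<in>F. f b s *\<^sub>R e1 b s + f' b *\<^sub>R e b s))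
      (at s within I)"
    unfolding f_def f'_def
    by (intro has_vector_derivative_sum has_vector_derivative_scaleR coefficient_has_vd[OF s L\<Lambda>] good_vd[OF s])
  moreover have "\<forall>\<^sub>F r in nhds s. r \<in> I \<longrightarrow> (\<Sum>b\<in>F. f b r *\<^sub>R e b r) = L r \<kappa>"
    using near
  proof eventually_elim
    case (elim r)
    show ?case
    proof
      assume r: "r \<in> I"
      then have "good r" using elim by simp
      from vert_component[OF this vertI1[OF \<Upsilon> r L(1)]] show "(\<Sum>b\<in>F. f b r *\<^sub>R e b r) = L r \<kappa>"
        unfolding f_def by (rule sym)
    qed
  qed
  ultimately have "((\<lambda>r. L r \<kappa>) has_vector_derivative (\<Sum>b\<in>F. f b s *\<^sub>R e1 b s + f' b *\<^sub>R e b s))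
      (at s within I)"
    using has_vector_derivative_within_cong_ev[where f = "\<lambda>r. \<Sum>b\<in>F. f b r *\<^sub>R e b r"
      and g = "\<lambda>r. L r \<kappa>", OF _ sI] by simp
  from cov_apply[where X = L, OF sI ks this]
  have "cov L s \<kappa> = (\<Sum>b\<in>F. f b s *\<^sub>R e1 b s + f' b *\<^sub>R e b s) + \<Gamma>c \<kappa> s (\<Sum>b\<in>F. f b s *\<^sub>R e b s)"
    using vert_component[OF s v] L(2) by (simp add: f_def)
  also have "\<dots> = (\<Sum>b\<in>F. f b s *\<^sub>R (e1 b s + \<Gamma>c \<kappa> s (e b s))) + (\<Sum>b\<in>F. f' b *\<^sub>R e b s)"
    by (simp add: linear_sum[OF \<Gamma>c_linear[OF ks]] linear_scale[OF \<Gamma>c_linear[OF ks]] sum.distrib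
      scaleR_right_distrib)
  finally have c: "cov L s \<kappa> = (\<Sum>b\<in>F. f b s *\<^sub>R (e1 b s + \<Gamma>c \<kappa> s (e b s))) + (\<Sum>b\<in>F. f' b *\<^sub>R e b s)" .
  note l = proj_linear[OF s]
  have "proj s (cov L s \<kappa>) = (\<Sum>b\<in>F. f b s *\<^sub>R perp_e1 b s)"
    unfolding c linear_add[OF l] linear_sum[OF l] linear_scale[OF l] perp_e1_def[symmetric]
    using proj_frame[OF s] by simp
  then show "A_regular \<A> g I c \<Upsilon> s v \<kappa> = (\<Sum>b\<in>F. gc \<kappa> s (v \<kappa>) (e b s) *\<^sub>R perp_e1 b s)"
    unfolding A perp_good(2)[OF s cT] f_def L(2) .
qed

lemma gc_tendsto:
  assumes "(V \<longlongrightarrow> V0) (at t within I)" "(W \<longlongrightarrow> W0) (at t within I)"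
  shows "((\<lambda>s. gc \<kappa> s (V s) (W s)) \<longlongrightarrow> gc \<kappa> t V0 W0) (at t within I)"
proof (rule bilinear_family_tendsto[where H = "gc \<kappa>" and ?H0.0 = "gc \<kappa> t", OF _ gc_bilinear[OF k] _ assms])
  show "\<forall>\<^sub>F s in at t within I. bilinear (gc \<kappa> s)"
    using charts_near_within[OF t k] by eventually_elim (rule gc_bilinear)
  show "((\<lambda>s. gc \<kappa> s a b) \<longlongrightarrow> gc \<kappa> t a b) (at t within I)" for a b
    using C1_at_continuous[OF gc_C1[OF t k] t] by (simp add: continuous_within)
qed

lemma e_tendsto: "b \<in> F \<Longrightarrow> (e b \<longlongrightarrow> e b t) (at t within I)"
  using C1_at_continuous[OF e_C1 t] by (simp add: continuous_within)

lemma e1_tendsto: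
  assumes "b \<in> F"
  shows "(e1 b \<longlongrightarrow> e1 b t) (at t within I)"
proof -
  obtain X' where X': "\<forall>\<^sub>F s in nhds t. s \<in> I \<longrightarrow> (e b has_vector_derivative X' s) (at s within I)"
    "continuous (at t within I) X'" by (rule C1_at_deriv_ev[OF e_C1[OF assms]])
  have eq: "\<forall>\<^sub>F s in nhds t. s \<in> I \<longrightarrow> X' s = e1 b s"
    using X'(1)
  proof eventually_elim
    case (elim s)
    then show ?case using vd_eq[of s "e b" "X' s"] by (auto simp: e1_def)
  qed
  then have "X' t = e1 b t" using eventually_nhds_x_imp_x t by blast
  then have "(X' \<longlongrightarrow> e1 b t) (at t within I)" using X'(2) by (simp add: continuous_within)
  moreover have "\<forall>\<^sub>F s in at t within I. X' s = e1 b s"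
    using eq unfolding eventually_at_filter by eventually_elim simp
  ultimately show ?thesis by (rule Lim_transform_eventually)
qed

lemma perp_e1_tendsto:
  assumes b: "b \<in> F"
  shows "(perp_e1 b \<longlongrightarrow> perp_e1 b t) (at t within I)"
  unfolding perp_e1_def proj_def
  by (intro tendsto_diff tendsto_sum tendsto_scaleR tendsto_add gc_tendsto e_tendsto e1_tendsto b
    christoffel_family_tendsto[OF t k vel_tendsto[OF t k]])

lemma A_sum_tendsto:
  assumes "(V \<longlongrightarrow> V0) (at t within I)"
  shows "((\<lambda>s. \<Sum>b\<in>F. gc \<kappa> s (V s) (e b s) *\<^sub>R perp_e1 b s) \<longlongrightarrow> (\<Sum>b\<in>F. gc \<kappa> t V0 (e b t) *\<^sub>R perp_e1 b t))
      (at t within I)"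
  by (intro tendsto_sum tendsto_scaleR gc_tendsto e_tendsto perp_e1_tendsto assms)

lemma A_regular_tendsto:
  assumes V: "\<And>s. s \<in> I \<Longrightarrow> V s \<in> vert \<Upsilon> s" and lim: "((\<lambda>s. V s \<kappa>) \<longlongrightarrow> V0) (at t within I)"
  defines "S \<equiv> {s\<in>I. riccati_nonsingular \<A> g I c \<Lambda> s}"
  shows "((\<lambda>s. A_regular \<A> g I c \<Upsilon> s (V s) \<kappa>) \<longlongrightarrow> (\<Sum>b\<in>F. gc \<kappa> t V0 (e b t) *\<^sub>R perp_e1 b t)) (at t within S)"
    and "\<forall>\<^sub>F s in at t within S. A_regular \<A> g I c \<Upsilon> s (V s) \<in> TM s"
proof -
  have gg: "\<forall>\<^sub>F s in at t within S. s \<in> S \<and> good s \<and> (\<forall>\<^sub>F r in nhds s. r \<in> I \<longrightarrow> good r)"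
    using ev_good_good unfolding eventually_at_filter by eventually_elim (simp add: S_def)
  have "((\<lambda>s. \<Sum>b\<in>F. gc \<kappa> s (V s \<kappa>) (e b s) *\<^sub>R perp_e1 b s) \<longlongrightarrow> (\<Sum>b\<in>F. gc \<kappa> t V0 (e b t) *\<^sub>R perp_e1 b t))
      (at t within S)"
    using A_sum_tendsto[OF lim] by (rule tendsto_within_subset) (simp add: S_def)
  moreover have "\<forall>\<^sub>F s in at t within S. (\<Sum>b\<in>F. gc \<kappa> s (V s \<kappa>) (e b s) *\<^sub>R perp_e1 b s)
      = A_regular \<A> g I c \<Upsilon> s (V s) \<kappa>"
    using gg
  proof eventually_elim
    case (elim s)
    then show ?case using A_regular_good(2)[of s "V s"] V[of s] by (simp add: S_def)
  qed
  ultimately show "((\<lambda>s. A_regular \<A> g I c \<Upsilon> s (V s) \<kappa>) \<longlongrightarrow> (\<Sum>b\<in>F. gc \<kappa> t V0 (e b t) *\<^sub>R perp_e1 b t))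
      (at t within S)"
    by (rule Lim_transform_eventually)
  show "\<forall>\<^sub>F s in at t within S. A_regular \<A> g I c \<Upsilon> s (V s) \<in> TM s"
    using gg
  proof eventually_elim
    case (elim s)
    then show ?case using A_regular_good(1)[of s "V s"] V[of s] by (simp add: S_def)
  qed
qed

section \<open>The tensor and its adjoint at the parameter itself\<close>

text \<open>At a singular \<open>t\<close> the frame formula is the limit along every admissible
  section, by continuity of \<open>perp_e1\<close> at \<open>t\<close>. It is the only candidate
  because non-singular parameters accumulate at \<open>t\<close> and an admissible section through
  \<open>v\<close> exists.\<close>

lemma A_tensor_frame:
  assumes v: "v \<in> vert \<Upsilon> t"
  shows "A_tensor \<A> g I c \<Lambda> \<Upsilon> t v \<in> TM t"
    and "A_tensor \<A> g I c \<Lambda> \<Upsilon> t v \<kappa> = (\<Sum>b\<in>F. gc \<kappa> t (v \<kappa>) (e b t) *\<^sub>R perp_e1 b t)"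
proof -
  define a where "a = (\<Sum>b\<in>F. gc \<kappa> t (v \<kappa>) (e b t) *\<^sub>R perp_e1 b t)"
  have vT: "v \<in> TM t" by (rule vert_tangent[OF \<Upsilon>(2) t v])
  have "A_tensor \<A> g I c \<Lambda> \<Upsilon> t v \<in> TM t \<and> A_tensor \<A> g I c \<Lambda> \<Upsilon> t v \<kappa> = a"
  proof (cases "riccati_nonsingular \<A> g I c \<Lambda> t")
    case True
    then show ?thesis
      using A_regular_good[OF good_t ev_good True v] by (simp add: A_tensor_def a_def)
  next
    case False
    define S where "S = {s\<in>I. riccati_nonsingular \<A> g I c \<Lambda> s}"
    define w where "w = coord_tvec \<A> \<kappa> (c t) a"
    have wT: "w \<in> TM t" unfolding w_def by (rule coord_tvec_tangent[OF k])
    have wk: "w \<kappa> = a" unfolding w_def by (rule coord_tvec_apply[OF k])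
    have SI: "S \<subseteq> I" by (auto simp: S_def)
    have nontriv: "at t within S \<noteq> bot"
    proof
      assume "at t within S = bot"
      then have "\<forall>\<^sub>F s in at t within S. False" by simp
      then have "\<forall>\<^sub>F s in at t within I. s \<in> S \<longrightarrow> False"
        using SI unfolding eventually_at_filter by (auto elim: eventually_mono)
      moreover have "\<forall>\<^sub>F s in at t within I. s \<in> S"
        using nonsingular_near[OF t] unfolding eventually_at_filter by eventually_elim (simp add: S_def)
      ultimately have "\<forall>\<^sub>F s in at t within I. False" by eventually_elim simp
      then show False using within_nontrivial[OF t] by (simp add: eventually_False)
    qed
    have aorth: "gc \<kappa> t a (e b t) = 0" if "b \<in> F" for b
      unfolding a_def bilinear_sum_left[OF gc_bilinear[OF k]] using proj_orth[OF good_t that]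
        by (simp add: perp_e1_def)
    have wperp: "w \<in> perp_space \<A> g I c \<Upsilon> t"
      unfolding perp_space_def
    proof (intro CollectI conjI ballI wT)
      fix u assume u: "u \<in> vert \<Upsilon> t"
      have "g (c t) w u = gc \<kappa> t a (u \<kappa>)"
        using metric_eq_gc[OF k wT vert_tangent[OF \<Upsilon>(2) t u]] by (simp add: wk)
      also have "\<dots> = 0"
        by (subst vert_component[OF good_t u]) (simp add: bilinear_sum_right[OF gc_bilinear[OF k]] aorth)
      finally show "g (c t) w u = 0" .
    qed
    have wlim: "tendsto_along \<A> c (\<lambda>s. A_regular \<A> g I c \<Upsilon> s (V s)) w t S"
      if V: "\<forall>s\<in>I. V s \<in> vert \<Upsilon> s" "V t = v" "tendsto_along \<A> c V v t I" for V
      unfolding tendsto_along_def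
    proof
      fix \<kappa>' assume k': "\<kappa>' \<in> charts t"
      have l: "((\<lambda>s. V s \<kappa>) \<longlongrightarrow> v \<kappa>) (at t within I)" using V(3) k by (simp add: tendsto_along_def)
      have V': "V s \<in> vert \<Upsilon> s" if "s \<in> I" for s using V(1) that by blast
      show "((\<lambda>s. A_regular \<A> g I c \<Upsilon> s (V s) \<kappa>') \<longlongrightarrow> w \<kappa>') (at t within S)"
      proof (rule field_tendsto_change_chart[where X = "\<lambda>s. A_regular \<A> g I c \<Upsilon> s (V s)", OF t k k' SI _ wT])
        show "\<forall>\<^sub>F s in at t within S. A_regular \<A> g I c \<Upsilon> s (V s) \<in> TM s"
          unfolding S_def by (rule A_regular_tendsto(2)[OF V' l])
        show "((\<lambda>s. A_regular \<A> g I c \<Upsilon> s (V s) \<kappa>) \<longlongrightarrow> w \<kappa>) (at t within S)"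
          unfolding S_def wk a_def by (rule A_regular_tendsto(1)[OF V' l])
      qed
    qed
    have "A_tensor \<A> g I c \<Lambda> \<Upsilon> t v = w"
      unfolding A_tensor_def if_not_P[OF False] S_def[symmetric]
    proof (rule the_equality)
      show "w \<in> perp_space \<A> g I c \<Upsilon> t \<and>
        (\<forall>V. (\<forall>s\<in>I. V s \<in> vert \<Upsilon> s) \<and> V t = v \<and> tendsto_along \<A> c V v t I \<longrightarrow>
           tendsto_along \<A> c (\<lambda>s. A_regular \<A> g I c \<Upsilon> s (V s)) w t S)"
        using wperp wlim by blast
      fix w' assume w': "w' \<in> perp_space \<A> g I c \<Upsilon> t \<and>
        (\<forall>V. (\<forall>s\<in>I. V s \<in> vert \<Upsilon> s) \<and> V t = v \<and> tendsto_along \<A> c V v t I \<longrightarrow>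
           tendsto_along \<A> c (\<lambda>s. A_regular \<A> g I c \<Upsilon> s (V s)) w' t S)"
      have w'T: "w' \<in> TM t" using w' by (simp add: perp_space_def)
      \<comment> \<open>Constant coefficients in the frame give a vertical section that is
        continuous at \<open>t\<close> and passes through \<open>v\<close>. The value 0 at the
        remaining parameters is vertical as well and does not affect the limit, since all parameters
        near \<open>t\<close> are good.\<close>
      define V where "V s = (if s
          = t then v else if good s then coord_tvec \<A> \<kappa> (c s) (\<Sum>b\<in>F. gc \<kappa> t (v \<kappa>) (e b t) *\<^sub>R e b s)
            else 0)" for s
      have Vv: "V s \<in> vert \<Upsilon> s" if "s \<in> I" for s
        using v frame_vert[of s] subspace_0[OF vert_subspace[OF \<Upsilon> that]] by (simp add: V_def)
      have Vlim: "((\<lambda>s. V s \<kappa>) \<longlongrightarrow> v \<kappa>) (at t within I)"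
      proof -
        have "((\<lambda>s. \<Sum>b\<in>F. gc \<kappa> t (v \<kappa>) (e b t) *\<^sub>R e b s) \<longlongrightarrow> (\<Sum>b\<in>F. gc \<kappa> t (v \<kappa>) (e b t) *\<^sub>R e b t))
            (at t within I)"
          by (intro tendsto_sum tendsto_scaleR tendsto_const e_tendsto)
        then have "((\<lambda>s. \<Sum>b\<in>F. gc \<kappa> t (v \<kappa>) (e b t) *\<^sub>R e b s) \<longlongrightarrow> v \<kappa>) (at t within I)"
          using vert_component[OF good_t v] by simp
        moreover have "\<forall>\<^sub>F s in at t within I. (\<Sum>b\<in>F. gc \<kappa> t (v \<kappa>) (e b t) *\<^sub>R e b s) = V s \<kappa>"
          using ev_good unfolding eventually_at_filter
          by eventually_elim (simp add: V_def coord_tvec_apply[OF good_chart])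
        ultimately show ?thesis by (rule Lim_transform_eventually)
      qed
      have "tendsto_along \<A> c V v t I"
        unfolding tendsto_along_def
      proof
        fix \<kappa>' assume k': "\<kappa>' \<in> charts t"
        show "((\<lambda>s. V s \<kappa>') \<longlongrightarrow> v \<kappa>') (at t within I)"
        proof (rule field_tendsto_change_chart[where X = V, OF t k k' order_refl _ vT Vlim])
          show "\<forall>\<^sub>F s in at t within I. V s \<in> TM s"
            unfolding eventually_at_filter
            by (rule always_eventually) (use vert_tangent[OF \<Upsilon>(2) _ Vv] in blast)
        qed
      qed
      moreover have "V t = v" by (simp add: V_def)
      ultimately have "tendsto_along \<A> c (\<lambda>s. A_regular \<A> g I c \<Upsilon> s (V s)) w' t S"
        using w' Vv by blast
      then have "((\<lambda>s. A_regular \<A> g I c \<Upsilon> s (V s) \<kappa>) \<longlongrightarrow> w' \<kappa>) (at t within S)"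
        using k by (simp add: tendsto_along_def)
      moreover have "((\<lambda>s. A_regular \<A> g I c \<Upsilon> s (V s) \<kappa>) \<longlongrightarrow> a) (at t within S)"
        unfolding S_def a_def by (rule A_regular_tendsto(1)[OF Vv Vlim])
      ultimately have "w' \<kappa> = w \<kappa>" using tendsto_unique[OF nontriv] wk by metis
      then show "w' = w" by (rule tangent_eqI[OF w'T wT k])
    qed
    then show ?thesis using wT wk by simp
  qed
  then show "A_tensor \<A> g I c \<Lambda> \<Upsilon> t v \<in> TM t"
    "A_tensor \<A> g I c \<Lambda> \<Upsilon> t v \<kappa> = (\<Sum>b\<in>F. gc \<kappa> t (v \<kappa>) (e b t) *\<^sub>R perp_e1 b t)" by (simp_all add: a_def)
qed

text \<open>Existence is read off from the frame formula, in which \<open>perp_e1 b t\<close> is the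
  image of \<open>e b t\<close>. Uniqueness follows by testing with the difference of two
  candidates, which is vertical.\<close>

lemma A_adjoint_frame:
  assumes w: "w \<in> TM t"
  shows "A_adjoint \<A> g I c \<Lambda> \<Upsilon> t w \<in> vert \<Upsilon> t"
    and "A_adjoint \<A> g I c \<Lambda> \<Upsilon> t w \<kappa> = (\<Sum>b\<in>F. gc \<kappa> t (perp_e1 b t) (w \<kappa>) *\<^sub>R e b t)"
proof -
  define v where "v = coord_tvec \<A> \<kappa> (c t) (\<Sum>b\<in>F. gc \<kappa> t (perp_e1 b t) (w \<kappa>) *\<^sub>R e b t)"
  have v: "v \<in> vert \<Upsilon> t" unfolding v_def by (rule frame_vert[OF good_t])
  have vk: "v \<kappa> = (\<Sum>b\<in>F. gc \<kappa> t (perp_e1 b t) (w \<kappa>) *\<^sub>R e b t)" unfolding v_def by (rule coord_tvec_apply[OF k])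
  note B = gc_bilinear[OF k] and vT = vert_tangent[OF \<Upsilon>(2) t]
  have adj: "g (c t) (A_tensor \<A> g I c \<Lambda> \<Upsilon> t u) w = g (c t) u v" if u: "u \<in> vert \<Upsilon> t" for u
  proof -
    have "g (c t) (A_tensor \<A> g I c \<Lambda> \<Upsilon> t u) w = (\<Sum>b\<in>F. gc \<kappa> t (u \<kappa>) (e b t) * gc \<kappa> t (perp_e1 b t) (w \<kappa>))"
      unfolding metric_eq_gc[OF k A_tensor_frame(1)[OF u] w] A_tensor_frame(2)[OF u]
      by (simp add: bilinear_sum_left[OF B])
    also have "\<dots> = g (c t) u v"
      unfolding metric_eq_gc[OF k vT[OF u] vT[OF v]] vk by (simp add: bilinear_sum_right[OF B] mult.commute)
    finally show ?thesis .
  qed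
  have "A_adjoint \<A> g I c \<Lambda> \<Upsilon> t w = v"
    unfolding A_adjoint_def
  proof (rule the_equality)
    show "v \<in> vert \<Upsilon> t \<and> (\<forall>u\<in>vert \<Upsilon> t. g (c t) (A_tensor \<A> g I c \<Lambda> \<Upsilon> t u) w = g (c t) u v)"
      using v adj by blast
    fix v' assume v': "v' \<in> vert \<Upsilon> t \<and> (\<forall>u\<in>vert \<Upsilon> t. g (c t) (A_tensor \<A> g I c \<Lambda> \<Upsilon> t u) w = g (c t) u v')"
    have d: "v' - v \<in> vert \<Upsilon> t" using subspace_diff[OF vert_subspace[OF \<Upsilon> t]] v v' by blast
    have "g (c t) (v' - v) v' = g (c t) (v' - v) v" using v' adj[OF d] d by metis
    then have "gc \<kappa> t ((v' - v) \<kappa>) (v' \<kappa>) = gc \<kappa> t ((v' - v) \<kappa>) (v \<kappa>)"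
      using metric_eq_gc[OF k vT[OF d] vT] v v' by simp
    then have "gc \<kappa> t ((v' - v) \<kappa>) ((v' - v) \<kappa>) = 0" by (simp add: bilinear_rsub[OF B])
    then have "(v' - v) \<kappa> = 0" using gc_pos[OF k, of "(v' - v) \<kappa>"] by force
    then have "v' \<kappa> = v \<kappa>" by simp
    then show "v' = v" using tangent_eqI[OF vT vT k] v v' by blast
  qed
  then show "A_adjoint \<A> g I c \<Lambda> \<Upsilon> t w \<in> vert \<Upsilon> t"
    "A_adjoint \<A> g I c \<Lambda> \<Upsilon> t w \<kappa> = (\<Sum>b\<in>F. gc \<kappa> t (perp_e1 b t) (w \<kappa>) *\<^sub>R e b t)" using v vk by simp_all
qed

end

section \<open>The transverse Jacobi equation\<close>

context framed
begin

text \<open>\<open>H\<close> stands for \<open>J - L\<close>, corrected at the fixed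
  \<open>t\<close>, whereas \<open>Y\<close> is the given perpendicular field. The last assumption
  links them at all good parameters, since subtracting a field of \<open>\<Upsilon>\<close> does not
  alter the perpendicular part.\<close>

context
  fixes H :: "real \<Rightarrow> ('m, 'e) tvec" and Y :: "real \<Rightarrow> ('m, 'e) tvec"
  assumes H: "H \<in> \<Lambda>"
    and H_orth: "\<And>b. b \<in> F \<Longrightarrow> gc \<kappa> t (H t \<kappa>) (e b t) = 0"
    and H_cov: "\<And>b. b \<in> F \<Longrightarrow> gc \<kappa> t (cov H t \<kappa>) (e b t) = gc \<kappa> t (H t \<kappa>) (e1 b t + \<Gamma>c \<kappa> t (e b t))"
    and Y_good: "\<And>s. good s \<Longrightarrow> Y s \<in> TM s \<and> Y s \<kappa> = proj s (H s \<kappa>)"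
begin

definition coeff :: "'e \<Rightarrow> real \<Rightarrow> real" where "coeff b s = gc \<kappa> s (H s \<kappa>) (e b s)"

definition cov_coeff :: "'e \<Rightarrow> real \<Rightarrow> real" where "cov_coeff b s = gc \<kappa> s (cov H s \<kappa>) (e b s)"

definition coeff_deriv :: "'e \<Rightarrow> real \<Rightarrow> real"
  where "coeff_deriv b s = cov_coeff b s + gc \<kappa> s (H s \<kappa>) (e1 b s + \<Gamma>c \<kappa> s (e b s))"

abbreviation Z :: "real \<Rightarrow> ('m, 'e) tvec" where "Z \<equiv> perp_deriv \<A> g I c \<Upsilon> Y"

lemma ev_tangent_Y: "\<forall>\<^sub>F r in nhds s. r \<in> I \<longrightarrow> Y r \<in> TM r" if "\<forall>\<^sub>F r in nhds s. r \<in> I \<longrightarrow> good r"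
  using that by eventually_elim (simp add: Y_good)

lemma Y_has_vd:
  assumes s: "good s" and near: "\<forall>\<^sub>F r in nhds s. r \<in> I \<longrightarrow> good r"
  shows "((\<lambda>r. Y r \<kappa>) has_vector_derivative (cov H s \<kappa> - \<Gamma>c \<kappa> s (H s \<kappa>))
     - (\<Sum>b\<in>F. coeff b s *\<^sub>R e1 b s + coeff_deriv b s *\<^sub>R e b s)) (at s within I)"
proof -
  note sI = good_I[OF s] and ks = good_chart[OF s]
  have "((\<lambda>r. H r \<kappa> - (\<Sum>b\<in>F. coeff b r *\<^sub>R e b r)) has_vector_derivative (cov H s \<kappa> - \<Gamma>c \<kappa> s (H s \<kappa>))
     - (\<Sum>b\<in>F. coeff b s *\<^sub>R e1 b s + coeff_deriv b s *\<^sub>R e b s)) (at s within I)"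
    unfolding coeff_def coeff_deriv_def cov_coeff_def
    by (intro has_vector_derivative_diff has_vector_derivative_sum has_vector_derivative_scaleR
        coefficient_has_vd[OF s H] good_vd[OF s] jacobi_has_vd(1)[OF \<Lambda>_jacobi[OF H] sI ks])
  moreover have "\<forall>\<^sub>F r in nhds s. r \<in> I \<longrightarrow> H r \<kappa> - (\<Sum>b\<in>F. coeff b r *\<^sub>R e b r) = Y r \<kappa>"
    using near by eventually_elim (simp add: Y_good proj_def coeff_def)
  ultimately show ?thesis
    using has_vector_derivative_within_cong_ev[where f = "\<lambda>r. H r \<kappa> - (\<Sum>b\<in>F. coeff b r *\<^sub>R e b r)"
      and g = "\<lambda>r. Y r \<kappa>", OF _ sI] by simp
qed

text \<open>The terms with \<open>coeff_deriv\<close> are vertical and disappear under the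
  projection, and the sum with \<open>cov_coeff\<close> is the vertical part of
  \<open>cov H\<close>. In this form every summand can be differentiated once more at
  \<open>t\<close>.\<close>

lemma Y_cov:
  assumes s: "good s" and near: "\<forall>\<^sub>F r in nhds s. r \<in> I \<longrightarrow> good r"
  shows "cov_differentiable \<A> I c Y s" and "Z s \<in> TM s"
    and "Z s \<kappa> = cov H s \<kappa> - (\<Sum>b\<in>F. cov_coeff b s *\<^sub>R e b s) - (\<Sum>b\<in>F. coeff b s *\<^sub>R perp_e1 b s)"
proof -
  note sI = good_I[OF s] and ks = good_chart[OF s] and gl = \<Gamma>c_linear[OF good_chart[OF s]]
    and pl = proj_linear[OF s]
  note D = Y_has_vd[OF s near]
  show "cov_differentiable \<A> I c Y s"
    by (rule cov_differentiableI(1)[OF sI ks ev_tangent_Y[OF near] differentiableI_vector[OF D]])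
  have cT: "cov Y s \<in> TM s"
    by (rule cov_differentiableI(2)[OF sI ks ev_tangent_Y[OF near] differentiableI_vector[OF D]])
  show "Z s \<in> TM s" unfolding perp_deriv_def by (rule perp_good(1)[OF s cT])
  have "\<Gamma>c \<kappa> s (Y s \<kappa>) = \<Gamma>c \<kappa> s (H s \<kappa>) - (\<Sum>b\<in>F. coeff b s *\<^sub>R \<Gamma>c \<kappa> s (e b s))"
    using Y_good[OF s] by (simp add: proj_def coeff_def linear_diff[OF gl] linear_sum[OF gl]
      linear_scale[OF gl])
  with cov_apply[where X = Y, OF sI ks D]
  have c: "cov Y s \<kappa> = cov H s \<kappa> - (\<Sum>b\<in>F. coeff b s *\<^sub>R (e1 b s + \<Gamma>c \<kappa> s (e b s)))
      - (\<Sum>b\<in>F. coeff_deriv b s *\<^sub>R e b s)"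
    by (simp add: sum.distrib scaleR_right_distrib)
  have "Z s \<kappa> = proj s (cov Y s \<kappa>)" unfolding perp_deriv_def by (rule perp_good(2)[OF s cT])
  also have "\<dots> = proj s (cov H s \<kappa>) - (\<Sum>b\<in>F. coeff b s *\<^sub>R perp_e1 b s)"
    unfolding c linear_diff[OF pl] linear_sum[OF pl] linear_scale[OF pl] perp_e1_def[symmetric]
    using proj_frame[OF s] by simp
  finally show "Z s \<kappa> = cov H s \<kappa> - (\<Sum>b\<in>F. cov_coeff b s *\<^sub>R e b s) - (\<Sum>b\<in>F. coeff b s *\<^sub>R perp_e1 b s)"
    by (simp add: proj_def cov_coeff_def)
qed

lemma coeff_t: "b \<in> F \<Longrightarrow> coeff b t = 0"
  by (simp add: coeff_def H_orth)

text \<open>At \<open>t\<close> the field \<open>H\<close> is perpendicular to the frame, so in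
  \<open>H_cov\<close> only the perpendicular part of the derivative of \<open>e b\<close> counts.
  These numbers are the frame coefficients of the adjoint applied to \<open>Y\<close>.\<close>

lemma cov_coeff_t: "b \<in> F \<Longrightarrow> cov_coeff b t = gc \<kappa> t (H t \<kappa>) (perp_e1 b t)"
  using H_orth by (simp add: cov_coeff_def H_cov perp_e1_def proj_def bilinear_rsub[OF gc_bilinear[OF
    k]] bilinear_sum_right[OF gc_bilinear[OF k]])

text \<open>Differentiating \<open>coeff\<close> gives one term from \<open>cov H\<close> and one
  from the frame; \<open>H_cov\<close> makes them equal at \<open>t\<close>.\<close>

lemma coeff_deriv_t: "b \<in> F \<Longrightarrow> coeff_deriv b t = 2 * cov_coeff b t"
  using H_cov by (simp add: coeff_deriv_def cov_coeff_def)

text \<open>The products of \<open>coeff b\<close> and \<open>perp_e1 b\<close> are differentiable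
  at \<open>t\<close> because \<open>coeff b t = 0\<close>. The numbers \<open>h1 b\<close> remain
  unspecified, as they multiply frame vectors that the final projection removes.\<close>

lemma Z_has_vd:
  obtains h1 where "((\<lambda>s. Z s \<kappa>) has_vector_derivative (cov (cov H) t \<kappa> - \<Gamma>c \<kappa> t (cov H t \<kappa>))
     - (\<Sum>b\<in>F. cov_coeff b t *\<^sub>R e1 b t + h1 b *\<^sub>R e b t) - (\<Sum>b\<in>F. coeff_deriv b t *\<^sub>R perp_e1 b t)) (at
       t within I)"
proof -
  define h1 where "h1 b = gc \<kappa> t (cov (cov H) t \<kappa>) (e b t) + gc \<kappa> t (cov H t \<kappa>) (e1 b t + \<Gamma>c \<kappa> t (e b t))" for b
  note J = \<Lambda>_jacobi[OF H]
  have hd: "(cov_coeff b has_real_derivative h1 b) (at t within I)" if b: "b \<in> F" for b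
    unfolding cov_coeff_def h1_def
    using gc_has_derivative[OF t k jacobi_cov_has_vd(1)[OF J t k] good_vd[OF good_t b]] by simp
  have fd: "(coeff b has_real_derivative coeff_deriv b t) (at t within I)" if b: "b \<in> F" for b
    unfolding coeff_def coeff_deriv_def cov_coeff_def by (rule coefficient_has_vd[OF good_t H b])
  have "((\<lambda>s. cov H s \<kappa> - (\<Sum>b\<in>F. cov_coeff b s *\<^sub>R e b s)
      - (\<Sum>b\<in>F. coeff b s *\<^sub>R perp_e1 b s)) has_vector_derivative
     (cov (cov H) t \<kappa> - \<Gamma>c \<kappa> t (cov H t \<kappa>))
     - (\<Sum>b\<in>F. cov_coeff b t *\<^sub>R e1 b t + h1 b *\<^sub>R e b t) - (\<Sum>b\<in>F. coeff_deriv b t *\<^sub>R perp_e1 b t)) (at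
       t within I)"
  proof (intro has_vector_derivative_diff jacobi_cov_has_vd(1)[OF J t k])
    show "((\<lambda>s. \<Sum>b\<in>F. cov_coeff b s *\<^sub>R e b s) has_vector_derivative (\<Sum>b\<in>F. cov_coeff b t *\<^sub>R e1 b t
        + h1 b *\<^sub>R e b t)) (at t within I)"
      by (intro has_vector_derivative_sum has_vector_derivative_scaleR hd good_vd[OF good_t])
    show "((\<lambda>s. \<Sum>b\<in>F. coeff b s *\<^sub>R perp_e1 b s) has_vector_derivative (\<Sum>b\<in>F. coeff_deriv b t *\<^sub>R
        perp_e1 b t)) (at t within I)"
      by (intro has_vector_derivative_sum has_vector_derivative_scaleR_vanishing fd coeff_t perp_e1_tendsto)
  qed
  moreover have "\<forall>\<^sub>F s in nhds t. s \<in> I \<longrightarrow> cov H s \<kappa> - (\<Sum>b\<in>F. cov_coeff b s *\<^sub>R e b s)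
      - (\<Sum>b\<in>F. coeff b s *\<^sub>R perp_e1 b s) = Z s \<kappa>"
    using ev_good_good by eventually_elim (simp add: Y_cov(3))
  ultimately have "((\<lambda>s. Z s \<kappa>) has_vector_derivative (cov (cov H) t \<kappa> - \<Gamma>c \<kappa> t (cov H t \<kappa>))
     - (\<Sum>b\<in>F. cov_coeff b t *\<^sub>R e1 b t + h1 b *\<^sub>R e b t) - (\<Sum>b\<in>F. coeff_deriv b t *\<^sub>R perp_e1 b t)) (at
       t within I)"
    using has_vector_derivative_within_cong_ev[where
      f = "\<lambda>s. cov H s \<kappa> - (\<Sum>b\<in>F. cov_coeff b s *\<^sub>R e b s) - (\<Sum>b\<in>F. coeff b s *\<^sub>R perp_e1 b s)"
        and g = "\<lambda>s. Z s \<kappa>", OF _ t] by simp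
  then show ?thesis by (rule that)
qed

lemma ev_tangent_Z: "\<forall>\<^sub>F s in nhds t. s \<in> I \<longrightarrow> Z s \<in> TM s"
  using ev_good_good by eventually_elim (simp add: Y_cov(2))

lemma transverse_jacobi_at:
  "cov_differentiable \<A> I c Y t \<and> cov_differentiable \<A> I c Z t \<and>
   perp_deriv \<A> g I c \<Upsilon> Z t + perp \<A> g I c \<Upsilon> t (curvature \<A> g (c t) (Y t) (vel t) (vel t))
   + 3 *\<^sub>R A_tensor \<A> g I c \<Lambda> \<Upsilon> t (A_adjoint \<A> g I c \<Lambda> \<Upsilon> t (Y t)) = 0"
proof (intro conjI)
  note J = \<Lambda>_jacobi[OF H] and gl = \<Gamma>c_linear[OF k] and pl = proj_linear[OF good_t] and B = gc_bilinear[OF k]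
  obtain h1 where D: "((\<lambda>s. Z s \<kappa>) has_vector_derivative (cov (cov H) t \<kappa> - \<Gamma>c \<kappa> t (cov H t \<kappa>))
     - (\<Sum>b\<in>F. cov_coeff b t *\<^sub>R e1 b t + h1 b *\<^sub>R e b t) - (\<Sum>b\<in>F. coeff_deriv b t *\<^sub>R perp_e1 b t)) (at
       t within I)"
    by (rule Z_has_vd)
  show "cov_differentiable \<A> I c Y t" by (rule Y_cov(1)[OF good_t ev_good])
  show "cov_differentiable \<A> I c Z t"
    by (rule cov_differentiableI(1)[OF t k ev_tangent_Z differentiableI_vector[OF D]])
  have cT: "cov Z t \<in> TM t"
    by (rule cov_differentiableI(2)[OF t k ev_tangent_Z differentiableI_vector[OF D]])
  \<comment> \<open>In \<open>part3\<close> this becomes the component of the tensor applied to its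
    adjoint at \<open>Y t\<close>.\<close>
  define q where "q = (\<Sum>b\<in>F. cov_coeff b t *\<^sub>R perp_e1 b t)"
  have "\<Gamma>c \<kappa> t (Z t \<kappa>) = \<Gamma>c \<kappa> t (cov H t \<kappa>) - (\<Sum>b\<in>F. cov_coeff b t *\<^sub>R \<Gamma>c \<kappa> t (e b t))"
    using coeff_t by (simp add: Y_cov(3)[OF good_t ev_good] linear_diff[OF gl] linear_sum[OF gl]
      linear_scale[OF gl])
  with cov_apply[where X = Z, OF t k D]
  have c: "cov Z t \<kappa> = cov (cov H) t \<kappa> - (\<Sum>b\<in>F. cov_coeff b t *\<^sub>R (e1 b t + \<Gamma>c \<kappa> t (e b t)))
      - (\<Sum>b\<in>F. h1 b *\<^sub>R e b t) - (\<Sum>b\<in>F. coeff_deriv b t *\<^sub>R perp_e1 b t)"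
    by (simp add: sum.distrib scaleR_right_distrib)
  have f1q: "(\<Sum>b\<in>F. coeff_deriv b t *\<^sub>R perp_e1 b t) = 2 *\<^sub>R q"
    unfolding q_def scaleR_sum_right by (rule sum.cong) (simp_all add: coeff_deriv_t)
  have Prq: "proj t q = q"
    unfolding q_def linear_sum[OF pl] linear_scale[OF pl] proj_perp_e1[OF good_t] ..
  \<comment> \<open>One copy of \<open>q\<close> comes from differentiating the frame in the sum
    with \<open>cov_coeff\<close>, two from \<open>coeff_deriv_t\<close>.\<close>
  have "proj t (cov Z t \<kappa>) = proj t (cov (cov H) t \<kappa>) - q - proj t (2 *\<^sub>R q)"
    unfolding c f1q linear_diff[OF pl] linear_sum[OF pl] linear_scale[OF pl] perp_e1_def[symmetric]
      q_def[symmetric]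
    using proj_frame[OF good_t] by simp
  then have part1: "perp_deriv \<A> g I c \<Upsilon> Z t \<kappa> = proj t (cov (cov H) t \<kappa>) - 3 *\<^sub>R q"
    unfolding perp_deriv_def perp_good(2)[OF good_t cT, unfolded perp_deriv_def] linear_scale[OF pl] Prq
    using scaleR_left_distrib[of 1 2 q] by (simp add: diff_diff_eq)
  have T1: "perp_deriv \<A> g I c \<Upsilon> Z t \<in> TM t"
    using perp_good(1)[OF good_t cT] by (simp add: perp_deriv_def)
  have YT: "Y t \<in> TM t" and Yk: "Y t \<kappa> = H t \<kappa>"
    using Y_good[OF good_t] proj_fix[OF H_orth] by simp_all
  \<comment> \<open>Perpendicularity of \<open>H\<close> at \<open>t\<close> makes \<open>Y\<close>
    coincide there with a Jacobi field, so the curvature term is given by the Jacobi equation of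
    \<open>H\<close>.\<close>
  have "Y t = H t" by (rule tangent_eqI[OF YT \<Lambda>_tangent[OF H t] k Yk])
  then have R: "curvature \<A> g (c t) (Y t) (vel t) (vel t) = - cov (cov H) t"
    using jacobi_equation[OF J t] by (simp add: add_eq_0_iff)
  have RT: "- cov (cov H) t \<in> TM t"
    using tangent_scale[OF jacobi_cov_has_vd(2)[OF J t k], of "-1"] by simp
  have part2: "perp \<A> g I c \<Upsilon> t (curvature \<A> g (c t) (Y t) (vel t) (vel t)) \<kappa> = - proj t (cov (cov H) t \<kappa>)"
    unfolding R perp_good(2)[OF good_t RT] by (simp add: linear_neg[OF pl])
  have T2: "perp \<A> g I c \<Upsilon> t (curvature \<A> g (c t) (Y t) (vel t) (vel t)) \<in> TM t"
    unfolding R by (rule perp_good(1)[OF good_t RT])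
  let ?v = "A_adjoint \<A> g I c \<Lambda> \<Upsilon> t (Y t)"
  note v = A_adjoint_frame[OF YT]
  have "A_tensor \<A> g I c \<Lambda> \<Upsilon> t ?v \<kappa> = (\<Sum>b\<in>F. gc \<kappa> t (perp_e1 b t) (Y t \<kappa>) *\<^sub>R perp_e1 b t)"
    unfolding A_tensor_frame(2)[OF v(1)] v(2)
    using frame_sum[OF good_t] by (intro sum.cong) (simp_all add: bilinear_sum_left[OF B])
  also have "\<dots> = q"
    unfolding q_def using gc_sym[OF k] by (intro sum.cong) (simp_all add: cov_coeff_t Yk)
  finally have part3: "A_tensor \<A> g I c \<Lambda> \<Upsilon> t ?v \<kappa> = q" .
  note T3 = A_tensor_frame(1)[OF v(1)]
  show "perp_deriv \<A> g I c \<Upsilon> Z t + perp \<A> g I c \<Upsilon> t (curvature \<A> g (c t) (Y t) (vel t) (vel t))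
    + 3 *\<^sub>R A_tensor \<A> g I c \<Lambda> \<Upsilon> t ?v = 0"
    by (rule tangent_eqI[OF tangent_add[OF tangent_add[OF T1 T2] tangent_scale[OF T3]] tangent_zero k])
      (simp add: part1 part2 part3 scaleR_fun_apply)
qed

end

end

theorem theorem9:
  fixes \<A> :: "('m::{t2_space,second_countable_topology}, 'e::euclidean_space) chart set"
    and g :: "('m, 'e) metric"
    and I :: "real set"
    and c :: "real \<Rightarrow> 'm"
    and \<Lambda> \<Upsilon> :: "(real \<Rightarrow> ('m, 'e) tvec) set"
    and J Y :: "real \<Rightarrow> ('m, 'e) tvec"
  assumes "riemannian_manifold \<A> g"
    and "is_interval I"
    and "geodesic \<A> g I c"
    and "\<not> c constant_on I"
    and "subspace \<Lambda>"
    and "dim \<Lambda> = DIM('e) - 1"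
    and "\<forall>K\<in>\<Lambda>. normal_jacobi_field \<A> g I c K"
    and "riccati_self_adjoint \<A> g I c \<Lambda>"
    and "subspace \<Upsilon>"
    and "\<Upsilon> \<subseteq> \<Lambda>"
    and "J \<in> \<Lambda> - \<Upsilon>"
    and "Y = (\<lambda>t. perp \<A> g I c \<Upsilon> t (J t))"
  shows "\<forall>t\<in>I.
      cov_differentiable \<A> I c Y t \<and>
      cov_differentiable \<A> I c (perp_deriv \<A> g I c \<Upsilon> Y) t \<and>
      perp_deriv \<A> g I c \<Upsilon> (perp_deriv \<A> g I c \<Upsilon> Y) t
      + perp \<A> g I c \<Upsilon> t (curvature \<A> g (c t) (Y t) (velocity \<A> I c t) (velocity \<A> I c t))
      + 3 *\<^sub>R A_tensor \<A> g I c \<Lambda> \<Upsilon> t (A_adjoint \<A> g I c \<Lambda> \<Upsilon> t (Y t)) = 0"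
proof
  fix t assume t: "t \<in> I"
  interpret lagrangian \<A> g I c \<Lambda>
    by unfold_locales (fact assms)+
  obtain \<kappa> where k: "\<kappa> \<in> charts t" using chart_exists[OF t] .
  obtain F K e where ad: "adapted \<kappa> t \<Upsilon> F K e"
    using adapted_frame_exists[OF t k assms(9,10)] by (elim exE)
  interpret framed \<A> g I c \<Lambda> \<Upsilon> t \<kappa> F K e
    by unfold_locales (fact assms t k ad)+
  have J: "J \<in> \<Lambda>" using assms(11) by simp
  \<comment> \<open>The correction depends on \<open>t\<close>, like the chart and the frame: the
    equation is obtained one parameter at a time.\<close>
  have "\<exists>L\<in>\<Upsilon>. \<forall>b\<in>F. gc \<kappa> t ((J - L) t \<kappa>) (e b t) = 0 \<and>
       (\<forall>D. (e b has_vector_derivative D) (at t within I) \<longrightarrow>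
         gc \<kappa> t (cov (J - L) t \<kappa>) (e b t) = gc \<kappa> t ((J - L) t \<kappa>) (D + \<Gamma>c \<kappa> t (e b t)))"
    using ad J unfolding adapted_def by blast
  then obtain L where L: "L \<in> \<Upsilon>" and adj: "\<forall>b\<in>F. gc \<kappa> t ((J - L) t \<kappa>) (e b t) = 0 \<and>
       (\<forall>D. (e b has_vector_derivative D) (at t within I) \<longrightarrow>
         gc \<kappa> t (cov (J - L) t \<kappa>) (e b t) = gc \<kappa> t ((J - L) t \<kappa>) (D + \<Gamma>c \<kappa> t (e b t)))"
    by (elim bexE)
  have L\<Lambda>: "L \<in> \<Lambda>" using L assms(10) by blast
  show "cov_differentiable \<A> I c Y t \<and>
      cov_differentiable \<A> I c (perp_deriv \<A> g I c \<Upsilon> Y) t \<and>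
      perp_deriv \<A> g I c \<Upsilon> (perp_deriv \<A> g I c \<Upsilon> Y) t
      + perp \<A> g I c \<Upsilon> t (curvature \<A> g (c t) (Y t) (velocity \<A> I c t) (velocity \<A> I c t))
      + 3 *\<^sub>R A_tensor \<A> g I c \<Lambda> \<Upsilon> t (A_adjoint \<A> g I c \<Lambda> \<Upsilon> t (Y t)) = 0"
  proof (rule transverse_jacobi_at[where H = "J - L"])
    show "J - L \<in> \<Lambda>" by (rule subspace_diff[OF assms(5) J L\<Lambda>])
    show "gc \<kappa> t ((J - L) t \<kappa>) (e b t) = 0" if "b \<in> F" for b using adj that by blast
    show "gc \<kappa> t (cov (J - L) t \<kappa>) (e b t) = gc \<kappa> t ((J - L) t \<kappa>) (e1 b t + \<Gamma>c \<kappa> t (e b t))" if "b \<in> F" for b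
      using adj that good_vd[OF good_t that] by blast
    fix s assume s: "good s"
    have JT: "J s \<in> TM s" by (rule \<Lambda>_tangent[OF J good_I[OF s]])
    \<comment> \<open>\<open>L\<close> is vertical at every good \<open>s\<close>, so
      \<open>J\<close> and \<open>J - L\<close> have the same perpendicular part near
      \<open>t\<close> and not only at \<open>t\<close>, as two derivatives of \<open>Y\<close>
      require.\<close>
    have "proj s (L s \<kappa>) = 0" by (rule vert_proj[OF s vertI1[OF assms(9,10) good_I[OF s] L]])
    then have "proj s (J s \<kappa>) = proj s ((J - L) s \<kappa>)" by (simp add: linear_diff[OF proj_linear[OF s]])
    then show "Y s \<in> TM s \<and> Y s \<kappa> = proj s ((J - L) s \<kappa>)"
      unfolding assms(12) using perp_good[OF s JT] by simp
  qed
qed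

end
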